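(* For positive integers $h$ and $w$, the following two identities hold: $$ \sum_{\substack{\lambda:\ \ell(\lambda)\le 2h+1\\ \lambda_1-\lambda_{2h+1}\le w}}\ \sum_{\substack{k_1,\dots,k_{2h+1}\in\mathbb Z\\ k_1+\dots+k_{2h+1}=0}} \det_{1\le i,j\le 2h+1}\left(e_{\lambda_i-i+j+(2h+w+1)k_i}(\mathbf x)\right) =\sum_{k\ge 0}e_k(\mathbf x)\sum_{k_1,\dots,k_h\in\mathbb Z}\det_{1\le i,j\le h}\left(f_{-i+j+(2h+w+1)k_i}(\mathbf x)-f_{i+j+(2h+w+1)k_i}(\mathbf x)\right) $$ and $$ \sum_{\substack{\lambda:\ \ell(\lambda)\le 2h\\ \lambda_1-\lambda_{2h}\le w}}\ \sum_{\substack{k_1,\dots,k_{2h}\in\mathbb Z\\ k_1+\dots+k_{2h}=0}} \det_{1\le i,j\le 2h}\left(e_{\lambda_i-i+j+(2h+w)k_i}(\mathbf x)\right) =\sum_{k_1,\dots,k_h\in\mathbb Z}(-1)^{\sum_{i=1}^h k_i}\det_{1\le i,j\le h}\left(f_{-i+j+(2h+w)k_i}(\mathbf x)+f_{i+j-1+(2h+w)k_i}(\mathbf x)\right). $$ Here the outer sums on the left-hand sides are over partitions $\lambda$.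
   Context: $\mathbf x=\{x_1,x_2,\dots\}$ is a set of variables, and the identities are identities of formal power series in these variables. $e_n(\mathbf x)=\sum_{i_1<\dots<i_n}x_{i_1}\cdots x_{i_n}$ is the $n$-th elementary symmetric function, with $e_0(\mathbf x)=1$ and $e_n(\mathbf x)=0$ for $n<0$. For $r\in\mathbb Z$, $f_r(\mathbf x)=\sum_{n\in\mathbb Z}e_n(\mathbf x)e_{n+r}(\mathbf x)$. A partition $\lambda=(\lambda_1\ge\lambda_2\ge\cdots)$ has length $\ell(\lambda)$ equal to its number of positive parts, and $\lambda_i=0$ for $i>\ell(\lambda)$; the empty partition is included. *)

theory Defs
  imports
    "HOL-Library.Poly_Mapping"
    "HOL-Library.FuncSet"
    "Jordan_Normal_Form.Determinant"
begin

section \<open>Formal power series in countably many variables\<close>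

text \<open>
  A monomial is a finitely supported exponent vector \<open>nat \<Rightarrow>\<^sub>0 nat\<close>; the variables
  $x_1, x_2, \ldots$ are indexed by \<open>0, 1, \<dots>\<close>. A formal power series is an arbitrary
  family of coefficients, one for each monomial.
\<close>

typedef 'a mfps = "UNIV :: ((nat \<Rightarrow>\<^sub>0 nat) \<Rightarrow> 'a) set"
  morphisms mcoeff Abs_mfps
  by simp

lemma mcoeff_Abs [simp]: "mcoeff (Abs_mfps f) = f"
  by (simp add: Abs_mfps_inverse)

lemma mfps_eqI: "(\<And>m. mcoeff f m = mcoeff g m) \<Longrightarrow> f = g"
  by (metis ext mcoeff_inject)

definition splits :: "(nat \<Rightarrow>\<^sub>0 nat) \<Rightarrow> ((nat \<Rightarrow>\<^sub>0 nat) \<times> (nat \<Rightarrow>\<^sub>0 nat)) set" where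
  "splits m = {(a, b). a + b = m}"

lemma finite_splits [simp]: "finite (splits m)"
proof -
  define L where "L = PiE (Poly_Mapping.keys m) (\<lambda>i. {..Poly_Mapping.lookup m i})"
  have "finite L"
    unfolding L_def by (intro finite_PiE) auto
  moreover have "inj_on (\<lambda>(a, b). restrict (Poly_Mapping.lookup a) (Poly_Mapping.keys m)) (splits m)"
  proof (rule inj_onI, clarify)
    fix a b c d
    assume s: "(a, b) \<in> splits m" "(c, d) \<in> splits m"
      and r: "restrict (Poly_Mapping.lookup a) (Poly_Mapping.keys m) = restrict (Poly_Mapping.lookup c) (Poly_Mapping.keys m)"
    have eqs: "a + b = m" "c + d = m"
      using s by (auto simp: splits_def)
    have "Poly_Mapping.lookup a i = Poly_Mapping.lookup c i" for i
    proof (cases "i \<in> Poly_Mapping.keys m")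
      case True
      then show ?thesis using r by (metis restrict_apply')
    next
      case False
      then have "Poly_Mapping.lookup (a + b) i = 0" "Poly_Mapping.lookup (c + d) i = 0"
        using eqs by (auto simp: in_keys_iff)
      then show ?thesis by (simp add: lookup_add)
    qed
    then have "a = c" by (rule poly_mapping_eqI)
    with eqs show "a = c \<and> b = d" by auto
  qed
  moreover have "(\<lambda>(a, b). restrict (Poly_Mapping.lookup a) (Poly_Mapping.keys m)) ` splits m \<subseteq> L"
    by (auto simp: L_def splits_def lookup_add)
  ultimately show ?thesis
    by (meson finite_imageD finite_subset)
qed

instantiation mfps :: (comm_ring_1) comm_ring_1
begin

definition zero_mfps where "0 = Abs_mfps (\<lambda>_. 0)"
definition one_mfps where "1 = Abs_mfps (\<lambda>m. if m = 0 then 1 else 0)"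
definition plus_mfps where "f + g = Abs_mfps (\<lambda>m. mcoeff f m + mcoeff g m)"
definition uminus_mfps where "- f = Abs_mfps (\<lambda>m. - mcoeff f m)"
definition minus_mfps where "f - g = Abs_mfps (\<lambda>m. mcoeff f m - mcoeff g m)"
definition times_mfps where
  "f * g = Abs_mfps (\<lambda>m. \<Sum>(a, b)\<in>splits m. mcoeff f a * mcoeff g b)"

instance
proof
  fix f g h :: "'a mfps"
  show "f + g + h = f + (g + h)" "f + g = g + f" "0 + f = f" "- f + f = 0" "f - g = f + - g"
    by (auto intro!: mfps_eqI
        simp: plus_mfps_def zero_mfps_def uminus_mfps_def minus_mfps_def add_ac)
  show "f * g = g * f"
    by (rule mfps_eqI, simp add: times_mfps_def,
        rule sum.reindex_bij_witness[of _ prod.swap prod.swap])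
       (auto simp: splits_def add.commute mult.commute)
  show "(f + g) * h = f * h + g * h"
    by (rule mfps_eqI)
       (simp add: times_mfps_def plus_mfps_def case_prod_unfold distrib_right sum.distrib)
  show "(0 :: 'a mfps) \<noteq> 1"
  proof
    assume "(0 :: 'a mfps) = 1"
    then have "mcoeff (0 :: 'a mfps) 0 = mcoeff 1 0" by (rule arg_cong)
    then show False by (simp add: zero_mfps_def one_mfps_def)
  qed
  show "1 * f = f"
  proof (rule mfps_eqI)
    fix m
    have "mcoeff (1 * f) m
        = (\<Sum>p\<in>splits m. if p = (0, m) then mcoeff f m else 0)"
      unfolding times_mfps_def one_mfps_def mcoeff_Abs
      by (rule sum.cong) (auto simp: splits_def split: if_splits)
    also have "\<dots> = mcoeff f m"
      by (simp add: splits_def[of m, symmetric]) (simp add: splits_def)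
    finally show "mcoeff (1 * f) m = mcoeff f m" .
  qed
  show "f * g * h = f * (g * h)"
  proof (rule mfps_eqI)
    fix m
    have "mcoeff (f * g * h) m = (\<Sum>p\<in>splits m. \<Sum>q\<in>splits (fst p).
            mcoeff f (fst q) * mcoeff g (snd q) * mcoeff h (snd p))"
      by (simp add: times_mfps_def case_prod_unfold sum_distrib_right)
    also have "\<dots> = (\<Sum>(p, q)\<in>Sigma (splits m) (\<lambda>p. splits (fst p)).
            mcoeff f (fst q) * mcoeff g (snd q) * mcoeff h (snd p))"
      by (rule sum.Sigma) auto
    also have "\<dots> = (\<Sum>(p, q)\<in>Sigma (splits m) (\<lambda>p. splits (snd p)).
            mcoeff f (fst p) * (mcoeff g (fst q) * mcoeff h (snd q)))"
      by (rule sum.reindex_bij_witness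
            [of _ "\<lambda>(p, q). ((fst p + fst q, snd q), (fst p, fst q))"
                  "\<lambda>(p, q). ((fst q, snd q + snd p), (snd q, snd p))"])
         (auto simp: splits_def add.assoc mult.assoc)
    also have "\<dots> = (\<Sum>p\<in>splits m. \<Sum>q\<in>splits (snd p).
            mcoeff f (fst p) * (mcoeff g (fst q) * mcoeff h (snd q)))"
      by (rule sum.Sigma[symmetric]) auto
    also have "\<dots> = mcoeff (f * (g * h)) m"
      by (simp add: times_mfps_def case_prod_unfold sum_distrib_left)
    finally show "mcoeff (f * g * h) m = mcoeff (f * (g * h)) m" .
  qed
qed

end

definition mvar :: "nat \<Rightarrow> 'a::comm_ring_1 mfps" where
  "mvar i = Abs_mfps (\<lambda>m. if m = Poly_Mapping.single i 1 then 1 else 0)"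


section \<open>Infinite sums of formal power series\<close>

text \<open>
  A family of formal power series is summable if every monomial occurs in only finitely many
  of its members; its sum is then taken coefficientwise. The value \<open>msum F A\<close> is only
  meaningful if \<open>msummable F A\<close> holds.
\<close>

definition msummable :: "('i \<Rightarrow> 'a::comm_ring_1 mfps) \<Rightarrow> 'i set \<Rightarrow> bool" where
  "msummable F A \<longleftrightarrow> (\<forall>m. finite {i \<in> A. mcoeff (F i) m \<noteq> 0})"

definition msum :: "('i \<Rightarrow> 'a::comm_ring_1 mfps) \<Rightarrow> 'i set \<Rightarrow> 'a mfps" where
  "msum F A = Abs_mfps (\<lambda>m. \<Sum>i\<in>{i \<in> A. mcoeff (F i) m \<noteq> 0}. mcoeff (F i) m)"


section \<open>The series $e_n$ and $f_r$\<close>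

text \<open>A choice of indices $i_1 < \cdots < i_n$ is a set of $n$ indices.\<close>

definition esym :: "int \<Rightarrow> 'a::comm_ring_1 mfps" where
  "esym n = (if n < 0 then 0
             else msum (\<lambda>S. \<Prod>i\<in>S. mvar i) {S. finite S \<and> card S = nat n})"

definition fser :: "int \<Rightarrow> 'a::comm_ring_1 mfps" where
  "fser r = msum (\<lambda>n. esym n * esym (n + r)) UNIV"


section \<open>Summability of the defining families\<close>

lemma mcoeff_mvar: "mcoeff (mvar i) m = (if m = Poly_Mapping.single i 1 then 1 else 0)"
  by (simp add: mvar_def)

lemma mcoeff_prod_mvar:
  assumes "finite S"
  shows "mcoeff (\<Prod>i\<in>S. mvar i :: 'a::comm_ring_1 mfps) m =
           (if m = (\<Sum>i\<in>S. Poly_Mapping.single i 1) then 1 else 0)"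
  using assms
proof (induction S arbitrary: m rule: finite_induct)
  case empty
  then show ?case by (simp add: one_mfps_def)
next
  case (insert i S)
  let ?s = "Poly_Mapping.single i (1::nat)"
  let ?t = "\<Sum>i\<in>S. Poly_Mapping.single i (1::nat)"
  have "mcoeff (\<Prod>i\<in>insert i S. mvar i :: 'a mfps) m =
      (\<Sum>(a, b)\<in>splits m. mcoeff (mvar i :: 'a mfps) a * mcoeff (\<Prod>i\<in>S. mvar i :: 'a mfps) b)"
    using insert.hyps by (simp add: times_mfps_def)
  also have "\<dots> = (\<Sum>p\<in>splits m. if p = (?s, ?t) then 1 else 0)"
    by (rule sum.cong) (auto simp: mcoeff_mvar insert.IH split: if_splits)
  also have "\<dots> = (if (?s, ?t) \<in> splits m then 1 else 0)"
    by simp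
  finally show ?case
    using insert.hyps by (auto simp: splits_def)
qed

lemma keys_sum_single:
  assumes "finite S"
  shows "Poly_Mapping.keys (\<Sum>i\<in>S. Poly_Mapping.single i (1::nat)) = S"
proof -
  have "Poly_Mapping.lookup (\<Sum>i\<in>S. Poly_Mapping.single i (1::nat)) j = (if j \<in> S then 1 else 0)" for j
    using assms by (induction S rule: finite_induct) (auto simp: lookup_add lookup_single when_def)
  then show ?thesis by (auto simp: in_keys_iff split: if_splits)
qed

lemma msummable_esym:
  "msummable (\<lambda>S. \<Prod>i\<in>S. mvar i :: 'a::comm_ring_1 mfps) {S. finite S \<and> card S = n}"
  unfolding msummable_def
proof
  fix m
  have "{S \<in> {S. finite S \<and> card S = n}. mcoeff (\<Prod>i\<in>S. mvar i :: 'a mfps) m \<noteq> 0} \<subseteq> {Poly_Mapping.keys m}"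
    by (auto simp: mcoeff_prod_mvar keys_sum_single[simplified] split: if_splits)
  then show "finite {S \<in> {S. finite S \<and> card S = n}. mcoeff (\<Prod>i\<in>S. mvar i :: 'a mfps) m \<noteq> 0}"
    by (rule finite_subset) simp
qed

lemma mcoeff_esym_nonzero:
  assumes "mcoeff (esym n :: 'a::comm_ring_1 mfps) m \<noteq> 0"
  shows "n = int (card (Poly_Mapping.keys m))"
proof -
  have n: "\<not> n < 0"
    using assms by (auto simp: esym_def zero_mfps_def)
  then obtain S where "finite S" "card S = nat n" "mcoeff (\<Prod>i\<in>S. mvar i :: 'a mfps) m \<noteq> 0"
    using assms by (auto simp: esym_def msum_def elim!: sum.not_neutral_contains_not_neutral)
  then show ?thesis
    using n by (auto simp: mcoeff_prod_mvar keys_sum_single[simplified] split: if_splits)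
qed

lemma msummable_fser: "msummable (\<lambda>n. esym n * esym (n + r) :: 'a::comm_ring_1 mfps) UNIV"
  unfolding msummable_def
proof
  fix m
  have "{n \<in> UNIV. mcoeff (esym n * esym (n + r) :: 'a mfps) m \<noteq> 0}
      \<subseteq> (\<lambda>(a, b). int (card (Poly_Mapping.keys a))) ` splits m"
  proof
    fix n assume "n \<in> {n \<in> UNIV. mcoeff (esym n * esym (n + r) :: 'a mfps) m \<noteq> 0}"
    then obtain a b where ab: "(a, b) \<in> splits m" "mcoeff (esym n :: 'a mfps) a * mcoeff (esym (n + r)) b \<noteq> 0"
      by (auto simp: times_mfps_def elim!: sum.not_neutral_contains_not_neutral)
    then have "mcoeff (esym n :: 'a mfps) a \<noteq> 0"
      by auto
    with ab(1) have "(a, b) \<in> splits m" "n = int (card (Poly_Mapping.keys a))"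
      using mcoeff_esym_nonzero by auto
    then show "n \<in> (\<lambda>(a, b). int (card (Poly_Mapping.keys a))) ` splits m"
      by force
  qed
  then show "finite {n \<in> UNIV. mcoeff (esym n * esym (n + r) :: 'a mfps) m \<noteq> 0}"
    by (rule finite_subset) simp
qed


section \<open>Partitions and summation ranges\<close>

text \<open>
  Parts are numbered from \<open>0\<close>: \<open>p i\<close> is $\lambda_{i+1}$.
\<close>

definition is_partition :: "(nat \<Rightarrow> nat) \<Rightarrow> bool" where
  "is_partition p \<longleftrightarrow> antimono p \<and> finite {i. p i > 0}"

definition plength :: "(nat \<Rightarrow> nat) \<Rightarrow> nat" where
  "plength p = card {i. p i > 0}"

definition bounded_partitions :: "nat \<Rightarrow> nat \<Rightarrow> (nat \<Rightarrow> nat) set" where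
  "bounded_partitions n w =
     {p. is_partition p \<and> plength p \<le> n \<and> int (p 0) - int (p (n - 1)) \<le> int w}"

definition int_tuples :: "nat \<Rightarrow> (nat \<Rightarrow> int) set" where
  "int_tuples n = {..<n} \<rightarrow>\<^sub>E UNIV"

definition zero_sum_tuples :: "nat \<Rightarrow> (nat \<Rightarrow> int) set" where
  "zero_sum_tuples n = {k \<in> int_tuples n. (\<Sum>i<n. k i) = 0}"


section \<open>The determinants\<close>

text \<open>
  Matrix indices start at \<open>0\<close>, so the usual 1-based indices $i$ and $j$ are \<open>i + 1\<close> and \<open>j + 1\<close> here.
\<close>

definition edet :: "nat \<Rightarrow> int \<Rightarrow> (nat \<Rightarrow> nat) \<Rightarrow> (nat \<Rightarrow> int) \<Rightarrow> 'a::comm_ring_1 mfps" where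
  "edet n N p k =
     det (mat n n (\<lambda>(i, j). esym (int (p i) - int (i + 1) + int (j + 1) + N * k i)))"

definition fdet_minus :: "nat \<Rightarrow> int \<Rightarrow> (nat \<Rightarrow> int) \<Rightarrow> 'a::comm_ring_1 mfps" where
  "fdet_minus h N k =
     det (mat h h (\<lambda>(i, j). fser (- int (i + 1) + int (j + 1) + N * k i)
                          - fser (int (i + 1) + int (j + 1) + N * k i)))"

definition fdet_plus :: "nat \<Rightarrow> int \<Rightarrow> (nat \<Rightarrow> int) \<Rightarrow> 'a::comm_ring_1 mfps" where
  "fdet_plus h N k =
     det (mat h h (\<lambda>(i, j). fser (- int (i + 1) + int (j + 1) + N * k i)
                          + fser (int (i + 1) + int (j + 1) - 1 + N * k i)))"

text \<open>$(-1)^s$ for an integer \<open>s\<close>; the ring need not be a field, so \<open>powi\<close> is unavailable.\<close>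

definition neg_one_pow :: "int \<Rightarrow> 'a::comm_ring_1" where
  "neg_one_pow s = (if even s then 1 else - 1)"

end

theory Submission
  imports Defs
begin

text \<open>
  Let \<open>n\<close> be the number of rows on the left, \<open>N\<close> the period, $\eta = (-1)^{n-1}$, and let
  $l_i = \lambda_i - i$, with rows and columns numbered from \<open>0\<close>. Expanding the determinants, the
  terms with a fixed partition run over the orbit of \<open>l\<close> under the affine symmetric group that
  permutes the coordinates of an integer vector and translates it by \<open>N\<close> times a vector of sum
  zero. So the left-hand side is a signed sum of products $e_{a_0} e_{a_1+1} \cdots e_{a_{n-1}+n-1}$
  over integer vectors \<open>a\<close>.

  The bound \<open>w\<close> on the difference of the first and the last part says that \<open>l\<close> lies in an
  alcove, and every vector with distinct residues modulo \<open>N\<close> has exactly one alcove point in its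
  orbit (\<open>alcove_match_exists\<close>, \<open>alcove_match_unique\<close>). Alcove points with a negative last part contribute
  nothing (\<open>orbit_sum_esym_in_eq_0\<close>): peeling off one variable lowers each coordinate by \<open>0\<close> or
  \<open>1\<close>, which leads to another such alcove point or to a wall, where the signs cancel; the
  point of the empty partition is never reached. Hence the left-hand side is the sum over
  \<^emph>\<open>all\<close> vectors \<open>a\<close>, weighted by their affine sign.

  The affine sign factors into a sign of the residues and a power of \<open>\<eta>\<close> for each quotient.
  Summing over the quotients turns \<open>e\<close> into its periodization
  $E_s = \sum_k \eta^k e_{s+Nk}$, and what remains is the sum of all maximal minors of the matrix
  $(E_{s+j})$ with $0 \le s < N$ and $0 \le j < n$ (\<open>minor_sum_periodization\<close>).

  A sum of maximal minors is a Pfaffian for the skew form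
  $\omega(f,g) = \sum_{s,t} \mathrm{sgn}(s-t) f_s g_t$. Instead of Pfaffians, only their expansion
  along the first vector is used, which rests on one identity between signs
  (\<open>sum_sgn_alternating\<close>). If the first half of the vectors is isotropic, the expansion
  collapses to that of a determinant (\<open>minor_sum_isotropic\<close>). The reflection \<open>j \<mapsto> n - 1 - j\<close>
  provides the isotropic vectors $E_{s+j} \pm E_{s+n-1-j}$, and summation by parts gives
  $\omega(f, \Delta g) = \sum_s f_s (g_s + g_{s+1})$ up to a boundary term that vanishes here. So the
  determinant can be written in the correlations $\sum_s E_s E_{s+r}$, which are the
  periodizations of the $f_r$; this is \<open>minor_sum_even\<close> and \<open>minor_sum_odd\<close>. For odd \<open>n\<close> the
  middle vector is left over and splits off the factor $\sum_s E_s = \sum_k e_k$. Multilinearity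
  in the rows (\<open>det_row_sums\<close>) brings the sums over $k_1, \ldots, k_h$ back in front of the
  determinants.

  All of this is done after setting all but finitely many variables to \<open>0\<close>. This is a ring
  homomorphism, it makes every sum above finite, and a formal power series is determined by
  its images under these maps.
\<close>

section \<open>Alternating products of signs\<close>

text \<open>
  The index set \<open>I\<close> is an arbitrary set of positions, so that single positions can be removed
  without renumbering the remaining ones.
\<close>

definition pairprod :: "('b \<Rightarrow> 'b \<Rightarrow> 'c::comm_ring_1) \<Rightarrow> nat set \<Rightarrow> (nat \<Rightarrow> 'b) \<Rightarrow> 'c" where
  "pairprod \<kappa> I s = (\<Prod>j\<in>I. \<Prod>i\<in>{i\<in>I. i < j}. \<kappa> (s i) (s j))"

definition alternating_kernel :: "('b \<Rightarrow> 'b \<Rightarrow> 'c::comm_ring_1) \<Rightarrow> bool" where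
  "alternating_kernel \<kappa> \<longleftrightarrow> (\<forall>x y. \<kappa> x y = - \<kappa> y x) \<and> (\<forall>x. \<kappa> x x = 0)"

definition sgn_diff :: "int \<Rightarrow> int \<Rightarrow> int" where
  "sgn_diff x y = sgn (x - y)"

lemma alternating_sgn_diff: "alternating_kernel sgn_diff"
  by (auto simp: alternating_kernel_def sgn_diff_def sgn_if)

lemma pairprod_cong:
  assumes "\<And>i. i \<in> I \<Longrightarrow> s i = t i"
  shows "pairprod \<kappa> I s = pairprod \<kappa> I t"
  unfolding pairprod_def using assms by (intro prod.cong) auto

lemma pairprod_insert:
  assumes "finite J" "a \<notin> J" "alternating_kernel \<kappa>"
  shows "pairprod \<kappa> (insert a J) s =
           (- 1) ^ card {i\<in>J. i < a} * (\<Prod>i\<in>J. \<kappa> (s a) (s i)) * pairprod \<kappa> J s"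
proof -
  have anti: "\<kappa> x y = - \<kappa> y x" for x y
    using assms(3) unfolding alternating_kernel_def by blast
  have "pairprod \<kappa> (insert a J) s =
      (\<Prod>i\<in>{i\<in>insert a J. i < a}. \<kappa> (s i) (s a)) *
      (\<Prod>j\<in>J. \<Prod>i\<in>{i\<in>insert a J. i < j}. \<kappa> (s i) (s j))"
    unfolding pairprod_def using assms by simp
  also have "(\<Prod>i\<in>{i\<in>insert a J. i < a}. \<kappa> (s i) (s a)) = (\<Prod>i\<in>{i\<in>J. i < a}. - \<kappa> (s a) (s i))"
    by (intro prod.cong) (auto intro: anti)
  also have "\<dots> = (- 1) ^ card {i\<in>J. i < a} * (\<Prod>i\<in>{i\<in>J. i < a}. \<kappa> (s a) (s i))"
    by (simp add: prod_uminus)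
  also have "(\<Prod>j\<in>J. \<Prod>i\<in>{i\<in>insert a J. i < j}. \<kappa> (s i) (s j)) =
      (\<Prod>j\<in>J. (if a < j then \<kappa> (s a) (s j) else 1) * (\<Prod>i\<in>{i\<in>J. i < j}. \<kappa> (s i) (s j)))"
  proof (intro prod.cong refl)
    fix j assume "j \<in> J"
    have "{i\<in>insert a J. i < j} = (if a < j then insert a {i\<in>J. i < j} else {i\<in>J. i < j})"
      by auto
    then show "(\<Prod>i\<in>{i\<in>insert a J. i < j}. \<kappa> (s i) (s j)) =
        (if a < j then \<kappa> (s a) (s j) else 1) * (\<Prod>i\<in>{i\<in>J. i < j}. \<kappa> (s i) (s j))"
      using assms by auto
  qed
  also have "\<dots> = (\<Prod>j\<in>J. if a < j then \<kappa> (s a) (s j) else 1) * pairprod \<kappa> J s"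
    by (simp add: prod.distrib pairprod_def)
  also have "(\<Prod>j\<in>J. if a < j then \<kappa> (s a) (s j) else 1) = (\<Prod>j\<in>{j\<in>J. a < j}. \<kappa> (s a) (s j))"
    using assms(1) by (simp add: prod.inter_filter)
  also have "(- 1) ^ card {i\<in>J. i < a} * (\<Prod>i\<in>{i\<in>J. i < a}. \<kappa> (s a) (s i)) *
      ((\<Prod>j\<in>{j\<in>J. a < j}. \<kappa> (s a) (s j)) * pairprod \<kappa> J s) =
      (- 1) ^ card {i\<in>J. i < a} * ((\<Prod>i\<in>{i\<in>J. i < a}. \<kappa> (s a) (s i)) *
      (\<Prod>j\<in>{j\<in>J. a < j}. \<kappa> (s a) (s j))) * pairprod \<kappa> J s"
    by (simp add: mult_ac)
  also have "(\<Prod>i\<in>{i\<in>J. i < a}. \<kappa> (s a) (s i)) * (\<Prod>j\<in>{j\<in>J. a < j}. \<kappa> (s a) (s j)) =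
      (\<Prod>i\<in>J. \<kappa> (s a) (s i))"
  proof -
    have "{i\<in>J. i < a} \<union> {j\<in>J. a < j} = J" using assms(2) by (auto simp: not_less_iff_gr_or_eq)
    moreover have "{i\<in>J. i < a} \<inter> {j\<in>J. a < j} = {}" by auto
    ultimately show ?thesis
      using prod.union_disjoint[of "{i\<in>J. i < a}" "{j\<in>J. a < j}" "\<lambda>i. \<kappa> (s a) (s i)"] assms(1)
      by simp
  qed
  finally show ?thesis .
qed

lemma pairprod_remove:
  assumes "finite I" "a \<in> I" "alternating_kernel \<kappa>"
  shows "pairprod \<kappa> I s =
           (- 1) ^ card {i\<in>I. i < a} * (\<Prod>i\<in>I - {a}. \<kappa> (s a) (s i)) * pairprod \<kappa> (I - {a}) s"
proof -
  have "{i\<in>I - {a}. i < a} = {i\<in>I. i < a}" by auto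
  then show ?thesis
    using pairprod_insert[of "I - {a}" a \<kappa> s] assms by (simp add: insert_absorb)
qed

lemma pairprod_eq_0:
  assumes "finite I" "a \<in> I" "b \<in> I" "a \<noteq> b" "s a = s b" "alternating_kernel \<kappa>"
  shows "pairprod \<kappa> I s = 0"
proof -
  have "\<kappa> (s a) (s b) = 0"
    using assms(5,6) unfolding alternating_kernel_def by metis
  then have "(\<Prod>i\<in>I - {a}. \<kappa> (s a) (s i)) = 0"
    using assms by (intro prod_zero) auto
  then show ?thesis using pairprod_remove[of I a \<kappa> s] assms by simp
qed

text \<open>
  Pull both positions out of the product: what remains is symmetric in them, except for the single
  factor in which they meet each other.
\<close>

lemma pairprod_transpose:
  assumes "finite I" "a \<in> I" "b \<in> I" "a \<noteq> b" "alternating_kernel \<kappa>"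
  shows "pairprod \<kappa> I (s \<circ> Transposition.transpose a b) = - pairprod \<kappa> I s"
proof -
  define J where "J = I - {a} - {b}"
  define c :: 'b where "c = (- 1) ^ card {i\<in>I. i < a} * (- 1) ^ card {i\<in>I - {a}. i < b}"
  have I: "I - {a} = insert b J" "b \<notin> J" "finite J" using assms by (auto simp: J_def)
  have key: "pairprod \<kappa> I t = c * \<kappa> (t a) (t b) *
      ((\<Prod>i\<in>J. \<kappa> (t a) (t i)) * (\<Prod>i\<in>J. \<kappa> (t b) (t i))) * pairprod \<kappa> J t" for t
    using pairprod_remove[of I a \<kappa> t] pairprod_remove[of "I - {a}" b \<kappa> t] assms I
    by (simp add: c_def J_def[symmetric] mult_ac)
  let ?t = "s \<circ> Transposition.transpose a b"
  have J: "?t i = s i" if "i \<in> J" for i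
    using that by (auto simp: J_def Transposition.transpose_def)
  have "(\<Prod>i\<in>J. \<kappa> (?t a) (?t i)) = (\<Prod>i\<in>J. \<kappa> (s b) (s i))"
       "(\<Prod>i\<in>J. \<kappa> (?t b) (?t i)) = (\<Prod>i\<in>J. \<kappa> (s a) (s i))"
    using J by (auto intro!: prod.cong)
  moreover have "pairprod \<kappa> J ?t = pairprod \<kappa> J s"
    by (rule pairprod_cong) (rule J)
  moreover have "\<kappa> (?t a) (?t b) = - \<kappa> (s a) (s b)"
  proof -
    have "\<kappa> (s b) (s a) = - \<kappa> (s a) (s b)"
      using assms(5) unfolding alternating_kernel_def by blast
    then show ?thesis by simp
  qed
  ultimately show ?thesis unfolding key by (simp add: mult_ac)
qed

lemma pairprod_permutes:
  assumes "finite I" "p permutes I" "alternating_kernel \<kappa>"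
  shows "pairprod \<kappa> I (s \<circ> p) = of_int (sign p) * pairprod \<kappa> I s"
  using assms(2,1)
proof (induction arbitrary: s rule: permutes_induct)
  case id
  then show ?case by (simp add: sign_id)
next
  case (swap a b p)
  have "permutation p" using swap.hyps assms(1) permutation_permutes by blast
  then have "sign (Transposition.transpose a b \<circ> p) = - sign p"
    using swap.hyps sign_compose[OF permutation_swap_id, of p a b] by (simp add: sign_swap_id)
  moreover have "pairprod \<kappa> I (s \<circ> Transposition.transpose a b \<circ> p) =
      of_int (sign p) * pairprod \<kappa> I (s \<circ> Transposition.transpose a b)"
    by (rule swap.IH)
  ultimately show ?case
    using pairprod_transpose[of I a b \<kappa> s] swap.hyps assms by (simp add: o_assoc del: o_apply)
qed

text \<open>
  With the elements of \<open>Y\<close> in decreasing order, the products on the left are \<open>1, -1, 1, \<dots>\<close>, so the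
  sum is an alternating sum of signs that change at \<open>x\<close>. The largest element of \<open>Y\<close> can be removed
  from both sides. The correction is \<open>0\<close> for odd cardinality, the case that yields the expansion
  of a Pfaffian.
\<close>

lemma sum_sgn_alternating:
  fixes x :: int
  assumes "finite Y"
  shows "(\<Sum>y\<in>Y. sgn_diff x y * (\<Prod>z\<in>Y - {y}. sgn_diff y z)) =
           (\<Prod>y\<in>Y. sgn_diff x y) - (if even (card Y) then 1 else 0)"
  using assms
proof (induction Y rule: finite_linorder_max_induct)
  case empty
  then show ?case by simp
next
  case (insert b Y)
  have b: "b \<notin> Y" using insert.hyps by auto
  have "(\<Sum>y\<in>Y. sgn_diff x y * (\<Prod>z\<in>insert b Y - {y}. sgn_diff y z)) =
        (\<Sum>y\<in>Y. - (sgn_diff x y * (\<Prod>z\<in>Y - {y}. sgn_diff y z)))"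
  proof (intro sum.cong refl)
    fix y assume y: "y \<in> Y"
    then have "insert b Y - {y} = insert b (Y - {y})" "b \<notin> Y - {y}" "y < b"
      using b insert.hyps by auto
    then show "sgn_diff x y * (\<Prod>z\<in>insert b Y - {y}. sgn_diff y z) =
        - (sgn_diff x y * (\<Prod>z\<in>Y - {y}. sgn_diff y z))"
      using insert.hyps by (simp add: sgn_diff_def)
  qed
  moreover have "(\<Prod>z\<in>insert b Y - {b}. sgn_diff b z) = 1"
    using b insert.hyps by (intro prod.neutral) (auto simp: sgn_diff_def)
  ultimately have 1: "(\<Sum>y\<in>insert b Y. sgn_diff x y * (\<Prod>z\<in>insert b Y - {y}. sgn_diff y z)) =
      sgn_diff x b - ((\<Prod>y\<in>Y. sgn_diff x y) - (if even (card Y) then 1 else 0))"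
    using b insert by (simp add: sum_negf)
  have 2: "(\<Prod>y\<in>Y. sgn_diff x y) = 1" if "x \<ge> b"
    using that insert.hyps by (intro prod.neutral) (force simp: sgn_diff_def)
  show ?case
    unfolding 1 using b insert.hyps 2
    by (cases "x < b"; cases "x = b") (auto simp: sgn_diff_def)
qed

text \<open>
  For injective \<open>s\<close>, multiply the preceding identity for the set of values by the product of the
  signs in \<open>J\<close>. If two values coincide, the left-hand side is zero and only the two terms that
  remove one of these positions survive; they cancel.
\<close>

lemma pairprod_expand:
  assumes J: "finite J" and odd: "odd (card J)"
  shows "(\<Prod>j\<in>J. sgn_diff x (s j)) * pairprod sgn_diff J s =
    (\<Sum>j\<in>J. (- 1) ^ card {i\<in>J. i < j} * sgn_diff x (s j) * pairprod sgn_diff (J - {j}) s)"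
proof (cases "inj_on s J")
  case True
  have sq: "sgn_diff u v * sgn_diff u v = 1" if "u \<noteq> v" for u v
    using that by (auto simp: sgn_diff_def sgn_if)
  have A: "(- 1) ^ card {i\<in>J. i < j} * pairprod sgn_diff (J - {j}) s =
      (\<Prod>i\<in>J - {j}. sgn_diff (s j) (s i)) * pairprod sgn_diff J s" if j: "j \<in> J" for j
  proof -
    have "(\<Prod>i\<in>J - {j}. sgn_diff (s j) (s i)) * (\<Prod>i\<in>J - {j}. sgn_diff (s j) (s i)) = 1"
      unfolding prod.distrib[symmetric] using True j
      by (intro prod.neutral) (auto intro!: sq dest: inj_onD)
    moreover have "pairprod sgn_diff J s = (- 1) ^ card {i\<in>J. i < j} *
        (\<Prod>i\<in>J - {j}. sgn_diff (s j) (s i)) * pairprod sgn_diff (J - {j}) s"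
      using pairprod_remove[OF J j alternating_sgn_diff] .
    moreover have "c * Y = P * X" if "P * P = 1" "X = c * P * Y" for c P X Y :: int
    proof -
      have "P * X = P * P * (c * Y)" unfolding that(2) by (simp only: mult_ac)
      then show ?thesis using that(1) by simp
    qed
    ultimately show ?thesis by blast
  qed
  have "(\<Sum>j\<in>J. (- 1) ^ card {i\<in>J. i < j} * sgn_diff x (s j) * pairprod sgn_diff (J - {j}) s) =
     (\<Sum>j\<in>J. sgn_diff x (s j) * (\<Prod>i\<in>J - {j}. sgn_diff (s j) (s i))) * pairprod sgn_diff J s"
    unfolding sum_distrib_right using A by (intro sum.cong) (auto simp: mult_ac)
  also have "(\<Sum>j\<in>J. sgn_diff x (s j) * (\<Prod>i\<in>J - {j}. sgn_diff (s j) (s i))) =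
      (\<Sum>y\<in>s ` J. sgn_diff x y * (\<Prod>z\<in>s ` J - {y}. sgn_diff y z))"
  proof -
    have "(\<Prod>z\<in>s ` J - {s j}. sgn_diff (s j) z) = (\<Prod>i\<in>J - {j}. sgn_diff (s j) (s i))" if "j \<in> J" for j
    proof -
      have "s ` J - {s j} = s ` (J - {j})" using True that by (auto dest: inj_onD)
      moreover have "inj_on s (J - {j})" using True by (rule inj_on_subset) auto
      ultimately show ?thesis by (simp add: prod.reindex)
    qed
    then show ?thesis using True by (simp add: sum.reindex)
  qed
  also have "\<dots> = (\<Prod>y\<in>s ` J. sgn_diff x y)"
    using sum_sgn_alternating[of "s ` J" x] J odd True by (simp add: card_image)
  also have "\<dots> = (\<Prod>j\<in>J. sgn_diff x (s j))"
    using True by (simp add: prod.reindex)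
  finally show ?thesis by (rule sym)
next
  case False
  then obtain a b where ab: "a \<in> J" "b \<in> J" "a < b" "s a = s b"
    unfolding inj_on_def by (metis linorder_neqE_nat)
  define K where "K = J - {a, b}"
  have fin: "finite K" "finite (J - {a})" "finite (J - {b})" using J by (auto simp: K_def)
  have sets: "J - {a} - {b} = K" "J - {b} - {a} = K" by (auto simp: K_def)
  have zero: "pairprod sgn_diff (J - {j}) s = 0" if "j \<noteq> a" "j \<noteq> b" for j
    by (rule pairprod_eq_0[of _ a b]) (use that ab J alternating_sgn_diff in auto)
  have "{i\<in>J. i < b} = insert a {i\<in>J - {a}. i < b}" using ab by auto
  then have c1: "card {i\<in>J. i < b} = Suc (card {i\<in>J - {a}. i < b})"
    using J by simp
  have c2: "{i\<in>J - {b}. i < a} = {i\<in>J. i < a}" using ab by auto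
  have "pairprod sgn_diff (J - {a}) s =
      (- 1) ^ card {i\<in>J - {a}. i < b} * (\<Prod>i\<in>K. sgn_diff (s b) (s i)) * pairprod sgn_diff K s"
    using pairprod_remove[OF fin(2) _ alternating_sgn_diff, of b s] ab sets by simp
  moreover have "pairprod sgn_diff (J - {b}) s =
      (- 1) ^ card {i\<in>J. i < a} * (\<Prod>i\<in>K. sgn_diff (s b) (s i)) * pairprod sgn_diff K s"
    using pairprod_remove[OF fin(3) _ alternating_sgn_diff, of a s] ab sets c2 by simp
  ultimately have cancel: "(- 1) ^ card {i\<in>J. i < a} * sgn_diff x (s a) * pairprod sgn_diff (J - {a}) s +
      (- 1) ^ card {i\<in>J. i < b} * sgn_diff x (s b) * pairprod sgn_diff (J - {b}) s = 0"
    using ab(4) c1 by (simp add: mult_ac)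
  have "(\<Sum>j\<in>J. (- 1) ^ card {i\<in>J. i < j} * sgn_diff x (s j) * pairprod sgn_diff (J - {j}) s) =
      (\<Sum>j\<in>{a, b}. (- 1) ^ card {i\<in>J. i < j} * sgn_diff x (s j) * pairprod sgn_diff (J - {j}) s)"
    by (rule sum.mono_neutral_right) (use J ab zero in auto)
  also have "\<dots> = 0" using cancel ab by simp
  finally show ?thesis
    using pairprod_eq_0[OF J ab(1,2) _ ab(4) alternating_sgn_diff] ab by simp
qed

section \<open>Sums of maximal minors\<close>

text \<open>
  Grouping the tuples \<open>s\<close> by the set of their values shows that this is the sum of all maximal
  minors of the matrix with columns \<open>v i\<close>, the rows being listed in decreasing order.
\<close>

definition minor_sum :: "int \<Rightarrow> nat set \<Rightarrow> (nat \<Rightarrow> int \<Rightarrow> 'a::comm_ring_1) \<Rightarrow> 'a" where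
  "minor_sum N I v =
     (\<Sum>s\<in>I \<rightarrow>\<^sub>E {0..<N}. of_int (pairprod sgn_diff I s) * (\<Prod>i\<in>I. v i (s i)))"

text \<open>
  The skew form in whose values the sums of maximal minors with two columns, hence all those with
  an even number of columns, can be expressed.
\<close>

definition omega :: "int \<Rightarrow> (int \<Rightarrow> 'a::comm_ring_1) \<Rightarrow> (int \<Rightarrow> 'a) \<Rightarrow> 'a" where
  "omega N f g = (\<Sum>s\<in>{0..<N}. \<Sum>t\<in>{0..<N}. of_int (sgn_diff s t) * f s * g t)"

lemma sum_PiE_insert:
  assumes "a \<notin> I"
  shows "(\<Sum>s\<in>Pi\<^sub>E (insert a I) T. h s) = (\<Sum>x\<in>T a. \<Sum>s\<in>Pi\<^sub>E I T. h (s(a := x)))"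
proof -
  have "(\<Sum>s\<in>Pi\<^sub>E (insert a I) T. h s) =
      (\<Sum>p\<in>T a \<times> Pi\<^sub>E I T. h ((\<lambda>(y, g). g(a := y)) p))"
    unfolding PiE_insert_eq using inj_combinator[OF assms, of T] by (simp add: sum.reindex)
  then show ?thesis by (simp add: sum.cartesian_product case_prod_unfold)
qed

lemma prod_fun_upd_notin:
  assumes "a \<notin> J"
  shows "(\<Prod>i\<in>J. w i ((s(a := x)) i)) = (\<Prod>i\<in>J. w i (s i))"
  using assms by (intro prod.cong) auto

lemma pairprod_fun_upd_notin: "a \<notin> J \<Longrightarrow> pairprod \<kappa> J (s(a := x)) = pairprod \<kappa> J s"
  by (rule pairprod_cong) auto

text \<open>
  Position \<open>j\<close> is free once the sign product no longer mentions it, so its sum splits off.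
\<close>

lemma minor_sum_expand_gen:
  assumes J: "finite J" and j: "j \<in> J"
  shows "(\<Sum>s\<in>J \<rightarrow>\<^sub>E {0..<N}. k (s j) * of_int (pairprod sgn_diff (J - {j}) s) * (\<Prod>i\<in>J. v i (s i)))
       = (\<Sum>y\<in>{0..<N}. k y * v j y) * minor_sum N (J - {j}) v"
proof -
  have J': "J = insert j (J - {j})" using j by auto
  have "(\<Sum>s\<in>J \<rightarrow>\<^sub>E {0..<N}. k (s j) * of_int (pairprod sgn_diff (J - {j}) s) * (\<Prod>i\<in>J. v i (s i)))
      = (\<Sum>s\<in>insert j (J - {j}) \<rightarrow>\<^sub>E {0..<N}. k (s j) * of_int (pairprod sgn_diff (J - {j}) s) *
          (v j (s j) * (\<Prod>i\<in>J - {j}. v i (s i))))"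
    using J j by (simp add: insert_absorb prod.remove)
  also have "\<dots> = (\<Sum>y\<in>{0..<N}. \<Sum>s\<in>J - {j} \<rightarrow>\<^sub>E {0..<N}.
      k y * of_int (pairprod sgn_diff (J - {j}) s) * (v j y * (\<Prod>i\<in>J - {j}. v i (s i))))"
    by (subst sum_PiE_insert) (simp_all add: prod_fun_upd_notin pairprod_fun_upd_notin del: fun_upd_apply, simp)
  also have "\<dots> = (\<Sum>y\<in>{0..<N}. k y * v j y) * minor_sum N (J - {j}) v"
    unfolding minor_sum_def by (simp add: sum_product mult_ac)
  finally show ?thesis .
qed

text \<open>
  The sign identity for a value that exceeds all entries of the tuple.
\<close>

lemma minor_sum_expand_odd:
  assumes J: "finite J" and odd: "odd (card J)"
  shows "minor_sum N J v =
    (\<Sum>j\<in>J. (- 1) ^ card {i\<in>J. i < j} * (\<Sum>x\<in>{0..<N}. v j x) * minor_sum N (J - {j}) v)"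
proof -
  have pp: "pairprod sgn_diff J s = (\<Sum>j\<in>J. (- 1) ^ card {i\<in>J. i < j} * pairprod sgn_diff (J - {j}) s)"
    if "s \<in> J \<rightarrow>\<^sub>E {0..<N}" for s
  proof -
    \<comment> \<open>All entries of the tuple are smaller than \<open>N\<close>, so \<open>N\<close> serves as the extra value \<open>x\<close>.\<close>
    have "sgn_diff N (s j) = 1" if "j \<in> J" for j
      using PiE_mem[OF \<open>s \<in> J \<rightarrow>\<^sub>E {0..<N}\<close> that] by (simp add: sgn_diff_def)
    then show ?thesis using pairprod_expand[OF J odd, of N s] by simp
  qed
  have "minor_sum N J v = (\<Sum>s\<in>J \<rightarrow>\<^sub>E {0..<N}. \<Sum>j\<in>J. (- 1) ^ card {i\<in>J. i < j} *
      (1 * of_int (pairprod sgn_diff (J - {j}) s) * (\<Prod>i\<in>J. v i (s i))))"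
    unfolding minor_sum_def using pp
    by (intro sum.cong) (simp_all add: sum_distrib_left sum_distrib_right mult_ac)
  also have "\<dots> = (\<Sum>j\<in>J. (- 1) ^ card {i\<in>J. i < j} *
      (\<Sum>s\<in>J \<rightarrow>\<^sub>E {0..<N}. (\<lambda>_. 1) (s j) * of_int (pairprod sgn_diff (J - {j}) s) * (\<Prod>i\<in>J. v i (s i))))"
    by (subst sum.swap) (simp add: sum_distrib_left)
  also have "\<dots> = (\<Sum>j\<in>J. (- 1) ^ card {i\<in>J. i < j} * (\<Sum>x\<in>{0..<N}. v j x) * minor_sum N (J - {j}) v)"
    by (intro sum.cong refl, subst minor_sum_expand_gen[OF J]) (simp_all add: mult_ac)
  finally show ?thesis .
qed

text \<open>
  The expansion of a Pfaffian along its first row: the sign identity with the value at the first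
  position in the role of \<open>x\<close>.
\<close>

lemma minor_sum_expand_even:
  assumes J: "finite J" and odd: "odd (card J)" and a: "\<And>j. j \<in> J \<Longrightarrow> a < j"
  shows "minor_sum N (insert a J) v =
    (\<Sum>j\<in>J. (- 1) ^ card {i\<in>J. i < j} * omega N (v a) (v j) * minor_sum N (J - {j}) v)"
proof -
  have aJ: "a \<notin> J" and no: "{i\<in>J. i < a} = {}" using a by (auto dest: less_asym)
  have pp: "pairprod sgn_diff (insert a J) (s(a := x)) =
      (\<Sum>j\<in>J. (- 1) ^ card {i\<in>J. i < j} * sgn_diff x (s j) * pairprod sgn_diff (J - {j}) s)" for s x
  proof -
    have "pairprod sgn_diff (insert a J) (s(a := x)) = (\<Prod>i\<in>J. sgn_diff x (s i)) * pairprod sgn_diff J s"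
      using pairprod_insert[OF J aJ alternating_sgn_diff, of "s(a := x)"] no aJ
        prod_fun_upd_notin[OF aJ, of "\<lambda>i. sgn_diff x"]
      by (simp add: pairprod_fun_upd_notin del: fun_upd_apply) simp
    then show ?thesis using pairprod_expand[OF J odd] by simp
  qed
  have "minor_sum N (insert a J) v = (\<Sum>x\<in>{0..<N}. \<Sum>s\<in>J \<rightarrow>\<^sub>E {0..<N}.
      of_int (pairprod sgn_diff (insert a J) (s(a := x))) * (v a x * (\<Prod>i\<in>J. v i (s i))))"
    unfolding minor_sum_def using J aJ
    by (subst sum_PiE_insert[OF aJ]) (simp add: prod_fun_upd_notin del: fun_upd_apply, simp)
  also have "\<dots> = (\<Sum>x\<in>{0..<N}. \<Sum>s\<in>J \<rightarrow>\<^sub>E {0..<N}. \<Sum>j\<in>J. (- 1) ^ card {i\<in>J. i < j} * v a x *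
      (of_int (sgn_diff x (s j)) * of_int (pairprod sgn_diff (J - {j}) s) * (\<Prod>i\<in>J. v i (s i))))"
    unfolding pp by (simp add: sum_distrib_right sum_distrib_left mult_ac)
  also have "\<dots> = (\<Sum>x\<in>{0..<N}. \<Sum>j\<in>J. (- 1) ^ card {i\<in>J. i < j} * v a x *
      (\<Sum>s\<in>J \<rightarrow>\<^sub>E {0..<N}. of_int (sgn_diff x (s j)) * of_int (pairprod sgn_diff (J - {j}) s) * (\<Prod>i\<in>J. v i (s i))))"
    by (subst sum.swap[of _ J]) (simp add: sum_distrib_left)
  also have "\<dots> = (\<Sum>x\<in>{0..<N}. \<Sum>j\<in>J. (- 1) ^ card {i\<in>J. i < j} * v a x *
      ((\<Sum>y\<in>{0..<N}. of_int (sgn_diff x y) * v j y) * minor_sum N (J - {j}) v))"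
    by (intro sum.cong refl, subst minor_sum_expand_gen[OF J]) auto
  also have "\<dots> = (\<Sum>j\<in>J. (- 1) ^ card {i\<in>J. i < j} * omega N (v a) (v j) * minor_sum N (J - {j}) v)"
    by (subst sum.swap)
       (simp add: omega_def sum_distrib_left sum_distrib_right mult_ac)
  finally show ?thesis .
qed

text \<open>
  The diagonal is treated separately because \<open>2\<close> may be a zero divisor in the ring.
\<close>

lemma antisymmetric_double_sum:
  fixes h :: "'b \<Rightarrow> 'b \<Rightarrow> 'a::comm_ring_1"
  assumes "finite A" "\<And>x y. x \<in> A \<Longrightarrow> y \<in> A \<Longrightarrow> h x y = - h y x" "\<And>x. x \<in> A \<Longrightarrow> h x x = 0"
  shows "(\<Sum>x\<in>A. \<Sum>y\<in>A. h x y) = 0"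
  using assms
proof (induction A rule: finite_induct)
  case (insert a A)
  have "(\<Sum>x\<in>A. h x a) = (\<Sum>x\<in>A. - h a x)"
    by (intro sum.cong refl) (rule insert.prems(1), auto)
  moreover have "h a a = 0" by (rule insert.prems(2)) auto
  moreover have "(\<Sum>x\<in>A. \<Sum>y\<in>A. h x y) = 0"
  proof (rule insert.IH)
    fix x y assume "x \<in> A" "y \<in> A"
    then show "h x y = - h y x" by (intro insert.prems(1)) auto
  next
    fix x assume "x \<in> A"
    then show "h x x = 0" by (intro insert.prems(2)) auto
  qed
  ultimately show ?case
    using insert.hyps by (simp add: sum.distrib sum_negf)
qed simp

lemma minor_sum_cong:
  assumes "\<And>i. i \<in> I \<Longrightarrow> v i = w i"
  shows "minor_sum N I v = minor_sum N I w"
  unfolding minor_sum_def using assms by (intro sum.cong refl arg_cong2[where f = "(*)"] prod.cong) auto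

lemma minor_sum_eq_0:
  assumes I: "finite I" and ab: "a \<in> I" "b \<in> I" "a \<noteq> b" and v: "v a = v b"
  shows "minor_sum N I v = 0"
proof -
  define J where "J = I - {a, b}"
  have J: "I = insert a (insert b J)" "a \<notin> insert b J" "b \<notin> J" "a \<notin> J" "finite J"
    using assms by (auto simp: J_def)
  define h where "h s x y = of_int (pairprod sgn_diff I (s(b := y, a := x))) *
      (v b x * (v b y * (\<Prod>i\<in>J. v i (s i))))" for s x y
  have "minor_sum N I v = (\<Sum>x\<in>{0..<N}. \<Sum>y\<in>{0..<N}. \<Sum>s\<in>J \<rightarrow>\<^sub>E {0..<N}. h s x y)"
  proof -
    have "(\<Prod>i\<in>I. v i ((s(b := y, a := x)) i)) = v b x * (v b y * (\<Prod>i\<in>J. v i (s i)))" for s x y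
    proof -
      have "(\<Prod>i\<in>J. v i ((s(b := y, a := x)) i)) = (\<Prod>i\<in>J. v i (s i))"
        using J by (intro prod.cong) auto
      then show ?thesis using J v ab by (simp del: fun_upd_apply) simp
    qed
    then show ?thesis
      unfolding minor_sum_def h_def unfolding J(1) sum_PiE_insert[OF J(2)] sum_PiE_insert[OF J(3)]
      by (simp add: J(1)[symmetric] del: fun_upd_apply)
  qed
  also have "\<dots> = (\<Sum>s\<in>J \<rightarrow>\<^sub>E {0..<N}. \<Sum>x\<in>{0..<N}. \<Sum>y\<in>{0..<N}. h s x y)"
    by (subst sum.swap, subst (2) sum.swap) (rule refl)
  also have "\<dots> = 0"
  proof (rule sum.neutral, rule ballI, rule antisymmetric_double_sum)
    fix s :: "nat \<Rightarrow> int" and x y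
    have "s(b := y, a := x) = s(b := x, a := y) \<circ> Transposition.transpose a b"
      using ab by (auto simp: fun_eq_iff Transposition.transpose_def)
    then show "h s x y = - h s y x"
      unfolding h_def using pairprod_transpose[OF I ab alternating_sgn_diff, of "s(b := x, a := y)"]
      by (simp add: mult_ac)
    show "h s x x = 0"
      unfolding h_def using pairprod_eq_0[OF I ab _ alternating_sgn_diff, of "s(b := x, a := x)"] by simp
  qed auto
  finally show ?thesis .
qed

lemma minor_sum_linear:
  assumes I: "finite I" "a \<in> I"
  shows "minor_sum N I (v(a := \<lambda>x. f x + c * g x)) =
           minor_sum N I (v(a := f)) + c * minor_sum N I (v(a := g))"
proof -
  have P: "(\<Prod>i\<in>I. (v(a := u)) i (s i)) = u (s a) * (\<Prod>i\<in>I - {a}. v i (s i))" for u s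
    using prod.remove[OF I, of "\<lambda>i. (v(a := u)) i (s i)"] by simp
  show ?thesis
    unfolding minor_sum_def P by (simp add: sum_distrib_left sum.distrib[symmetric] algebra_simps)
qed

lemma minor_sum_add_multiple:
  assumes "finite I" "a \<in> I" "b \<in> I" "a \<noteq> b"
  shows "minor_sum N I (v(a := \<lambda>x. v a x + c * v b x)) = minor_sum N I v"
  using minor_sum_linear[OF assms(1,2), of N v "v a" c "v b"]
    minor_sum_eq_0[OF assms, of "v(a := v b)" N] assms(4) by simp

text \<open>
  All multiples may be added at once, as the vectors that are added are not changed themselves.
\<close>

lemma minor_sum_change:
  assumes "finite I" "A \<subseteq> I" "\<And>i. i \<in> A \<Longrightarrow> b i \<in> I - A"
  shows "minor_sum N I (\<lambda>i. if i \<in> A then \<lambda>x. v i x + c i * v (b i) x else v i) = minor_sum N I v"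
proof -
  have "finite A" using assms finite_subset by blast
  then have "A \<subseteq> I \<Longrightarrow> (\<forall>i\<in>A. b i \<in> I - A) \<Longrightarrow> ?thesis"
  proof (induction A rule: finite_induct)
    case (insert a A)
    let ?w = "\<lambda>i. if i \<in> A then \<lambda>x. v i x + c i * v (b i) x else v i"
    have "(\<lambda>i. if i \<in> insert a A then \<lambda>x. v i x + c i * v (b i) x else v i) =
        ?w(a := \<lambda>x. ?w a x + c a * ?w (b a) x)"
      using insert by (auto simp: fun_eq_iff)
    moreover have "minor_sum N I (?w(a := \<lambda>x. ?w a x + c a * ?w (b a) x)) = minor_sum N I ?w"
      by (rule minor_sum_add_multiple) (use insert.prems insert.hyps assms(1) in auto)
    ultimately show ?case using insert by auto
  qed simp
  then show ?thesis using assms by blast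
qed

lemma pairprod_reindex:
  assumes "strict_mono_on I f"
  shows "pairprod \<kappa> (f ` I) s = pairprod \<kappa> I (s \<circ> f)"
proof -
  have inj: "inj_on f I" using assms by (rule strict_mono_on_imp_inj_on)
  have "{i\<in>f ` I. i < f j} = f ` {i\<in>I. i < j}" if "j \<in> I" for j
    using assms that inj by (auto simp: strict_mono_on_less)
  moreover have "inj_on f {i\<in>I. i < j}" for j using inj by (rule inj_on_subset) auto
  ultimately show ?thesis
    unfolding pairprod_def using inj by (simp add: prod.reindex)
qed

lemma minor_sum_reindex:
  assumes "strict_mono_on I f"
  shows "minor_sum N (f ` I) v = minor_sum N I (v \<circ> f)"
proof -
  have inj: "inj_on f I" using assms by (rule strict_mono_on_imp_inj_on)
  show ?thesis unfolding minor_sum_def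
  proof (rule sum.reindex_bij_witness[of _ "\<lambda>s. restrict (s \<circ> the_inv_into I f) (f ` I)" "\<lambda>s. restrict (s \<circ> f) I"])
    fix s assume s: "s \<in> f ` I \<rightarrow>\<^sub>E {0..<N}"
    show "restrict (restrict (s \<circ> f) I \<circ> the_inv_into I f) (f ` I) = s"
      using s inj by (auto simp: fun_eq_iff the_inv_into_f_f restrict_def PiE_def extensional_def)
    show "restrict (s \<circ> f) I \<in> I \<rightarrow>\<^sub>E {0..<N}" using s by auto
    show "of_int (pairprod sgn_diff I (restrict (s \<circ> f) I)) * (\<Prod>i\<in>I. (v \<circ> f) i (restrict (s \<circ> f) I i)) =
        of_int (pairprod sgn_diff (f ` I) s) * (\<Prod>i\<in>f ` I. v i (s i))"
      using pairprod_cong[of I "restrict (s \<circ> f) I" "s \<circ> f" sgn_diff] inj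
      by (simp add: pairprod_reindex[OF assms] prod.reindex)
  next
    fix s assume s: "s \<in> I \<rightarrow>\<^sub>E {0..<N}"
    show "restrict (restrict (s \<circ> the_inv_into I f) (f ` I) \<circ> f) I = s"
      using s inj by (auto simp: fun_eq_iff the_inv_into_f_f restrict_def PiE_def extensional_def)
    show "restrict (s \<circ> the_inv_into I f) (f ` I) \<in> f ` I \<rightarrow>\<^sub>E {0..<N}"
      using s inj by (auto simp: the_inv_into_f_f)
  qed
qed

text \<open>
  In the expansion along \<open>v 0\<close> only the vectors of the second half survive, and removing \<open>v 0\<close> and
  one of them leaves a family of the same shape. This is the Laplace expansion of the determinant.
  The rows are listed in reverse so that the pairs \<open>(v (h - 1 - i), v (h + i))\<close> are nested, which
  makes all signs agree.
\<close>

lemma minor_sum_isotropic: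
  assumes "\<And>i j. i < h \<Longrightarrow> j < h \<Longrightarrow> omega N (v i) (v j) = 0"
  shows "minor_sum N {..<2 * h} v = det (mat h h (\<lambda>(i, j). omega N (v (h - 1 - i)) (v (h + j))))"
  using assms
proof (induction h arbitrary: v)
  case 0
  show ?case by (simp add: minor_sum_def pairprod_def det_def)
next
  case (Suc h)
  define A where "A = mat (Suc h) (Suc h) (\<lambda>(i, j). omega N (v (h - i)) (v (Suc h + j)))"
  define J where "J = {Suc 0..<2 * Suc h}"
  have "{..<2 * Suc h} = insert 0 J" by (auto simp: J_def)
  then have "minor_sum N {..<2 * Suc h} v =
      (\<Sum>j\<in>J. (- 1) ^ card {i\<in>J. i < j} * omega N (v 0) (v j) * minor_sum N (J - {j}) v)"
    using minor_sum_expand_even[of J 0 N v] by (simp add: J_def)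
  also have "\<dots> = (\<Sum>j\<in>{Suc h..<2 * Suc h}. (- 1) ^ card {i\<in>J. i < j} * omega N (v 0) (v j) * minor_sum N (J - {j}) v)"
    by (rule sum.mono_neutral_right) (auto simp: J_def Suc.prems)
  also have "\<dots> = (\<Sum>k<Suc h. A $$ (h, k) * cofactor A h k)"
  proof (rule sum.reindex_bij_witness[of _ "\<lambda>k. Suc h + k" "\<lambda>j. j - Suc h"])
    fix j assume "j \<in> {Suc h..<2 * Suc h}"
    then obtain k where k: "j = Suc h + k" "k < Suc h"
      by (metis add_less_cancel_left atLeastLessThan_iff le_Suc_ex mult_2)
    \<comment> \<open>The increasing enumeration of the positions other than \<open>0\<close> and \<open>j\<close>.\<close>
    define f where "f i = (if i < h + k then i + 1 else i + 2)" for i :: nat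
    have "{i\<in>J. i < j} = {Suc 0..<j}" using k by (auto simp: J_def)
    then have card: "card {i\<in>J. i < j} = h + k" using k by simp
    have mono: "strict_mono_on {..<2 * h} f" by (auto simp: strict_mono_on_def f_def)
    have "J - {j} \<subseteq> f ` {..<2 * h}"
    proof
      fix x assume x: "x \<in> J - {j}"
      show "x \<in> f ` {..<2 * h}"
      proof (cases "x < j")
        case True
        then show ?thesis using x k by (intro image_eqI[of _ _ "x - 1"]) (auto simp: J_def f_def)
      next
        case False
        then show ?thesis using x k by (intro image_eqI[of _ _ "x - 2"]) (auto simp: J_def f_def)
      qed
    qed
    then have "J - {j} = f ` {..<2 * h}" using k by (auto simp: J_def f_def)
    then have "minor_sum N (J - {j}) v = minor_sum N {..<2 * h} (v \<circ> f)"
      using minor_sum_reindex[OF mono, of N v] by simp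
    also have "\<dots> = det (mat h h (\<lambda>(i, j). omega N ((v \<circ> f) (h - 1 - i)) ((v \<circ> f) (h + j))))"
      by (rule Suc.IH) (auto simp: f_def intro!: Suc.prems)
    also have "mat h h (\<lambda>(i, j). omega N ((v \<circ> f) (h - 1 - i)) ((v \<circ> f) (h + j))) = mat_delete A h k"
      by (rule eq_matI) (auto simp: mat_delete_def A_def f_def Suc_diff_Suc)
    finally show "A $$ (h, j - Suc h) * cofactor A h (j - Suc h) =
        (- 1) ^ card {i\<in>J. i < j} * omega N (v 0) (v j) * minor_sum N (J - {j}) v"
      using k card by (simp add: cofactor_def A_def mult_ac)
  qed auto
  also have "\<dots> = det A"
    by (rule laplace_expansion_row[symmetric]) (auto simp: A_def)
  finally show ?case by (simp add: A_def)
qed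

section \<open>Minors of cyclic sequences and correlations\<close>

lemma sum_int_telescope:
  fixes g :: "int \<Rightarrow> 'a::ab_group_add"
  assumes "a \<le> b"
  shows "(\<Sum>s\<in>{a..<b}. g (s + 1) - g s) = g b - g a"
  using assms
proof (induction b rule: int_ge_induct)
  case (step b)
  have "{a..<b + 1} = insert b {a..<b}" using step by auto
  then show ?case using step by simp
qed simp

lemma sum_periodic_shift:
  fixes p :: "int \<Rightarrow> 'a::ab_group_add"
  assumes "N \<ge> 0" and "\<And>s. p (s + N) = p s"
  shows "(\<Sum>s\<in>{0..<N}. p (s + a)) = (\<Sum>s\<in>{0..<N}. p s)"
proof -
  have 1: "(\<Sum>s\<in>{0..<N}. p (s + (a + 1))) = (\<Sum>s\<in>{0..<N}. p (s + a))" for a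
  proof -
    have "(\<Sum>s\<in>{0..<N}. p (s + 1 + a) - p (s + a)) = p (N + a) - p (0 + a)"
      by (rule sum_int_telescope) (rule assms)
    also have "p (N + a) = p (0 + a)" using assms(2)[of a] by (simp add: add.commute)
    finally show ?thesis by (simp add: sum_subtractf ac_simps)
  qed
  show ?thesis
  proof (induction a rule: int_induct[of _ 0])
    case (step2 i)
    then show ?case using 1[of "i - 1"] by simp
  qed (simp_all add: 1)
qed

text \<open>
  The values of \<open>t\<close> below and above \<open>s\<close> form two telescoping sums with opposite signs.
\<close>

lemma sum_sgn_diff_telescope:
  fixes g :: "int \<Rightarrow> 'a::comm_ring_1"
  assumes "s \<in> {0..<N}"
  shows "(\<Sum>t\<in>{0..<N}. of_int (sgn_diff s t) * (g (t + 1) - g t)) = g s + g (s + 1) - (g 0 + g N)"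
proof -
  have "{0..<N} = {0..<s} \<union> ({s} \<union> {s + 1..<N})" using assms by auto
  then have "(\<Sum>t\<in>{0..<N}. of_int (sgn_diff s t) * (g (t + 1) - g t)) =
      (\<Sum>t\<in>{0..<s} \<union> ({s} \<union> {s + 1..<N}). of_int (sgn_diff s t) * (g (t + 1) - g t))"
    by simp
  also have "\<dots> = (\<Sum>t\<in>{0..<s}. of_int (sgn_diff s t) * (g (t + 1) - g t)) +
      (\<Sum>t\<in>{s + 1..<N}. of_int (sgn_diff s t) * (g (t + 1) - g t))"
    by (subst sum.union_disjoint; (subst sum.union_disjoint)?) (auto simp: sgn_diff_def)
  also have "(\<Sum>t\<in>{0..<s}. of_int (sgn_diff s t) * (g (t + 1) - g t)) = (\<Sum>t\<in>{0..<s}. g (t + 1) - g t)"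
    by (intro sum.cong) (auto simp: sgn_diff_def)
  also have "(\<Sum>t\<in>{s + 1..<N}. of_int (sgn_diff s t) * (g (t + 1) - g t)) =
      (\<Sum>t\<in>{s + 1..<N}. - (g (t + 1) - g t))"
    by (intro sum.cong) (auto simp: sgn_diff_def)
  also have "\<dots> = - (g N - g (s + 1))"
    unfolding sum_negf by (subst sum_int_telescope) (use assms in auto)
  also have "(\<Sum>t\<in>{0..<s}. g (t + 1) - g t) = g s - g 0"
    by (subst sum_int_telescope) (use assms in auto)
  finally show ?thesis by simp
qed

text \<open>
  Summation by parts: on differences, the skew form becomes the ordinary inner product, up to a
  boundary term. This is the source of the correlations in the determinants.
\<close>

lemma omega_difference:
  "omega N f (\<lambda>t. g (t + 1) - g t) =
     (\<Sum>s\<in>{0..<N}. f s * (g s + g (s + 1))) - (g 0 + g N) * (\<Sum>s\<in>{0..<N}. f s)"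
proof -
  have "omega N f (\<lambda>t. g (t + 1) - g t) =
      (\<Sum>s\<in>{0..<N}. f s * (\<Sum>t\<in>{0..<N}. of_int (sgn_diff s t) * (g (t + 1) - g t)))"
    unfolding omega_def by (simp add: sum_distrib_left mult_ac)
  also have "\<dots> = (\<Sum>s\<in>{0..<N}. f s * (g s + g (s + 1) - (g 0 + g N)))"
    by (intro sum.cong refl) (simp only: sum_sgn_diff_telescope)
  finally show ?thesis
    by (simp add: right_diff_distrib sum_subtractf sum_distrib_left mult.commute)
qed

lemma omega_diff_right: "omega N f (\<lambda>t. g t - h t) = omega N f g - omega N f h"
  unfolding omega_def by (simp add: right_diff_distrib sum_subtractf)

lemma omega_add_right: "omega N f (\<lambda>t. g t + h t) = omega N f g + omega N f h"
  unfolding omega_def by (simp add: distrib_left sum.distrib)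

lemma omega_add_left: "omega N (\<lambda>t. g t + h t) f = omega N g f + omega N h f"
  unfolding omega_def by (simp add: distrib_left distrib_right sum.distrib)

lemma omega_antisym: "omega N f g = - omega N g f"
proof -
  have "sgn_diff s t = - sgn_diff t s" for s t by (simp add: sgn_diff_def sgn_if)
  then have "omega N g f = (\<Sum>s\<in>{0..<N}. \<Sum>t\<in>{0..<N}. - (of_int (sgn_diff t s) * f t * g s))"
    unfolding omega_def by (intro sum.cong refl) (metis (no_types) mult.commute mult.assoc mult_minus_left of_int_minus)
  also have "\<dots> = - omega N f g"
    unfolding omega_def by (subst sum.swap) (simp add: sum_negf)
  finally show ?thesis by simp
qed

lemma omega_self: "omega N f f = 0"
  unfolding omega_def
proof (rule antisymmetric_double_sum)
  fix x y
  have "sgn_diff x y = - sgn_diff y x" by (simp add: sgn_diff_def sgn_if)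
  then show "of_int (sgn_diff x y) * f x * f y = - (of_int (sgn_diff y x) * f y * f x)"
    by (simp only: of_int_minus) (simp add: mult_ac)
qed (auto simp: sgn_diff_def)

lemma det_leibniz:
  fixes B :: "nat \<Rightarrow> nat \<Rightarrow> 'a::comm_ring_1"
  shows "det (mat n n (\<lambda>(i, j). B i j)) =
    (\<Sum>p | p permutes {..<n}. of_int (sign p) * (\<Prod>i<n. B i (p i)))"
  using det_def'[of "mat n n (\<lambda>(i, j). B i j)" n] by (simp add: lessThan_atLeast0)

text \<open>
  The matrix \<open>B\<close> is \<open>G\<close> times a unitriangular matrix.
\<close>

lemma det_add_twice_previous_columns:
  fixes B G :: "nat \<Rightarrow> nat \<Rightarrow> 'a::comm_ring_1"
  assumes "\<And>i j. i < h \<Longrightarrow> j < h \<Longrightarrow> B i j = G i j + 2 * (\<Sum>k<j. G i k)"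
  shows "det (mat h h (\<lambda>(i, j). B i j)) = det (mat h h (\<lambda>(i, j). G i j))"
proof -
  define U :: "'a mat" where "U = mat h h (\<lambda>(k, j). if k = j then 1 else if k < j then 2 else 0)"
  have "mat h h (\<lambda>(i, j). B i j) = mat h h (\<lambda>(i, j). G i j) * U"
  proof (rule eq_matI)
    fix i j assume ij: "i < dim_row (mat h h (\<lambda>(i, j). G i j) * U)" "j < dim_col (mat h h (\<lambda>(i, j). G i j) * U)"
    then have ij: "i < h" "j < h" by (auto simp: U_def)
    have "(mat h h (\<lambda>(i, j). G i j) * U) $$ (i, j) =
        (\<Sum>k\<in>{0..<h}. G i k * (if k = j then 1 else if k < j then 2 else 0))"
      using ij by (simp add: U_def scalar_prod_def)
    also have "\<dots> = (\<Sum>k\<in>insert j {..<j}. G i k * (if k = j then 1 else if k < j then 2 else 0))"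
      by (rule sum.mono_neutral_right) (use ij in auto)
    also have "\<dots> = G i j + (\<Sum>k<j. G i k * 2)"
      by (simp add: sum.insert_if)
    also have "\<dots> = B i j"
      using assms[OF ij] by (simp add: sum_distrib_left mult.commute)
    finally show "mat h h (\<lambda>(i, j). B i j) $$ (i, j) = (mat h h (\<lambda>(i, j). G i j) * U) $$ (i, j)"
      using ij by simp
  qed (auto simp: U_def)
  moreover have "det U = 1"
    by (subst det_upper_triangular[of _ h]) (auto simp: U_def prod_list_diag_prod)
  moreover have "U \<in> carrier_mat h h" by (simp add: U_def)
  ultimately show ?thesis using det_mult[of "mat h h (\<lambda>(i, j). G i j)" h U] by simp
qed

text \<open>
  The value of \<open>\<eta>\<close> will be \<open>1\<close> for an odd and \<open>-1\<close> for an even number of columns.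
\<close>

locale cyclic_sequence =
  fixes N :: int and \<eta> :: "'a::comm_ring_1" and E :: "int \<Rightarrow> 'a"
  assumes N_pos: "N > 0" and eta_sq: "\<eta> * \<eta> = 1" and quasi_periodic: "E (s + N) = \<eta> * E s"
begin

definition corr :: "int \<Rightarrow> 'a" where
  "corr r = (\<Sum>s\<in>{0..<N}. E s * E (s + r))"

text \<open>
  Products of two values are periodic because \<open>\<eta>\<close> squares to \<open>1\<close>, so the sum over a period may be
  shifted.
\<close>

lemma sum_shift_mult: "(\<Sum>s\<in>{0..<N}. E (s + a) * E (s + b)) = corr (b - a)"
proof -
  have per: "E (s + N) * E (s + N + r) = E s * E (s + r)" for s r
  proof -
    have "E (s + N) * E (s + N + r) = \<eta> * E s * (\<eta> * E (s + r))"
      using quasi_periodic[of s] quasi_periodic[of "s + r"] by (simp add: ac_simps)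
    then show ?thesis using eta_sq by (metis mult.assoc mult.commute mult.right_neutral)
  qed
  have "(\<Sum>s\<in>{0..<N}. E (s + a) * E (s + a + (b - a))) = corr (b - a)"
    unfolding corr_def
    by (rule sum_periodic_shift[where p = "\<lambda>s. E s * E (s + (b - a))"]) (use N_pos per in auto)
  then show ?thesis by simp
qed

lemma corr_minus: "corr (- r) = corr r"
  using sum_shift_mult[of "- r" 0] by (simp add: corr_def mult.commute)

text \<open>
  The boundary term of the summation by parts vanishes either because the two end values cancel or
  because the entries of \<open>f\<close> sum to zero.
\<close>

lemma omega_shift_step:
  assumes "\<eta> = - 1 \<or> (\<Sum>s\<in>{0..<N}. f s) = 0"
  shows "omega N f (\<lambda>s. E (s + (b + 1))) = omega N f (\<lambda>s. E (s + b)) +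
           (\<Sum>s\<in>{0..<N}. f s * E (s + b)) + (\<Sum>s\<in>{0..<N}. f s * E (s + (b + 1)))"
proof -
  have "(E (0 + b) + E (N + b)) * (\<Sum>s\<in>{0..<N}. f s) = 0"
    using assms quasi_periodic[of b] by (auto simp: add.commute)
  then have "omega N f (\<lambda>s. E (s + 1 + b) - E (s + b)) =
      (\<Sum>s\<in>{0..<N}. f s * (E (s + b) + E (s + 1 + b)))"
    using omega_difference[of N f "\<lambda>s. E (s + b)"] by simp
  then show ?thesis
    by (simp add: omega_diff_right distrib_left sum.distrib add_ac algebra_simps)
qed

text \<open>
  For \<open>\<eta> = -1\<close> the form \<open>\<omega>\<close> is invariant under simultaneous shifts, so its values on shifts of \<open>E\<close>
  form an odd function \<open>z\<close> of the difference. Sums of mirror images are then isotropic. The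
  resulting determinant has entries \<open>z (i + j + 1) + z (j - i)\<close>, and the recursion
  \<open>z (r + 1) - z r = corr r + corr (r + 1)\<close> turns its columns into partial sums of the columns of
  correlations.
\<close>

lemma minor_sum_even:
  assumes eta: "\<eta> = - 1"
  shows "minor_sum N {..<2 * h} (\<lambda>j s. E (s + int j)) =
    det (mat h h (\<lambda>(i, j). corr (int j - int i) + corr (int i + int j + 1)))"
proof -
  define v where "v a s = E (s + a)" for a s :: int
  have v_eq: "(\<lambda>j s. E (s + int j)) = (\<lambda>i. v (int i))" by (simp add: fun_eq_iff v_def)
  define z where "z r = omega N (v 0) (v r)" for r
  have step: "omega N (v a) (v (b + 1)) = omega N (v a) (v b) + corr (b - a) + corr (b + 1 - a)" for a b
    unfolding v_def using omega_shift_step[of "\<lambda>s. E (s + a)" b] eta by (simp add: sum_shift_mult)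
  have inv: "omega N (v (a + 1)) (v (b + 1)) = omega N (v a) (v b)" for a b
  proof -
    have "omega N (v (a + 1)) (v b) = - (omega N (v b) (v a) + corr (a - b) + corr (a + 1 - b))"
      using omega_antisym[of N "v (a + 1)" "v b"] step[of b a] by simp
    then show ?thesis
      using step[of "a + 1" b] omega_antisym[of N "v a" "v b"] corr_minus[of "a - b"] corr_minus[of "a + 1 - b"]
      by simp
  qed
  have z: "omega N (v a) (v b) = z (b - a)" for a b
  proof (induction a arbitrary: b rule: int_induct[of _ 0])
    case base
    then show ?case by (simp add: z_def)
  next
    case (step1 i)
    then show ?case using inv[of i "b - 1"] by (simp add: algebra_simps)
  next
    case (step2 i)
    then show ?case using inv[of "i - 1" b] by (simp add: algebra_simps)
  qed
  have z0: "z 0 = 0" by (simp add: z_def omega_self)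
  have z_minus: "z (- r) = - z r" for r
    using omega_antisym[of N "v r" "v 0"] z[of r 0] z[of 0 r] by simp
  have z_Suc: "z (r + 1) = z r + corr r + corr (r + 1)" for r
    using step[of 0 r] by (simp add: z_def)
  \<comment> \<open>Add to each vector of the first half its mirror image.\<close>
  define w where "w i = (if i \<in> {..<h} then (\<lambda>x. v (int i) x + 1 * v (int (2 * h - 1 - i)) x) else v (int i))" for i
  have w: "w i = (\<lambda>x. v (int i) x + v (2 * int h - 1 - int i) x)" if "i < h" for i
    using that by (auto simp: w_def of_nat_diff algebra_simps)
  have "minor_sum N {..<2 * h} (\<lambda>j s. E (s + int j)) = minor_sum N {..<2 * h} (\<lambda>i. v (int i))"
    unfolding v_eq ..
  also have "\<dots> = minor_sum N {..<2 * h} w"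
    unfolding w_def by (rule minor_sum_change[symmetric]) auto
  also have "\<dots> = det (mat h h (\<lambda>(i, j). omega N (w (h - 1 - i)) (w (h + j))))"
  proof (rule minor_sum_isotropic)
    fix i j assume "i < h" "j < h"
    then have "omega N (w i) (w j) = z (int j - int i) + z (2 * int h - 1 - int j - int i)
        + (z (int j - (2 * int h - 1 - int i)) + z (2 * int h - 1 - int j - (2 * int h - 1 - int i)))"
      by (simp add: w omega_add_left omega_add_right z)
    also have "\<dots> = 0"
      using z_minus[of "int j - int i"] z_minus[of "int j - (2 * int h - 1 - int i)"]
      by (simp add: algebra_simps)
    finally show "omega N (w i) (w j) = 0" .
  qed
  also have "mat h h (\<lambda>(i, j). omega N (w (h - 1 - i)) (w (h + j))) =
      mat h h (\<lambda>(i, j). z (int i + int j + 1) + z (int j - int i))"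
  proof (rule eq_matI)
    fix i j assume "i < dim_row (mat h h (\<lambda>(i, j). z (int i + int j + 1) + z (int j - int i)))"
      "j < dim_col (mat h h (\<lambda>(i, j). z (int i + int j + 1) + z (int j - int i)))"
    then have ij: "i < h" "j < h" by auto
    have "w (h + j) = v (int h + int j)" by (simp add: w_def)
    moreover have "w (h - 1 - i) = (\<lambda>x. v (int h - 1 - int i) x + v (int h + int i) x)"
      using ij w[of "h - 1 - i"] by (simp add: of_nat_diff algebra_simps)
    ultimately show "mat h h (\<lambda>(i, j). omega N (w (h - 1 - i)) (w (h + j))) $$ (i, j) =
        mat h h (\<lambda>(i, j). z (int i + int j + 1) + z (int j - int i)) $$ (i, j)"
      using ij by (simp add: omega_add_left z algebra_simps)
  qed auto
  also have "det \<dots> = det (mat h h (\<lambda>(i, j). corr (int j - int i) + corr (int i + int j + 1)))"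
  proof (rule det_add_twice_previous_columns)
    fix i j :: nat
    show "z (int i + int j + 1) + z (int j - int i) = corr (int j - int i) + corr (int i + int j + 1) +
        2 * (\<Sum>k<j. corr (int k - int i) + corr (int i + int k + 1))"
    proof (induction j)
      case 0
      show ?case using z_Suc[of "int i"] z_minus[of "int i"] corr_minus[of "int i"] by simp
    next
      case (Suc j)
      have "z (int i + int (Suc j) + 1) + z (int (Suc j) - int i) =
          (z (int i + int j + 1) + z (int j - int i)) + corr (int i + int j + 1) + corr (int i + int j + 2)
          + corr (int j - int i) + corr (int j - int i + 1)"
        using z_Suc[of "int i + int j + 1"] z_Suc[of "int j - int i"] by (simp add: algebra_simps)
      then show ?case unfolding Suc.IH by (simp add: algebra_simps)
    qed
  qed
  finally show ?thesis .
qed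

text \<open>
  For \<open>\<eta> = 1\<close> the boundary term of the summation by parts vanishes only against vectors whose entries
  sum to zero. Differences of mirror images have this property, and so do all vectors after subtracting the middle one from
  those to its right. The odd expansion then has a single term, the one that removes the middle
  vector. The values \<open>Y i k\<close> of the form against a shift by \<open>k\<close> from the middle have increments
  \<open>D i k + D i (k + 1)\<close> with \<open>D i\<close> odd. So \<open>Y i\<close> is even, which is isotropy.
\<close>

lemma minor_sum_odd:
  assumes eta: "\<eta> = 1"
  shows "minor_sum N {..<2 * h + 1} (\<lambda>j s. E (s + int j)) =
    (\<Sum>s\<in>{0..<N}. E s) * det (mat h h (\<lambda>(i, j). corr (int j - int i) - corr (int i + int j + 2)))"
proof -
  define v where "v a s = E (s + a)" for a s :: int
  \<comment> \<open>Left of the middle subtract the mirror image, right of the middle subtract the middle vector.\<close>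
  define w where "w i = (if i < h then (\<lambda>x. v (int i) x - v (2 * int h - int i) x)
      else if i = h then v (int h) else (\<lambda>x. v (int i) x - v (int h) x))" for i
  have v_eq: "(\<lambda>j s. E (s + int j)) = (\<lambda>i. v (int i))" by (simp add: fun_eq_iff v_def)
  define D where "D i k = (\<Sum>s\<in>{0..<N}. w i s * v (int h + k) s)" for i :: nat and k :: int
  define Y where "Y i k = omega N (w i) (v (int h + k))" for i :: nat and k :: int
  have sum_v: "(\<Sum>s\<in>{0..<N}. v a s) = (\<Sum>s\<in>{0..<N}. E s)" for a
    unfolding v_def by (rule sum_periodic_shift) (use N_pos quasi_periodic eta in auto)
  have sum_w: "(\<Sum>s\<in>{0..<N}. w i s) = (if i = h then (\<Sum>s\<in>{0..<N}. E s) else 0)" for i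
    unfolding w_def by (simp add: sum_subtractf sum_v)
  have D: "D i k = corr (k + (int h - int i)) - corr (k - (int h - int i))" if "i < h" for i k
    using that sum_shift_mult[of "int i" "int h + k"] sum_shift_mult[of "2 * int h - int i" "int h + k"]
    unfolding D_def w_def v_def
    by (simp add: left_diff_distrib sum_subtractf) (simp add: algebra_simps)
  have D_minus: "D i (- k) = - D i k" if "i < h" for i k
    using corr_minus[of "k - (int h - int i)"] corr_minus[of "k + (int h - int i)"]
    by (simp add: D[OF that] algebra_simps)
  have Y: "Y i (k + 1) = Y i k + D i k + D i (k + 1)" if "i < h" for i k
    using omega_shift_step[of "w i" "int h + k"] sum_w[of i] that
    unfolding Y_def D_def v_def by (simp add: add.assoc)
  have Y_even: "Y i (- int n) = Y i (int n)" if "i < h" for i n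
  proof (induction n)
    case (Suc n)
    have "Y i (- int (Suc n)) = Y i (- int n) - D i (- int (Suc n)) - D i (- int n)"
      using Y[OF that, of "- int (Suc n)"] by simp
    also have "\<dots> = Y i (int n) + D i (int (Suc n)) + D i (int n)"
      unfolding Suc.IH D_minus[OF that] by simp
    also have "\<dots> = Y i (int (Suc n))"
      using Y[OF that, of "int n"] by (simp add: add.commute)
    finally show ?case .
  qed simp
  have "minor_sum N {..<2 * h + 1} (\<lambda>j s. E (s + int j)) = minor_sum N {..<2 * h + 1} (\<lambda>i. v (int i))"
    unfolding v_eq ..
  also have "\<dots> = minor_sum N {..<2 * h + 1} (\<lambda>i. if i \<in> {..<h} then
      (\<lambda>x. v (int i) x + (- 1) * v (int (2 * h - i)) x) else v (int i))" (is "_ = minor_sum _ _ ?u")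
    by (rule minor_sum_change[symmetric]) auto
  also have "\<dots> = minor_sum N {..<2 * h + 1} (\<lambda>i. if i \<in> {h<..<2 * h + 1} then
      (\<lambda>x. ?u i x + (- 1) * ?u h x) else ?u i)"
    by (rule minor_sum_change[symmetric]) auto
  also have "\<dots> = minor_sum N {..<2 * h + 1} w"
    by (rule minor_sum_cong) (auto simp: w_def of_nat_diff)
  also have "\<dots> = (\<Sum>j\<in>{..<2 * h + 1}. (- 1) ^ card {i\<in>{..<2 * h + 1}. i < j} *
      (if j = h then (\<Sum>s\<in>{0..<N}. E s) else 0) * minor_sum N ({..<2 * h + 1} - {j}) w)"
    unfolding sum_w[symmetric] by (rule minor_sum_expand_odd) auto
  also have "\<dots> = (\<Sum>j\<in>{h}. (- 1) ^ card {i\<in>{..<2 * h + 1}. i < j} *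
      (if j = h then (\<Sum>s\<in>{0..<N}. E s) else 0) * minor_sum N ({..<2 * h + 1} - {j}) w)"
    by (rule sum.mono_neutral_right) auto
  also have "\<dots> = (- 1) ^ h * (\<Sum>s\<in>{0..<N}. E s) * minor_sum N ({..<2 * h + 1} - {h}) w"
  proof -
    have "{i\<in>{..<2 * h + 1}. i < h} = {..<h}" by auto
    then show ?thesis by simp
  qed
  also have "minor_sum N ({..<2 * h + 1} - {h}) w = minor_sum N {..<2 * h} (w \<circ> (\<lambda>i. if i < h then i else i + 1))"
  proof -
    have "{..<2 * h + 1} - {h} \<subseteq> (\<lambda>i. if i < h then i else i + 1) ` {..<2 * h}"
    proof
      fix x assume x: "x \<in> {..<2 * h + 1} - {h}"
      show "x \<in> (\<lambda>i. if i < h then i else i + 1) ` {..<2 * h}"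
        using x by (cases "x < h") (auto intro: image_eqI[of _ _ x] image_eqI[of _ _ "x - 1"])
    qed
    then have "{..<2 * h + 1} - {h} = (\<lambda>i. if i < h then i else i + 1) ` {..<2 * h}" by auto
    then show ?thesis
      by (simp only:) (rule minor_sum_reindex, auto simp: strict_mono_on_def)
  qed
  also have "\<dots> = det (mat h h (\<lambda>(i, j). omega N (w (h - 1 - i)) (w (h + j + 1))))"
  proof (subst minor_sum_isotropic)
    fix i j assume ij: "i < h" "j < h"
    have "w j = (\<lambda>x. v (int h + (- int (h - j))) x - v (int h + int (h - j)) x)"
      using ij by (auto simp: w_def of_nat_diff algebra_simps)
    then have "omega N (w i) (w j) = Y i (- int (h - j)) - Y i (int (h - j))"
      unfolding Y_def using omega_diff_right by metis
    then have "omega N (w i) (w j) = 0" unfolding Y_even[OF ij(1)] by simp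
    then show "omega N ((w \<circ> (\<lambda>i. if i < h then i else i + 1)) i) ((w \<circ> (\<lambda>i. if i < h then i else i + 1)) j) = 0"
      using ij by simp
  next
    show "det (mat h h (\<lambda>(i, j). omega N ((w \<circ> (\<lambda>i. if i < h then i else i + 1)) (h - 1 - i))
        ((w \<circ> (\<lambda>i. if i < h then i else i + 1)) (h + j)))) =
        det (mat h h (\<lambda>(i, j). omega N (w (h - 1 - i)) (w (h + j + 1))))"
      by (intro arg_cong[of _ _ det] eq_matI) auto
  qed
  also have "mat h h (\<lambda>(i, j). omega N (w (h - 1 - i)) (w (h + j + 1))) =
      (- 1) \<cdot>\<^sub>m mat h h (\<lambda>(i, j). - (Y (h - 1 - i) (int j + 1) - Y (h - 1 - i) 0))"
  proof (rule eq_matI)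
    fix i j assume "i < dim_row ((- 1) \<cdot>\<^sub>m mat h h (\<lambda>(i, j). - (Y (h - 1 - i) (int j + 1) - Y (h - 1 - i) 0)))"
      "j < dim_col ((- 1) \<cdot>\<^sub>m mat h h (\<lambda>(i, j). - (Y (h - 1 - i) (int j + 1) - Y (h - 1 - i) 0)))"
    then have ij: "i < h" "j < h" by auto
    have "w (h + j + 1) = (\<lambda>x. v (int h + (int j + 1)) x - v (int h + 0) x)"
      by (simp add: w_def add_ac)
    then show "mat h h (\<lambda>(i, j). omega N (w (h - 1 - i)) (w (h + j + 1))) $$ (i, j) =
        ((- 1) \<cdot>\<^sub>m mat h h (\<lambda>(i, j). - (Y (h - 1 - i) (int j + 1) - Y (h - 1 - i) 0))) $$ (i, j)"
      using ij by (simp add: omega_diff_right Y_def)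
  qed auto
  also have "det \<dots> = (- 1) ^ h * det (mat h h (\<lambda>(i, j). - (Y (h - 1 - i) (int j + 1) - Y (h - 1 - i) 0)))"
    by simp
  also have "det (mat h h (\<lambda>(i, j). - (Y (h - 1 - i) (int j + 1) - Y (h - 1 - i) 0))) =
      det (mat h h (\<lambda>(i, j). corr (int j - int i) - corr (int i + int j + 2)))"
  proof (rule det_add_twice_previous_columns)
    fix i j assume "i < h"
    then have less: "h - 1 - i < h" and m: "int h - int (h - 1 - i) = int i + 1" by auto
    have D': "- D (h - 1 - i) (int k + 1) = corr (int k - int i) - corr (int i + int k + 2)" for k
      using D[OF less, of "int k + 1"] m by (simp add: algebra_simps)
    show "- (Y (h - 1 - i) (int j + 1) - Y (h - 1 - i) 0) = corr (int j - int i) - corr (int i + int j + 2)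
        + 2 * (\<Sum>k<j. corr (int k - int i) - corr (int i + int k + 2))"
    proof (induction j)
      case 0
      have "D (h - 1 - i) 0 = 0" using D[OF less, of 0] corr_minus[of "int i + 1"] unfolding m by (simp add: algebra_simps)
      then show ?case using D'[of 0] Y[OF less, of 0] by simp
    next
      case (Suc j)
      have "- (Y (h - 1 - i) (int (Suc j) + 1) - Y (h - 1 - i) 0) =
          - (Y (h - 1 - i) (int j + 1) - Y (h - 1 - i) 0) - D (h - 1 - i) (int j + 1) - D (h - 1 - i) (int (Suc j) + 1)"
        using Y[OF less, of "int j + 1"] by (simp add: algebra_simps)
      then show ?case
        unfolding Suc.IH using D'[of j] D'[of "Suc j"] by (simp add: algebra_simps)
    qed
  qed
  finally show ?thesis
    by (simp add: power_mult_distrib[symmetric] mult.left_commute[of _ "(- 1) ^ h"] mult_ac flip: mult.assoc)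
qed

end

section \<open>Periodization and affine signs\<close>

text \<open>
  The power with an integer exponent of an element that squares to \<open>1\<close>.
\<close>

definition ipow :: "'a::comm_ring_1 \<Rightarrow> int \<Rightarrow> 'a" where
  "ipow u k = (if even k then 1 else u)"

text \<open>
  The sign $(-1)^{n-1}$ by which a cyclic shift of \<open>n\<close> rows changes a determinant, hence also the
  sign that accompanies the translation of a single coordinate by the period.
\<close>

definition parity_sign :: "nat \<Rightarrow> 'a::comm_ring_1" where
  "parity_sign n = (if even n then - 1 else 1)"

lemma ipow_add: "u * u = 1 \<Longrightarrow> ipow u (a + b) = ipow u a * ipow u b"
  by (auto simp: ipow_def)

lemma ipow_sq: "u * u = 1 \<Longrightarrow> ipow u k * ipow u k = 1"
  by (auto simp: ipow_def)

lemma ipow_sum: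
  assumes "u * u = 1"
  shows "ipow u (\<Sum>i\<in>A. k i) = (\<Prod>i\<in>A. ipow u (k i))"
  by (induction A rule: infinite_finite_induct) (simp_all add: ipow_add[OF assms], simp_all add: ipow_def)

lemma parity_sign_sq [simp]: "parity_sign n * parity_sign n = (1::'a::comm_ring_1)"
  by (simp add: parity_sign_def)

lemma of_int_ipow_parity_sign: "of_int (ipow (parity_sign n) k) = (ipow (parity_sign n) k :: 'a::comm_ring_1)"
  by (simp add: ipow_def parity_sign_def)

text \<open>
  The sign of the affine permutation that sorts \<open>a\<close> into the alcove, and \<open>0\<close> if two entries agree
  modulo \<open>N\<close>.
\<close>

definition affine_sign :: "nat \<Rightarrow> int \<Rightarrow> (nat \<Rightarrow> int) \<Rightarrow> int" where
  "affine_sign n N a = (\<Prod>i<n. ipow (parity_sign n) (a i div N)) * pairprod sgn_diff {..<n} (\<lambda>i. a i mod N)"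

text \<open>
  The sum of $\eta^k e_{s+Nk}$ over all integers \<open>k\<close>, written as a finite sum over the support
  \<open>{0..M}\<close> of \<open>e\<close>.
\<close>

definition periodization :: "int \<Rightarrow> 'a::comm_ring_1 \<Rightarrow> int \<Rightarrow> (int \<Rightarrow> 'a) \<Rightarrow> int \<Rightarrow> 'a" where
  "periodization N \<eta> M e s =
     (\<Sum>c\<in>{0..M}. if N dvd c - s then ipow \<eta> ((c - s) div N) * e c else 0)"

lemma cyclic_sequence_periodization:
  assumes "N > 0" "\<eta> * \<eta> = 1"
  shows "cyclic_sequence N \<eta> (periodization N \<eta> M e)"
proof
  fix s
  have "N dvd c - (s + N) \<longleftrightarrow> N dvd c - s" for c
    using dvd_diff[of N "c - s" N] dvd_add[of N "c - (s + N)" N] by (auto simp: algebra_simps)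
  moreover have "ipow \<eta> ((c - (s + N)) div N) = \<eta> * ipow \<eta> ((c - s) div N)" for c
  proof -
    have "(c - (s + N)) div N = (c - s + (- 1) * N) div N" by (simp add: algebra_simps)
    also have "\<dots> = - 1 + (c - s) div N" using assms(1) by (subst div_mult_self1) auto
    finally show ?thesis using ipow_add[OF assms(2), of "- 1" "(c - s) div N"] by (simp add: ipow_def)
  qed
  ultimately show "periodization N \<eta> M e (s + N) = \<eta> * periodization N \<eta> M e s"
    unfolding periodization_def by (simp add: sum_distrib_left mult.assoc if_distrib[of "(*) \<eta>"] cong: if_cong)
qed (use assms in auto)

lemma periodization_residue:
  fixes N :: int
  assumes "N > 0" "s \<in> {0..<N}"
  shows "N dvd a - s \<longleftrightarrow> s = a mod N" and "s = a mod N \<Longrightarrow> (a - s) div N = a div N"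
proof -
  show "N dvd a - s \<longleftrightarrow> s = a mod N"
  proof -
    have "s mod N = s" using assms by simp
    then show ?thesis using mod_eq_dvd_iff[of a N s] by auto
  qed
  show "(a - s) div N = a div N" if "s = a mod N"
  proof -
    have "a - s = N * (a div N)" using that by (simp add: minus_mod_eq_mult_div)
    then show ?thesis using assms(1) by simp
  qed
qed

text \<open>
  Expanding every periodization, a choice of indices \<open>c\<close> admits exactly one tuple of rows, namely
  the residues of the numbers \<open>c i - i\<close>, and their quotients supply the powers of the sign.
\<close>

lemma minor_sum_periodization:
  fixes e :: "int \<Rightarrow> 'a::comm_ring_1"
  assumes N: "N > 0"
  shows "minor_sum N {..<n} (\<lambda>j s. periodization N (parity_sign n) M e (s + int j)) =
    (\<Sum>c\<in>{..<n} \<rightarrow>\<^sub>E {0..M}. of_int (affine_sign n N (\<lambda>i. c i - int i)) * (\<Prod>i<n. e (c i)))"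
proof -
  let ?\<eta> = "parity_sign n :: 'a"
  define t where "t c s i = (if N dvd c i - int i - s i then ipow ?\<eta> ((c i - int i - s i) div N) * e (c i) else 0)"
    for c s :: "nat \<Rightarrow> int" and i
  have "minor_sum N {..<n} (\<lambda>j s. periodization N ?\<eta> M e (s + int j)) =
      (\<Sum>s\<in>{..<n} \<rightarrow>\<^sub>E {0..<N}. of_int (pairprod sgn_diff {..<n} s) * (\<Sum>c\<in>{..<n} \<rightarrow>\<^sub>E {0..M}. \<Prod>i<n. t c s i))"
    unfolding minor_sum_def
  proof (intro sum.cong refl arg_cong2[where f = "(*)"])
    fix s
    have "(\<Prod>i<n. periodization N ?\<eta> M e (s i + int i)) =
        (\<Prod>i<n. \<Sum>c\<in>{0..M}. if N dvd c - int i - s i then ipow ?\<eta> ((c - int i - s i) div N) * e c else 0)"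
    proof -
      have comm: "s i + int i = int i + s i" for i by simp
      show ?thesis unfolding periodization_def by (simp only: comm diff_diff_eq)
    qed
    also have "\<dots> = (\<Sum>c\<in>{..<n} \<rightarrow>\<^sub>E {0..M}. \<Prod>i<n. t c s i)"
      unfolding t_def by (rule prod_sum_PiE) auto
    finally show "(\<Prod>i<n. periodization N ?\<eta> M e (s i + int i)) = (\<Sum>c\<in>{..<n} \<rightarrow>\<^sub>E {0..M}. \<Prod>i<n. t c s i)" .
  qed
  also have "\<dots> = (\<Sum>c\<in>{..<n} \<rightarrow>\<^sub>E {0..M}. \<Sum>s\<in>{..<n} \<rightarrow>\<^sub>E {0..<N}.
      of_int (pairprod sgn_diff {..<n} s) * (\<Prod>i<n. t c s i))"
    by (subst sum.swap) (simp add: sum_distrib_left)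
  also have "\<dots> = (\<Sum>c\<in>{..<n} \<rightarrow>\<^sub>E {0..M}. of_int (affine_sign n N (\<lambda>i. c i - int i)) * (\<Prod>i<n. e (c i)))"
  proof (intro sum.cong refl)
    fix c :: "nat \<Rightarrow> int"
    define r where "r = restrict (\<lambda>i. (c i - int i) mod N) {..<n}"
    have r: "r \<in> {..<n} \<rightarrow>\<^sub>E {0..<N}" using N by (auto simp: r_def)
    have r_eq: "r i = (c i - int i) mod N" if "i < n" for i using that by (simp add: r_def)
    have zero: "(\<Prod>i<n. t c s i) = 0" if "s \<in> ({..<n} \<rightarrow>\<^sub>E {0..<N}) - {r}" for s
    proof -
      have s: "s \<in> {..<n} \<rightarrow>\<^sub>E {0..<N}" "s \<noteq> r" using that by auto
      have "\<exists>i\<in>{..<n}. s i \<noteq> r i"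
      proof (rule ccontr)
        assume "\<not> ?thesis"
        then have "s = r" by (intro PiE_ext[OF s(1) r]) simp
        then show False using s(2) by simp
      qed
      then obtain i where i: "i < n" "s i \<noteq> r i" by auto
      have mem: "s i \<in> {0..<N}" using s(1) i(1) by (rule PiE_mem[OF _ lessThan_iff[THEN iffD2]])
      have "s i \<noteq> (c i - int i) mod N" using i(2) unfolding r_eq[OF i(1)] .
      then have "\<not> N dvd c i - int i - s i"
        unfolding periodization_residue(1)[OF N mem] .
      then have "t c s i = 0" by (simp add: t_def)
      then show ?thesis using i by (intro prod_zero) auto
    qed
    have "(\<Sum>s\<in>{..<n} \<rightarrow>\<^sub>E {0..<N}. of_int (pairprod sgn_diff {..<n} s) * (\<Prod>i<n. t c s i)) =
        (\<Sum>s\<in>{r}. of_int (pairprod sgn_diff {..<n} s) * (\<Prod>i<n. t c s i))"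
    proof (rule sum.mono_neutral_right)
      show "\<forall>s\<in>({..<n} \<rightarrow>\<^sub>E {0..<N}) - {r}. of_int (pairprod sgn_diff {..<n} s) * (\<Prod>i<n. t c s i) = 0"
        by (intro ballI) (simp only: zero mult_zero_right)
    qed (use r in \<open>auto intro: finite_PiE\<close>)
    also have "\<dots> = of_int (pairprod sgn_diff {..<n} r) * (\<Prod>i<n. t c r i)" by simp
    also have "(\<Prod>i<n. t c r i) = (\<Prod>i<n. ipow ?\<eta> ((c i - int i) div N) * e (c i))"
    proof (intro prod.cong refl)
      fix i assume "i \<in> {..<n}"
      then have i: "i < n" by simp
      have ri: "r i = (c i - int i) mod N" by (rule r_eq[OF i])
      have mem: "r i \<in> {0..<N}" using r i by (rule PiE_mem[OF _ lessThan_iff[THEN iffD2]])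
      have "N dvd c i - int i - r i"
        unfolding periodization_residue(1)[OF N mem] by (rule ri)
      then show "t c r i = ipow ?\<eta> ((c i - int i) div N) * e (c i)"
        using periodization_residue(2)[OF N mem ri] by (simp only: t_def if_True)
    qed
    also have "pairprod sgn_diff {..<n} r = pairprod sgn_diff {..<n} (\<lambda>i. (c i - int i) mod N)"
      by (rule pairprod_cong) (simp add: r_def)
    finally show "(\<Sum>s\<in>{..<n} \<rightarrow>\<^sub>E {0..<N}. of_int (pairprod sgn_diff {..<n} s) * (\<Prod>i<n. t c s i)) =
        of_int (affine_sign n N (\<lambda>i. c i - int i)) * (\<Prod>i<n. e (c i))"
      by (simp add: affine_sign_def of_int_ipow_parity_sign prod.distrib mult_ac)
  qed
  finally show ?thesis .
qed

lemma affine_sign_cong: "(\<And>i. i < n \<Longrightarrow> a i = b i) \<Longrightarrow> affine_sign n N a = affine_sign n N b"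
  unfolding affine_sign_def by (intro arg_cong2[where f = "(*)"] prod.cong pairprod_cong) auto

lemma affine_sign_permutes:
  assumes "p permutes {..<n}"
  shows "affine_sign n N (a \<circ> p) = sign p * affine_sign n N a"
proof -
  have "(\<Prod>i<n. ipow (parity_sign n) ((a \<circ> p) i div N)) = (\<Prod>i<n. ipow (parity_sign n) (a i div N) :: int)"
    using prod.permute[OF assms, of "\<lambda>i. ipow (parity_sign n) (a i div N) :: int"] by (simp add: o_def)
  moreover have "pairprod sgn_diff {..<n} (\<lambda>i. (a \<circ> p) i mod N) =
      sign p * pairprod sgn_diff {..<n} (\<lambda>i. a i mod N)"
    using pairprod_permutes[OF _ assms alternating_sgn_diff, of "\<lambda>i. a i mod N"] by (simp add: o_def)
  ultimately show ?thesis by (simp add: affine_sign_def)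
qed

text \<open>
  The signs from the individual translations combine to a power whose exponent is the sum of the
  \<open>k i\<close>.
\<close>

lemma affine_sign_translate:
  assumes "N > 0" "(\<Sum>i<n. k i) = 0"
  shows "affine_sign n N (\<lambda>i. a i + N * k i) = affine_sign n N a"
proof -
  have "(\<Prod>i<n. ipow (parity_sign n) ((a i + N * k i) div N)) =
      ipow (parity_sign n) (\<Sum>i<n. k i) * (\<Prod>i<n. ipow (parity_sign n) (a i div N) :: int)"
    using assms(1) by (simp add: ipow_sum ipow_add prod.distrib mult.commute)
  then show ?thesis using assms by (simp add: affine_sign_def ipow_def)
qed

lemma affine_sign_eq_0:
  assumes "i < n" "j < n" "i \<noteq> j" "N dvd a i - a j"
  shows "affine_sign n N a = 0"
proof -
  have "a i mod N = a j mod N" using assms(4) by (simp add: mod_eq_dvd_iff)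
  then show ?thesis
    using pairprod_eq_0[of "{..<n}" i j "\<lambda>i. a i mod N" sgn_diff] assms alternating_sgn_diff
    by (simp add: affine_sign_def)
qed

lemma prod_pairs:
  fixes u :: "nat \<Rightarrow> 'a::comm_ring_1"
  shows "(\<Prod>j<n. \<Prod>i\<in>{i\<in>{..<n}. i < j}. u i * u j) = (\<Prod>i<n. u i ^ (n - 1))"
proof (induction n)
  case (Suc n)
  have "(\<Prod>j<Suc n. \<Prod>i\<in>{i\<in>{..<Suc n}. i < j}. u i * u j) = (\<Prod>j<Suc n. \<Prod>i<j. u i * u j)"
    by (rule prod.cong[OF refl], rule prod.cong) auto
  also have "\<dots> = (\<Prod>j<n. \<Prod>i<j. u i * u j) * ((\<Prod>i<n. u i) * u n ^ n)"
    by (simp add: prod.distrib)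
  also have "(\<Prod>j<n. \<Prod>i<j. u i * u j) = (\<Prod>j<n. \<Prod>i\<in>{i\<in>{..<n}. i < j}. u i * u j)"
    by (rule prod.cong[OF refl], rule prod.cong) auto
  also note Suc.IH
  also have "(\<Prod>i<n. u i ^ (n - 1)) * ((\<Prod>i<n. u i) * u n ^ n) = (\<Prod>i<n. u i ^ (n - 1) * u i) * u n ^ n"
    by (simp add: prod.distrib mult_ac)
  also have "(\<Prod>i<n. u i ^ (n - 1) * u i) = (\<Prod>i<n. u i ^ n)"
    by (intro prod.cong refl) (metis Suc_pred' gr_implies_not0 lessThan_iff neq0_conv power_Suc2)
  finally show ?case by simp
qed simp

section \<open>Alcoves and orbits of the affine symmetric group\<close>

text \<open>
  Decreasing vectors whose entries lie within one period. With \<open>l i = \<lambda> i - i\<close> and period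
  \<open>n + w\<close>, these are the weakly decreasing integer vectors \<open>\<lambda>\<close> of length \<open>n\<close> whose first and last
  entry differ by at most \<open>w\<close>.
\<close>

definition alcove :: "nat \<Rightarrow> int \<Rightarrow> (nat \<Rightarrow> int) set" where
  "alcove n N = {l \<in> extensional {..<n}. \<forall>i j. i < j \<longrightarrow> j < n \<longrightarrow> l j < l i \<and> l i < l j + N}"

lemma alcove_less: "l \<in> alcove n N \<Longrightarrow> i < j \<Longrightarrow> j < n \<Longrightarrow> l j < l i"
  by (simp add: alcove_def)

lemma alcove_diff_less:
  assumes "l \<in> alcove n N" "N > 0" "i < n" "j < n"
  shows "l i - l j < N"
proof -
  have "l i < l j + N" if "i < j" using assms that by (auto simp: alcove_def)
  moreover have "l i < l j" if "j < i" using assms that by (auto simp: alcove_def)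
  ultimately show ?thesis using assms by (cases i j rule: linorder_cases) force+
qed

lemma alcove_residues_distinct:
  assumes "l \<in> alcove n N" "N > 0" "i < n" "j < n" "N dvd l i - l j"
  shows "i = j"
proof (rule ccontr)
  assume "i \<noteq> j"
  then have "l i \<noteq> l j"
    using alcove_less[OF assms(1), of i j] alcove_less[OF assms(1), of j i] assms(3,4)
    by (cases i j rule: linorder_cases) auto
  moreover have "\<bar>l i - l j\<bar> < N"
    using alcove_diff_less[OF assms(1,2), of i j] alcove_diff_less[OF assms(1,2), of j i] assms by auto
  ultimately show False using assms(5) dvd_imp_le_int[of "l i - l j" N] by auto
qed

text \<open>
  Two entries of an alcove point differ by less than the period, so the order of their residues is
  reversed exactly if their quotients differ, and then they differ by one. Hence the sign of the
  residues is the product of the signs of the quotients over all pairs, in which every entry occurs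
  \<open>n - 1\<close> times.
\<close>

lemma affine_sign_alcove:
  assumes l: "l \<in> alcove n N" and N: "N > 0"
  shows "affine_sign n N l = 1"
proof -
  define u :: "nat \<Rightarrow> int" where "u i = ipow (- 1) (l i div N)" for i
  have u2: "u i * u i = 1" for i unfolding u_def by (rule ipow_sq) simp
  have pair: "sgn_diff (l i mod N) (l j mod N) = u i * u j" if "i < j" "j < n" for i j
  proof -
    have lij: "l j < l i" "l i < l j + N" using l that by (auto simp: alcove_def)
    define q where "q = l i div N - l j div N"
    have eq: "l i - l j = N * q + (l i mod N - l j mod N)"
      using mult_div_mod_eq[of N "l i"] mult_div_mod_eq[of N "l j"]
      by (simp add: q_def algebra_simps)
    have r: "0 \<le> l i mod N" "l i mod N < N" "0 \<le> l j mod N" "l j mod N < N" using N by auto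
    have "N * q < N * 2" "N * (- 1) < N * q" using eq lij r by linarith+
    then have "q < 2" "- 1 < q" using N mult_less_cancel_left_pos by blast+
    \<comment> \<open>The residues are in the same order as the entries if \<open>q = 0\<close>, and in the opposite order if \<open>q = 1\<close>.\<close>
    then consider "q = 0" | "q = 1" by linarith
    then show ?thesis
    proof cases
      case 1
      then have "l i div N = l j div N" "l i mod N > l j mod N" using eq lij by (auto simp: q_def)
      then show ?thesis using u2[of i] by (simp add: sgn_diff_def u_def)
    next
      case 2
      then have "l i div N = l j div N + 1" "l i mod N < l j mod N" using eq lij by (auto simp: q_def)
      then show ?thesis by (simp add: sgn_diff_def u_def ipow_def)
    qed
  qed
  have "pairprod sgn_diff {..<n} (\<lambda>i. l i mod N) = (\<Prod>j<n. \<Prod>i\<in>{i\<in>{..<n}. i < j}. u i * u j)"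
    unfolding pairprod_def by (intro prod.cong refl) (auto simp: pair)
  also have "\<dots> = (\<Prod>i<n. u i ^ (n - 1))" by (rule prod_pairs)
  also have "\<dots> = (\<Prod>i<n. ipow (parity_sign n) (l i div N))"
  proof (intro prod.cong refl)
    fix i assume "i \<in> {..<n}"
    then have "even n \<longleftrightarrow> odd (n - 1)" by auto
    moreover have "(- 1 :: int) ^ (n - 1) = (if odd (n - 1) then - 1 else 1)" by simp
    ultimately show "u i ^ (n - 1) = ipow (parity_sign n) (l i div N)"
      by (simp add: u_def ipow_def parity_sign_def)
  qed
  finally have "affine_sign n N l = (\<Prod>i<n. ipow (parity_sign n) (l i div N) * ipow (parity_sign n) (l i div N))"
    by (simp add: affine_sign_def prod.distrib)
  also have "\<dots> = 1" by (intro prod.neutral ballI ipow_sq) simp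
  finally show ?thesis .
qed

text \<open>
  The vector \<open>a\<close>, rearranged by \<open>\<sigma>\<close>, is \<open>l\<close> plus \<open>N\<close> times a vector of sum zero. Only the residues
  and the sum of \<open>l\<close> enter.
\<close>

definition alcove_match :: "nat \<Rightarrow> int \<Rightarrow> (nat \<Rightarrow> int) \<Rightarrow> (nat \<Rightarrow> int) \<Rightarrow> (nat \<Rightarrow> nat) \<Rightarrow> bool" where
  "alcove_match n N l a \<sigma> \<longleftrightarrow>
     \<sigma> permutes {..<n} \<and> (\<forall>i<n. N dvd a (\<sigma> i) - l i) \<and> (\<Sum>i<n. a i) = (\<Sum>i<n. l i)"

definition orbit_sign :: "nat \<Rightarrow> int \<Rightarrow> (nat \<Rightarrow> int) \<Rightarrow> (nat \<Rightarrow> int) \<Rightarrow> int" where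
  "orbit_sign n N l a = (\<Sum>\<sigma> | alcove_match n N l a \<sigma>. sign \<sigma>)"

lemma of_int_orbit_sign:
  "of_int (orbit_sign n N l a) =
     (\<Sum>\<sigma> | \<sigma> permutes {..<n}. if alcove_match n N l a \<sigma> then of_int (sign \<sigma>) else (0::'a::comm_ring_1))"
proof -
  have fin: "finite {\<sigma>. \<sigma> permutes {..<n}}" by (simp add: finite_permutations)
  have "{\<sigma>. alcove_match n N l a \<sigma>} = {\<sigma> \<in> {\<sigma>. \<sigma> permutes {..<n}}. alcove_match n N l a \<sigma>}"
    by (auto simp: alcove_match_def)
  then have "orbit_sign n N l a = (\<Sum>\<sigma> | \<sigma> permutes {..<n}. if alcove_match n N l a \<sigma> then sign \<sigma> else 0)"
    unfolding orbit_sign_def by (simp only: sum.inter_filter[OF fin])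
  then show ?thesis by (simp add: if_distrib[of of_int] cong: if_cong)
qed

lemma alcove_match_unique_perm:
  assumes l: "l \<in> alcove n N" and N: "N > 0"
    and m: "alcove_match n N l a \<sigma>" "alcove_match n N l a \<tau>"
  shows "\<sigma> = \<tau>"
proof
  fix i
  show "\<sigma> i = \<tau> i"
  proof (cases "i < n")
    case True
    have perm: "\<sigma> permutes {..<n}" "\<tau> permutes {..<n}" using m by (auto simp: alcove_match_def)
    define j where "j = inv_into UNIV \<tau> (\<sigma> i)"
    have j: "\<tau> j = \<sigma> i" using permutes_inverses(1)[OF perm(2)] by (simp add: j_def)
    have "\<sigma> i < n" using permutes_in_image[OF perm(1), of i] True by simp
    then have "j < n" using permutes_in_image[OF permutes_inv[OF perm(2)], of "\<sigma> i"] by (simp add: j_def)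
    then have "N dvd a (\<sigma> i) - l j" "N dvd a (\<sigma> i) - l i"
      using m True j unfolding alcove_match_def by metis+
    then have "N dvd l i - l j" using dvd_diff[of N "a (\<sigma> i) - l j" "a (\<sigma> i) - l i"] by simp
    then have "i = j" using alcove_residues_distinct[OF l N True \<open>j < n\<close>] by simp
    then show ?thesis using j by simp
  next
    case False
    then show ?thesis using m by (auto simp: alcove_match_def permutes_def)
  qed
qed

text \<open>
  The affine sign is alternating, invariant under translations of sum zero, and \<open>1\<close> on the alcove.
\<close>

lemma alcove_match_sign:
  assumes l: "l \<in> alcove n N" and N: "N > 0" and m: "alcove_match n N l a \<sigma>"
  shows "sign \<sigma> = affine_sign n N a"
proof -
  have perm: "\<sigma> permutes {..<n}" and sum: "(\<Sum>i<n. a i) = (\<Sum>i<n. l i)"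
    using m by (auto simp: alcove_match_def)
  define k where "k i = (a (\<sigma> i) - l i) div N" for i
  have k: "a (\<sigma> i) = l i + N * k i" if "i < n" for i
    using m that by (simp add: k_def alcove_match_def)
  have "(\<Sum>i<n. a i) = (\<Sum>i<n. a (\<sigma> i))" using sum.permute[OF perm, of a] by (simp add: o_def)
  also have "\<dots> = (\<Sum>i<n. l i + N * k i)" by (intro sum.cong) (simp_all add: k)
  also have "\<dots> = (\<Sum>i<n. l i) + N * (\<Sum>i<n. k i)" by (simp add: sum.distrib sum_distrib_left)
  finally have k0: "(\<Sum>i<n. k i) = 0" using sum N by simp
  have "sign \<sigma> * affine_sign n N a = affine_sign n N (a \<circ> \<sigma>)" by (simp add: affine_sign_permutes[OF perm])
  also have "\<dots> = affine_sign n N (\<lambda>i. l i + N * k i)" by (rule affine_sign_cong) (simp add: k)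
  also have "\<dots> = 1" using affine_sign_translate[OF N k0] affine_sign_alcove[OF l N] by simp
  finally have "sign \<sigma> * affine_sign n N a = 1" .
  then show ?thesis by (metis mult.assoc mult.right_neutral mult_1 sign_idempotent)
qed

lemma alcove_position:
  assumes "l \<in> alcove n N" "i < n"
  shows "card {y \<in> l ` {..<n}. y > l i} = i"
proof -
  have "{y \<in> l ` {..<n}. y > l i} = l ` {..<i}"
  proof
    show "{y \<in> l ` {..<n}. y > l i} \<subseteq> l ` {..<i}"
    proof clarsimp
      fix j assume "j < n" "l i < l j"
      then show "l j \<in> l ` {..<i}"
        using alcove_less[OF assms(1), of i j] by (cases i j rule: linorder_cases) auto
    qed
    show "l ` {..<i} \<subseteq> {y \<in> l ` {..<n}. y > l i}"
      using alcove_less[OF assms(1) _ assms(2)] assms(2) by auto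
  qed
  moreover have "inj_on l {..<i}"
  proof (rule inj_onI)
    fix x y assume "x \<in> {..<i}" "y \<in> {..<i}" "l x = l y"
    then show "x = y"
      using alcove_less[OF assms(1), of x y] alcove_less[OF assms(1), of y x] assms(2)
      by (cases x y rule: linorder_cases) auto
  qed
  ultimately show ?thesis by (simp add: card_image)
qed

text \<open>
  Two alcove points in one orbit differ, up to a rearrangement, by translations of sum zero. If
  these were not all trivial, one coordinate would move up and another one down, each by at least
  a period, and their distance would exceed the width of the alcove. So both points have the same
  entries, in the same order.
\<close>

lemma alcove_match_unique:
  assumes l: "l \<in> alcove n N" "l' \<in> alcove n N" and N: "N > 0"
    and m: "alcove_match n N l a \<sigma>" "alcove_match n N l' a \<tau>"
  shows "l = l'"
proof -
  have perm: "\<sigma> permutes {..<n}" "\<tau> permutes {..<n}" using m by (auto simp: alcove_match_def)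
  define \<pi> where "\<pi> = inv_into UNIV \<sigma> \<circ> \<tau>"
  have perm': "\<pi> permutes {..<n}" unfolding \<pi>_def by (intro permutes_compose permutes_inv perm)
  have \<pi>_less: "\<pi> i < n" if "i < n" for i using permutes_in_image[OF perm', of i] that by simp
  define k where "k i = (l' i - l (\<pi> i)) div N" for i
  have k: "l' i = l (\<pi> i) + N * k i" if i: "i < n" for i
  proof -
    have "\<sigma> (\<pi> i) = \<tau> i" using permutes_inverses(1)[OF perm(1)] by (simp add: \<pi>_def)
    then have "N dvd a (\<tau> i) - l (\<pi> i)" "N dvd a (\<tau> i) - l' i"
      using m \<pi>_less[OF i] i unfolding alcove_match_def by metis+
    then have "N dvd l' i - l (\<pi> i)"
      using dvd_diff[of N "a (\<tau> i) - l (\<pi> i)" "a (\<tau> i) - l' i"] by simp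
    then show ?thesis by (simp add: k_def)
  qed
  have "(\<Sum>i<n. l' i) = (\<Sum>i<n. l (\<pi> i) + N * k i)" by (intro sum.cong) (simp_all add: k)
  also have "\<dots> = (\<Sum>i<n. l (\<pi> i)) + N * (\<Sum>i<n. k i)" by (simp add: sum.distrib sum_distrib_left)
  also have "(\<Sum>i<n. l (\<pi> i)) = (\<Sum>i<n. l i)" using sum.permute[OF perm', of l] by (simp add: o_def)
  finally have sum0: "(\<Sum>i<n. k i) = 0" using m N by (simp add: alcove_match_def)
  \<comment> \<open>One translation upwards and one downwards would spread \<open>l'\<close> over more than a period.\<close>
  have pos: "\<not> (k i > 0 \<and> k j < 0)" if "i < n" "j < n" for i j
  proof
    assume "k i > 0 \<and> k j < 0"
    then have "N * 1 \<le> N * k i" "N * k j \<le> N * (- 1)"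
      using N by (intro mult_left_mono; simp)+
    then have "N \<le> N * k i" "N * k j \<le> - N" by simp_all
    then show False
      using k[OF that(1)] k[OF that(2)] alcove_diff_less[OF l(2) N that]
        alcove_diff_less[OF l(1) N \<pi>_less[OF that(2)] \<pi>_less[OF that(1)]] N by linarith
  qed
  have k0: "k i = 0" if "i < n" for i
  proof (cases "\<exists>j<n. k j > 0")
    case True
    then have "\<forall>j\<in>{..<n}. 0 \<le> k j" using pos by force
    then show ?thesis using sum0 that sum_nonneg_eq_0_iff[of "{..<n}" k] by auto
  next
    case False
    then have "\<forall>j\<in>{..<n}. 0 \<le> - k j" by force
    then show ?thesis using sum0 that sum_nonneg_eq_0_iff[of "{..<n}" "\<lambda>j. - k j"] by (auto simp: sum_negf)
  qed
  then have eq: "l' i = l (\<pi> i)" if "i < n" for i using k that by simp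
  have "l' ` {..<n} = l ` \<pi> ` {..<n}" using eq by (force simp: image_iff)
  then have im: "l' ` {..<n} = l ` {..<n}" using permutes_image[OF perm'] by simp
  show ?thesis
  proof (rule extensionalityI[of _ "{..<n}"])
    fix i assume "i \<in> {..<n}"
    then have i: "i < n" by simp
    have "\<pi> i = i"
      using alcove_position[OF l(2) i] alcove_position[OF l(1) \<pi>_less[OF i]] im eq[OF i] by simp
    then show "l i = l' i" using eq[OF i] by simp
  qed (use l in \<open>auto simp: alcove_def\<close>)
qed

text \<open>
  Among all translates of sum zero choose one with the least sum of squares. If two of its
  coordinates differed by more than a period, moving them towards each other would make the sum of
  squares smaller. So all coordinates lie within a period and only have to be sorted.
\<close>

lemma alcove_match_exists:
  assumes N: "N > 0" and dist: "\<And>i j. i < n \<Longrightarrow> j < n \<Longrightarrow> i \<noteq> j \<Longrightarrow> \<not> N dvd a i - a j"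
  shows "\<exists>l\<in>alcove n N. \<exists>\<sigma>. alcove_match n N l a \<sigma>"
proof -
  define P where "P b \<longleftrightarrow> (\<forall>i<n. N dvd a i - b i) \<and> (\<Sum>i<n. b i) = (\<Sum>i<n. a i)" for b
  define q where "q b = nat (\<Sum>i<n. (b i)\<^sup>2)" for b :: "nat \<Rightarrow> int"
  have "P a" by (simp add: P_def)
  then obtain b where b: "P b" and min: "\<And>c. P c \<Longrightarrow> q b \<le> q c"
    using ex_has_least_nat[of P a q] by blast
  have close: "b i - b j < N" if ij: "i < n" "j < n" for i j
  proof (rule ccontr)
    assume far: "\<not> b i - b j < N"
    then have "i \<noteq> j" using N by auto
    then have no: "\<not> N dvd a i - a j" using dist ij by blast
    have "N dvd a i - b i" "N dvd a j - b j" using b ij by (auto simp: P_def)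
    then have "N dvd (a i - b i) - (a j - b j)" by (rule dvd_diff)
    then have "N dvd (a i - b i) - (a j - b j) + N" by simp
    moreover have "(a i - b i) - (a j - b j) + N = a i - a j" if "b i - b j = N" using that by simp
    ultimately have "b i - b j \<noteq> N" using no by metis
    then have gap: "b i - b j > N" using far by simp
    \<comment> \<open>Move the two coordinates towards each other.\<close>
    define c where "c = b(i := b i - N, j := b j + N)"
    have split: "(\<Sum>m<n. g (c m)) = (\<Sum>m<n. g (b m)) - g (b i) - g (b j) + g (b i - N) + g (b j + N)"
      for g :: "int \<Rightarrow> int"
    proof -
      have S: "{..<n} = insert i (insert j ({..<n} - {i, j}))" using ij by auto
      have "(\<Sum>m\<in>{..<n} - {i, j}. g (c m)) = (\<Sum>m\<in>{..<n} - {i, j}. g (b m))"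
        by (intro sum.cong) (auto simp: c_def)
      then show ?thesis
        using \<open>i \<noteq> j\<close> by (subst (1 2) S) (simp add: c_def)
    qed
    have "P c"
    proof -
      have "N dvd (a i - b i) + N" "N dvd (a j - b j) - N" using b ij by (auto simp: P_def)
      then have "N dvd a i - (b i - N)" "N dvd a j - (b j + N)" by (simp_all add: algebra_simps)
      then have "N dvd a m - c m" if "m < n" for m
        using b that by (auto simp: c_def P_def)
      moreover have "(\<Sum>m<n. c m) = (\<Sum>m<n. b m)" using split[of "\<lambda>x. x"] by simp
      ultimately show ?thesis using b by (simp add: P_def)
    qed
    have "(\<Sum>m<n. (c m)\<^sup>2) = (\<Sum>m<n. (b m)\<^sup>2) + 2 * N * (N - (b i - b j))"
      using split[of "\<lambda>x. x\<^sup>2"] by (simp add: power2_eq_square algebra_simps)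
    moreover have "2 * N * (N - (b i - b j)) < 0" using N gap by (simp add: mult_pos_neg)
    moreover have "(\<Sum>m<n. (c m)\<^sup>2) \<ge> 0" by (intro sum_nonneg) auto
    ultimately have "q c < q b" unfolding q_def by linarith
    then show False using min[OF \<open>P c\<close>] by simp
  qed
  have inj: "inj_on b {..<n}"
  proof (rule inj_onI)
    fix i j assume ij: "i \<in> {..<n}" "j \<in> {..<n}" "b i = b j"
    have "N dvd a i - b i" "N dvd a j - b j" using b ij by (auto simp: P_def)
    then have "N dvd (a i - b i) - (a j - b j)" by (rule dvd_diff)
    then have "N dvd a i - a j" using ij(3) by simp
    then show "i = j" using dist[of i j] ij by auto
  qed
  \<comment> \<open>Sorting: the number of larger coordinates is the new position.\<close>
  define rank where "rank i = (if i < n then card {j \<in> {..<n}. b j > b i} else i)" for i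
  have rank_less: "rank i < rank j" if "i < n" "j < n" "b j < b i" for i j
  proof -
    have "{m \<in> {..<n}. b m > b i} \<subset> {m \<in> {..<n}. b m > b j}" using that by auto
    then show ?thesis using that by (simp add: rank_def psubset_card_mono)
  qed
  have rank_n: "rank i < n" if "i < n" for i
  proof -
    have "{m \<in> {..<n}. b m > b i} \<subset> {..<n}" using that by auto
    then have "card {m \<in> {..<n}. b m > b i} < card {..<n}" by (intro psubset_card_mono) auto
    then show ?thesis using that by (simp add: rank_def)
  qed
  have "inj_on rank {..<n}"
  proof (rule inj_onI)
    fix i j assume ij: "i \<in> {..<n}" "j \<in> {..<n}" "rank i = rank j"
    then have "b i = b j"
      using rank_less[of i j] rank_less[of j i] by (cases "b i" "b j" rule: linorder_cases) auto
    then show "i = j" using inj ij by (auto dest: inj_onD)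
  qed
  then have "rank ` {..<n} = {..<n}"
    using rank_n by (intro endo_inj_surj) auto
  then have perm: "rank permutes {..<n}"
    using \<open>inj_on rank {..<n}\<close> by (intro bij_imp_permutes) (auto simp: bij_betw_def rank_def)
  define \<sigma> where "\<sigma> = inv_into UNIV rank"
  have perm\<sigma>: "\<sigma> permutes {..<n}" unfolding \<sigma>_def by (rule permutes_inv[OF perm])
  have \<sigma>_less: "\<sigma> i < n" if "i < n" for i using permutes_in_image[OF perm\<sigma>, of i] that by simp
  have rank\<sigma>: "rank (\<sigma> i) = i" for i using permutes_inverses(1)[OF perm] by (simp add: \<sigma>_def)
  define l where "l = restrict (b \<circ> \<sigma>) {..<n}"
  have "l \<in> alcove n N"
    unfolding alcove_def
  proof (intro CollectI conjI allI impI)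
    show "l \<in> extensional {..<n}" by (simp add: l_def)
    fix i j assume ij: "i < j" "j < n"
    then have "b (\<sigma> j) < b (\<sigma> i)"
    proof -
      have "\<sigma> i \<noteq> \<sigma> j"
      proof
        assume "\<sigma> i = \<sigma> j"
        then have "rank (\<sigma> i) = rank (\<sigma> j)" by simp
        then show False using ij unfolding rank\<sigma> by simp
      qed
      then have "b (\<sigma> i) \<noteq> b (\<sigma> j)" using inj ij \<sigma>_less by (auto dest: inj_onD)
      moreover have "\<not> b (\<sigma> i) < b (\<sigma> j)" using rank_less[of "\<sigma> j" "\<sigma> i"] ij \<sigma>_less rank\<sigma> by auto
      ultimately show ?thesis by simp
    qed
    then show "l j < l i" using ij by (simp add: l_def)
    show "l i < l j + N" using close[of "\<sigma> i" "\<sigma> j"] \<sigma>_less ij by (simp add: l_def)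
  qed
  moreover have "alcove_match n N l a \<sigma>"
    unfolding alcove_match_def
  proof (intro conjI allI impI)
    show "N dvd a (\<sigma> i) - l i" if "i < n" for i
      using b \<sigma>_less[OF that] that by (simp add: P_def l_def)
    have "(\<Sum>i<n. l i) = (\<Sum>i<n. b (\<sigma> i))" by (simp add: l_def)
    also have "\<dots> = (\<Sum>i<n. b i)" using sum.permute[OF perm\<sigma>, of b] by (simp add: o_def)
    finally show "(\<Sum>i<n. a i) = (\<Sum>i<n. l i)" using b by (simp add: P_def)
  qed (rule perm\<sigma>)
  ultimately show ?thesis by blast
qed

lemma orbit_sign_eq:
  assumes "l \<in> alcove n N" "N > 0"
  shows "orbit_sign n N l a = (if \<exists>\<sigma>. alcove_match n N l a \<sigma> then affine_sign n N a else 0)"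
proof (cases "\<exists>\<sigma>. alcove_match n N l a \<sigma>")
  case True
  then obtain \<sigma> where \<sigma>: "alcove_match n N l a \<sigma>" by blast
  then have "{\<tau>. alcove_match n N l a \<tau>} = {\<sigma>}"
    using alcove_match_unique_perm[OF assms] by blast
  then show ?thesis using \<sigma> alcove_match_sign[OF assms \<sigma>] True by (simp add: orbit_sign_def)
qed (simp add: orbit_sign_def)

text \<open>
  Exactly one alcove point lies in the orbit of \<open>a\<close> if the residues of \<open>a\<close> are distinct. Otherwise
  there is none, and the affine sign is zero.
\<close>

lemma sum_orbit_sign:
  assumes N: "N > 0" and L: "finite L" "L \<subseteq> alcove n N"
    and cover: "\<And>l. l \<in> alcove n N \<Longrightarrow> orbit_sign n N l a \<noteq> 0 \<Longrightarrow> l \<in> L"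
  shows "(\<Sum>l\<in>L. orbit_sign n N l a) = affine_sign n N a"
proof (cases "affine_sign n N a = 0")
  case True
  have "orbit_sign n N l a = 0" if "l \<in> L" for l
    by (simp add: orbit_sign_eq[OF subsetD[OF L(2) that] N] True)
  then show ?thesis using True by simp
next
  case False
  have "\<not> N dvd a i - a j" if "i < n" "j < n" "i \<noteq> j" for i j
    using affine_sign_eq_0[where a = a, OF that] False by blast
  from alcove_match_exists[where a = a, OF N this] obtain l \<sigma> where l: "l \<in> alcove n N" "alcove_match n N l a \<sigma>" by blast
  then have os: "orbit_sign n N l a = affine_sign n N a" unfolding orbit_sign_eq[OF l(1) N] by auto
  then have "l \<in> L" using cover l False by simp
  have "(\<Sum>l\<in>L. orbit_sign n N l a) = (\<Sum>l\<in>{l}. orbit_sign n N l a)"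
  proof (rule sum.mono_neutral_right)
    show "\<forall>l'\<in>L - {l}. orbit_sign n N l' a = 0"
    proof
      fix l' assume l': "l' \<in> L - {l}"
      then have al: "l' \<in> alcove n N" and ne: "l \<noteq> l'" using L(2) by auto
      have "\<not> alcove_match n N l' a \<tau>" for \<tau>
      proof
        assume "alcove_match n N l' a \<tau>"
        then have "l = l'" by (rule alcove_match_unique[OF l(1) al N l(2)])
        then show False using ne by simp
      qed
      then show "orbit_sign n N l' a = 0" by (simp add: orbit_sign_eq[OF al N])
    qed
  qed (use L(1) \<open>l \<in> L\<close> in simp_all)
  then show ?thesis using os by simp
qed

lemma finite_orbit_alcoves:
  assumes N: "N > 0"
  shows "finite {l \<in> alcove n N. orbit_sign n N l a \<noteq> 0}"
proof (cases "\<exists>l\<in>alcove n N. \<exists>\<sigma>. alcove_match n N l a \<sigma>")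
  case True
  then obtain l \<sigma> where l: "l \<in> alcove n N" "alcove_match n N l a \<sigma>" by blast
  have "{l \<in> alcove n N. orbit_sign n N l a \<noteq> 0} \<subseteq> {l}"
  proof
    fix l' assume "l' \<in> {l \<in> alcove n N. orbit_sign n N l a \<noteq> 0}"
    then have al: "l' \<in> alcove n N" and "orbit_sign n N l' a \<noteq> 0" by auto
    then obtain \<tau> where "alcove_match n N l' a \<tau>"
      unfolding orbit_sign_eq[OF al N] by (auto split: if_splits)
    then have "l = l'" by (rule alcove_match_unique[OF l(1) al N l(2)])
    then show "l' \<in> {l}" by simp
  qed
  then show ?thesis by (rule finite_subset) simp
next
  case False
  then have "orbit_sign n N l a = 0" if "l \<in> alcove n N" for l
    using that by (simp add: orbit_sign_eq[OF that N])
  then have "{l \<in> alcove n N. orbit_sign n N l a \<noteq> 0} = {}" by blast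
  then show ?thesis by (simp only: finite.emptyI)
qed

section \<open>Zero-sum determinants as orbit sums\<close>

definition finsupp_sum :: "('i \<Rightarrow> 'a::comm_monoid_add) \<Rightarrow> 'i set \<Rightarrow> 'a" where
  "finsupp_sum f A = sum f {x \<in> A. f x \<noteq> 0}"

lemma finsupp_sum_eq_sum:
  assumes "finite B" "B \<subseteq> A" "\<And>x. x \<in> A \<Longrightarrow> x \<notin> B \<Longrightarrow> f x = 0"
  shows "finite {x \<in> A. f x \<noteq> 0}" "finsupp_sum f A = sum f B"
proof -
  have sub: "{x \<in> A. f x \<noteq> 0} \<subseteq> B" using assms by blast
  then show "finite {x \<in> A. f x \<noteq> 0}" using assms(1) finite_subset by blast
  show "finsupp_sum f A = sum f B"
    unfolding finsupp_sum_def by (rule sum.mono_neutral_left) (use assms sub in auto)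
qed

text \<open>
  The sum over all $k_1 + \cdots + k_n = 0$ of the determinants with rows given by \<open>l\<close>, written as
  a finite sum over the indices of the factors \<open>e\<close>; see \<open>finsupp_sum_det_eq_orbit_sum\<close>.
\<close>

definition orbit_sum :: "nat \<Rightarrow> int \<Rightarrow> int \<Rightarrow> (int \<Rightarrow> 'a::comm_ring_1) \<Rightarrow> (nat \<Rightarrow> int) \<Rightarrow> 'a" where
  "orbit_sum n N M e l = (\<Sum>c\<in>{..<n} \<rightarrow>\<^sub>E {0..M}.
     of_int (orbit_sign n N l (\<lambda>i. c i - int i)) * (\<Prod>i<n. e (c i)))"

lemma orbit_sum_alt:
  "orbit_sum n N M e l = (\<Sum>\<sigma> | \<sigma> permutes {..<n}. of_int (sign \<sigma>) *
     (\<Sum>c\<in>{c \<in> {..<n} \<rightarrow>\<^sub>E {0..M}. alcove_match n N l (\<lambda>i. c i - int i) \<sigma>}. \<Prod>i<n. e (c i)))"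
proof -
  have fin: "finite ({..<n} \<rightarrow>\<^sub>E {0..M})" by (auto intro!: finite_PiE)
  have "orbit_sum n N M e l = (\<Sum>c\<in>{..<n} \<rightarrow>\<^sub>E {0..M}. \<Sum>\<sigma> | \<sigma> permutes {..<n}.
      if alcove_match n N l (\<lambda>i. c i - int i) \<sigma> then of_int (sign \<sigma>) * (\<Prod>i<n. e (c i)) else 0)"
    unfolding orbit_sum_def of_int_orbit_sign sum_distrib_right by (intro sum.cong refl) auto
  also have "\<dots> = (\<Sum>\<sigma> | \<sigma> permutes {..<n}. \<Sum>c\<in>{..<n} \<rightarrow>\<^sub>E {0..M}.
      if alcove_match n N l (\<lambda>i. c i - int i) \<sigma> then of_int (sign \<sigma>) * (\<Prod>i<n. e (c i)) else 0)"
    by (rule sum.swap)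
  finally show ?thesis
    by (simp only: sum.inter_filter[OF fin, symmetric] sum_distrib_left)
qed

text \<open>
  Expand the determinants. For a fixed permutation \<open>\<sigma>\<close> the translations \<open>k\<close> that contribute
  correspond to the index tuples \<open>c\<close> with \<open>c (\<sigma> i) = l i + \<sigma> i + N * k i\<close>.
\<close>

lemma finsupp_sum_det_eq_orbit_sum:
  fixes e :: "int \<Rightarrow> 'a::comm_ring_1" and l :: "nat \<Rightarrow> int" and n :: nat
  assumes N: "N > 0" and supp: "\<And>c. c \<notin> {0..M} \<Longrightarrow> e c = 0"
  defines "D \<equiv> \<lambda>k. det (mat n n (\<lambda>(i, j). e (l i + int j + N * k i)))"
  shows "finite {k \<in> zero_sum_tuples n. D k \<noteq> 0}"
    and "finsupp_sum D (zero_sum_tuples n) = orbit_sum n N M e l"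
proof -
  let ?pos = "\<lambda>\<sigma> k. \<forall>i<n. l i + int (\<sigma> i) + N * k i \<in> {0..M}"
  define K where "K = {k \<in> zero_sum_tuples n. \<exists>\<sigma>. \<sigma> permutes {..<n} \<and> ?pos \<sigma> k}"
  have D: "D k = (\<Sum>\<sigma> | \<sigma> permutes {..<n}. of_int (sign \<sigma>) * (\<Prod>i<n. e (l i + int (\<sigma> i) + N * k i)))" for k
    unfolding D_def by (rule det_leibniz)
  have zero: "(\<Prod>i<n. e (l i + int (\<sigma> i) + N * k i)) = 0" if np: "\<not> ?pos \<sigma> k" for \<sigma> k
  proof -
    obtain i where "i < n" "l i + int (\<sigma> i) + N * k i \<notin> {0..M}" using np by auto
    then show ?thesis using supp by (intro prod_zero) auto
  qed
  have finK: "finite K"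
  proof (rule finite_subset)
    define b where "b i = M + \<bar>l i\<bar> + int n" for i
    show "K \<subseteq> (\<Pi>\<^sub>E i\<in>{..<n}. {- b i..b i})"
    proof
      fix k assume "k \<in> K"
      then obtain \<sigma> where k: "k \<in> zero_sum_tuples n" and \<sigma>: "\<sigma> permutes {..<n}" and pos: "?pos \<sigma> k"
        by (auto simp: K_def)
      have "k i \<in> {- b i..b i}" if i: "i < n" for i
      proof -
        have "\<sigma> i < n" using permutes_in_image[OF \<sigma>, of i] i by simp
        moreover have "0 \<le> l i + int (\<sigma> i) + N * k i" "l i + int (\<sigma> i) + N * k i \<le> M" using pos i by auto
        ultimately have "\<bar>N * k i\<bar> \<le> b i" unfolding b_def by linarith
        moreover have "1 * \<bar>k i\<bar> \<le> \<bar>N\<bar> * \<bar>k i\<bar>" using N by (intro mult_right_mono) auto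
        then have "\<bar>k i\<bar> \<le> \<bar>N * k i\<bar>" by (simp add: abs_mult)
        ultimately show ?thesis by (auto simp: abs_le_iff)
      qed
      then show "k \<in> (\<Pi>\<^sub>E i\<in>{..<n}. {- b i..b i})"
        using k by (auto simp: zero_sum_tuples_def int_tuples_def PiE_def)
    qed
  qed (auto intro!: finite_PiE)
  have notK: "D k = 0" if "k \<in> zero_sum_tuples n" "k \<notin> K" for k
    unfolding D using that zero by (intro sum.neutral ballI) (auto simp: K_def)
  have KZ: "K \<subseteq> zero_sum_tuples n" by (auto simp: K_def)
  show "finite {k \<in> zero_sum_tuples n. D k \<noteq> 0}"
    by (rule finsupp_sum_eq_sum(1)[OF finK KZ notK])
  have "finsupp_sum D (zero_sum_tuples n) = sum D K"
    by (rule finsupp_sum_eq_sum(2)[OF finK KZ notK])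
  also have "\<dots> = (\<Sum>\<sigma> | \<sigma> permutes {..<n}. of_int (sign \<sigma>) *
      (\<Sum>k\<in>K. \<Prod>i<n. e (l i + int (\<sigma> i) + N * k i)))"
    unfolding D by (subst sum.swap) (simp add: sum_distrib_left)
  also have "\<dots> = orbit_sum n N M e l"
    unfolding orbit_sum_alt
  proof (rule sum.cong[OF refl], rule arg_cong2[where f = "(*)", OF refl])
    fix \<sigma> assume "\<sigma> \<in> {\<sigma>. \<sigma> permutes {..<n}}"
    then have \<sigma>: "\<sigma> permutes {..<n}" by simp
    define \<tau> where "\<tau> = inv_into UNIV \<sigma>"
    have \<tau>: "\<tau> permutes {..<n}" unfolding \<tau>_def by (rule permutes_inv[OF \<sigma>])
    have less: "\<sigma> i < n" "\<tau> i < n" if "i < n" for i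
      using permutes_in_image[OF \<sigma>, of i] permutes_in_image[OF \<tau>, of i] that by auto
    have inv: "\<sigma> (\<tau> i) = i" "\<tau> (\<sigma> i) = i" for i
      using permutes_inverses[OF \<sigma>] by (auto simp: \<tau>_def)
    have "(\<Sum>k\<in>K. \<Prod>i<n. e (l i + int (\<sigma> i) + N * k i)) =
        (\<Sum>k\<in>{k \<in> K. ?pos \<sigma> k}. \<Prod>i<n. e (l i + int (\<sigma> i) + N * k i))"
      by (rule sum.mono_neutral_right[OF finK]) (use zero in auto)
    also have "\<dots> = (\<Sum>c\<in>{c \<in> {..<n} \<rightarrow>\<^sub>E {0..M}. alcove_match n N l (\<lambda>i. c i - int i) \<sigma>}. \<Prod>i<n. e (c i))"
    proof (rule sum.reindex_bij_witness[where
          j = "\<lambda>k. restrict (\<lambda>j. l (\<tau> j) + int j + N * k (\<tau> j)) {..<n}" and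
          i = "\<lambda>c. restrict (\<lambda>i. (c (\<sigma> i) - int (\<sigma> i) - l i) div N) {..<n}"])
      fix k assume "k \<in> {k \<in> K. ?pos \<sigma> k}"
      then have k: "k \<in> extensional {..<n}" "(\<Sum>i<n. k i) = 0" and pos: "?pos \<sigma> k"
        by (auto simp: K_def zero_sum_tuples_def int_tuples_def PiE_def)
      define c where "c = restrict (\<lambda>j. l (\<tau> j) + int j + N * k (\<tau> j)) {..<n}"
      have c\<sigma>: "c (\<sigma> i) = l i + int (\<sigma> i) + N * k i" if "i < n" for i
        using that less inv by (simp add: c_def)
      show "restrict (\<lambda>i. (restrict (\<lambda>j. l (\<tau> j) + int j + N * k (\<tau> j)) {..<n} (\<sigma> i) - int (\<sigma> i) - l i) div N) {..<n} = k"
        unfolding c_def[symmetric]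
      proof (rule extensionalityI[OF _ k(1)])
        fix i assume "i \<in> {..<n}"
        then show "restrict (\<lambda>i. (c (\<sigma> i) - int (\<sigma> i) - l i) div N) {..<n} i = k i"
          using N by (simp add: c\<sigma>)
      qed simp
      have "c \<in> {..<n} \<rightarrow>\<^sub>E {0..M}"
        unfolding c_def
      proof (rule restrict_PiE_iff[THEN iffD2], rule ballI)
        fix j assume "j \<in> {..<n}"
        then have "l (\<tau> j) + int (\<sigma> (\<tau> j)) + N * k (\<tau> j) \<in> {0..M}" using pos less by blast
        then show "l (\<tau> j) + int j + N * k (\<tau> j) \<in> {0..M}" unfolding inv .
      qed
      moreover have "alcove_match n N l (\<lambda>i. c i - int i) \<sigma>"
        unfolding alcove_match_def
      proof (intro conjI allI impI \<sigma>)
        fix i assume "i < n"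
        then show "N dvd c (\<sigma> i) - int (\<sigma> i) - l i" by (simp add: c\<sigma>)
      next
        have "(\<Sum>i<n. c i - int i) = (\<Sum>i<n. c (\<sigma> i) - int (\<sigma> i))"
          using sum.permute[OF \<sigma>, of "\<lambda>i. c i - int i"] by (simp add: o_def)
        also have "\<dots> = (\<Sum>i<n. l i + N * k i)" by (intro sum.cong refl) (simp add: c\<sigma>)
        also have "\<dots> = (\<Sum>i<n. l i)" using k(2) by (simp add: sum.distrib flip: sum_distrib_left)
        finally show "(\<Sum>i<n. c i - int i) = (\<Sum>i<n. l i)" .
      qed
      ultimately show "restrict (\<lambda>j. l (\<tau> j) + int j + N * k (\<tau> j)) {..<n} \<in>
          {c \<in> {..<n} \<rightarrow>\<^sub>E {0..M}. alcove_match n N l (\<lambda>i. c i - int i) \<sigma>}"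
        unfolding c_def[symmetric] by blast
      have "(\<Prod>i<n. e (c i)) = (\<Prod>i<n. e (c (\<sigma> i)))"
        using prod.permute[OF \<sigma>, of "\<lambda>i. e (c i)"] by (simp add: o_def)
      also have "\<dots> = (\<Prod>i<n. e (l i + int (\<sigma> i) + N * k i))"
        by (intro prod.cong refl) (simp add: c\<sigma>)
      finally show "(\<Prod>i<n. e (restrict (\<lambda>j. l (\<tau> j) + int j + N * k (\<tau> j)) {..<n} i)) =
          (\<Prod>i<n. e (l i + int (\<sigma> i) + N * k i))"
        unfolding c_def[symmetric] .
    next
      fix c assume "c \<in> {c \<in> {..<n} \<rightarrow>\<^sub>E {0..M}. alcove_match n N l (\<lambda>i. c i - int i) \<sigma>}"
      then have c: "c \<in> {..<n} \<rightarrow>\<^sub>E {0..M}" and dvd: "\<And>i. i < n \<Longrightarrow> N dvd c (\<sigma> i) - int (\<sigma> i) - l i"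
        and sum: "(\<Sum>i<n. c i - int i) = (\<Sum>i<n. l i)"
        by (auto simp: alcove_match_def)
      let ?k = "restrict (\<lambda>i. (c (\<sigma> i) - int (\<sigma> i) - l i) div N) {..<n}"
      have k: "N * ?k i = c (\<sigma> i) - int (\<sigma> i) - l i" if "i < n" for i
        using dvd[OF that] that by simp
      show "restrict (\<lambda>j. l (\<tau> j) + int j + N * ?k (\<tau> j)) {..<n} = c"
      proof (rule extensionalityI)
        fix j assume "j \<in> {..<n}"
        then have j: "j < n" by simp
        show "restrict (\<lambda>j. l (\<tau> j) + int j + N * ?k (\<tau> j)) {..<n} j = c j"
          using j k[OF less(2)[OF j]] inv(1)[of j] by (simp only: restrict_apply' lessThan_iff)
      qed (use c in \<open>auto simp: PiE_def\<close>)
      have "N * (\<Sum>i<n. ?k i) = (\<Sum>i<n. c (\<sigma> i) - int (\<sigma> i) - l i)"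
        unfolding sum_distrib_left by (intro sum.cong refl) (simp only: lessThan_iff k)
      also have "\<dots> = (\<Sum>i<n. c (\<sigma> i) - int (\<sigma> i)) - (\<Sum>i<n. l i)" by (rule sum_subtractf)
      also have "(\<Sum>i<n. c (\<sigma> i) - int (\<sigma> i)) = (\<Sum>i<n. c i - int i)"
        using sum.permute[OF \<sigma>, of "\<lambda>i. c i - int i"] by (simp add: o_def)
      finally have "(\<Sum>i<n. ?k i) = 0" using sum N by simp
      then have Z: "?k \<in> zero_sum_tuples n" by (simp add: zero_sum_tuples_def int_tuples_def)
      have pos: "?pos \<sigma> ?k"
      proof (intro allI impI)
        fix i assume i: "i < n"
        have "c (\<sigma> i) \<in> {0..M}" using c less(1)[OF i] by (auto simp: PiE_def)
        then show "l i + int (\<sigma> i) + N * ?k i \<in> {0..M}" unfolding k[OF i] by simp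
      qed
      show "?k \<in> {k \<in> K. ?pos \<sigma> k}" using Z pos \<sigma> unfolding K_def by blast
    qed
    finally show "(\<Sum>k\<in>K. \<Prod>i<n. e (l i + int (\<sigma> i) + N * k i)) =
        (\<Sum>c\<in>{c \<in> {..<n} \<rightarrow>\<^sub>E {0..M}. alcove_match n N l (\<lambda>i. c i - int i) \<sigma>}. \<Prod>i<n. e (c i))" .
  qed
  finally show "finsupp_sum D (zero_sum_tuples n) = orbit_sum n N M e l" .
qed

section \<open>Vanishing of the orbits that contain no partition\<close>

text \<open>
  The elementary symmetric polynomial of degree \<open>c\<close> in the variables \<open>x v\<close> for \<open>v \<in> V\<close>.
\<close>

definition esym_in :: "(nat \<Rightarrow> 'a::comm_ring_1) \<Rightarrow> nat set \<Rightarrow> int \<Rightarrow> 'a" where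
  "esym_in x V c = (\<Sum>S | S \<subseteq> V \<and> int (card S) = c. \<Prod>v\<in>S. x v)"

lemma esym_in_eq_0:
  assumes "finite V" "c \<notin> {0..int (card V)}"
  shows "esym_in x V c = 0"
proof -
  have "{S. S \<subseteq> V \<and> int (card S) = c} = {}"
    using assms card_mono[OF assms(1)] by force
  then show ?thesis unfolding esym_in_def by (simp only: sum.empty)
qed

text \<open>
  The sum of \<open>f c\<close> times the product of the elementary symmetric polynomials of degrees \<open>c i\<close> over
  all tuples \<open>c\<close>, expanded into monomials; see \<open>sum_box_esym_in\<close>. In this form it has no bound on
  the degrees, which would have to change together with the set of variables.
\<close>

definition family_sum :: "nat \<Rightarrow> (nat \<Rightarrow> 'a::comm_ring_1) \<Rightarrow> nat set \<Rightarrow> ((nat \<Rightarrow> int) \<Rightarrow> 'a) \<Rightarrow> 'a" where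
  "family_sum n x V f =
     (\<Sum>S\<in>{..<n} \<rightarrow>\<^sub>E Pow V. f (\<lambda>i. int (card (S i))) * (\<Prod>i<n. \<Prod>v\<in>S i. x v))"

lemma sum_box_esym_in:
  assumes V: "finite V" "int (card V) \<le> M"
    and f: "\<And>c d. (\<And>i. i < n \<Longrightarrow> c i = d i) \<Longrightarrow> f c = f d"
  shows "(\<Sum>c\<in>{..<n} \<rightarrow>\<^sub>E {0..M}. f c * (\<Prod>i<n. esym_in x V (c i))) = family_sum n x V f"
proof -
  let ?g = "\<lambda>S. restrict (\<lambda>i. int (card (S i))) {..<n}"
  let ?h = "\<lambda>S. f (\<lambda>i. int (card (S i))) * (\<Prod>i<n. \<Prod>v\<in>S i. x v)"
  have fin: "finite ({..<n} \<rightarrow>\<^sub>E Pow V)" "finite ({..<n} \<rightarrow>\<^sub>E {0..M})"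
    using V by (auto intro!: finite_PiE)
  have "(\<Sum>c\<in>{..<n} \<rightarrow>\<^sub>E {0..M}. f c * (\<Prod>i<n. esym_in x V (c i))) =
      (\<Sum>c\<in>{..<n} \<rightarrow>\<^sub>E {0..M}. \<Sum>S\<in>{S \<in> {..<n} \<rightarrow>\<^sub>E Pow V. ?g S = c}. ?h S)"
  proof (rule sum.cong[OF refl])
    fix c assume c: "c \<in> {..<n} \<rightarrow>\<^sub>E {0..M}"
    have eq: "{S \<in> {..<n} \<rightarrow>\<^sub>E Pow V. ?g S = c} = (\<Pi>\<^sub>E i\<in>{..<n}. {S. S \<subseteq> V \<and> int (card S) = c i})"
    proof (intro equalityI subsetI)
      fix S assume "S \<in> {S \<in> {..<n} \<rightarrow>\<^sub>E Pow V. ?g S = c}"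
      then have S: "S \<in> {..<n} \<rightarrow>\<^sub>E Pow V" and "?g S = c" by auto
      then have "int (card (S i)) = c i" if "i < n" for i using that by auto
      then show "S \<in> (\<Pi>\<^sub>E i\<in>{..<n}. {S. S \<subseteq> V \<and> int (card S) = c i})"
        using S by (auto simp: PiE_iff)
    next
      fix S assume "S \<in> (\<Pi>\<^sub>E i\<in>{..<n}. {S. S \<subseteq> V \<and> int (card S) = c i})"
      then have "S \<in> {..<n} \<rightarrow>\<^sub>E Pow V" "\<And>i. i < n \<Longrightarrow> int (card (S i)) = c i" by (auto simp: PiE_iff)
      then show "S \<in> {S \<in> {..<n} \<rightarrow>\<^sub>E Pow V. ?g S = c}"
        using c by (auto simp: fun_eq_iff restrict_def PiE_def extensional_def)
    qed
    have "(\<Prod>i<n. esym_in x V (c i)) = (\<Sum>S\<in>(\<Pi>\<^sub>E i\<in>{..<n}. {S. S \<subseteq> V \<and> int (card S) = c i}). \<Prod>i<n. \<Prod>v\<in>S i. x v)"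
    proof -
      have "finite {S. S \<subseteq> V \<and> int (card S) = c i}" for i
        using V(1) by (rule finite_subset[OF _ finite_Pow_iff[THEN iffD2], rotated]) auto
      then show ?thesis
        unfolding esym_in_def
        using prod_sum_PiE[where A = "{..<n}" and B = "\<lambda>i. {S. S \<subseteq> V \<and> int (card S) = c i}"
            and f = "\<lambda>_ S. \<Prod>v\<in>S. x v"]
        by simp
    qed
    then have "f c * (\<Prod>i<n. esym_in x V (c i)) =
        (\<Sum>S\<in>{S \<in> {..<n} \<rightarrow>\<^sub>E Pow V. ?g S = c}. f c * (\<Prod>i<n. \<Prod>v\<in>S i. x v))"
      unfolding eq by (simp add: sum_distrib_left)
    also have "\<dots> = (\<Sum>S\<in>{S \<in> {..<n} \<rightarrow>\<^sub>E Pow V. ?g S = c}. ?h S)"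
    proof (rule sum.cong[OF refl])
      fix S assume "S \<in> {S \<in> {..<n} \<rightarrow>\<^sub>E Pow V. ?g S = c}"
      then have "f c = f (\<lambda>i. int (card (S i)))" by (intro f) auto
      then show "f c * (\<Prod>i<n. \<Prod>v\<in>S i. x v) = ?h S" by simp
    qed
    finally show "f c * (\<Prod>i<n. esym_in x V (c i)) = (\<Sum>S\<in>{S \<in> {..<n} \<rightarrow>\<^sub>E Pow V. ?g S = c}. ?h S)" .
  qed
  also have "\<dots> = (\<Sum>S\<in>{..<n} \<rightarrow>\<^sub>E Pow V. ?h S)"
  proof (rule sum.group[OF fin])
    show "?g ` ({..<n} \<rightarrow>\<^sub>E Pow V) \<subseteq> {..<n} \<rightarrow>\<^sub>E {0..M}"
    proof clarify
      fix S assume S: "S \<in> {..<n} \<rightarrow>\<^sub>E Pow V"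
      have "int (card (S i)) \<le> M" if "i < n" for i
      proof -
        have "card (S i) \<le> card V" using S that by (intro card_mono V) auto
        then show ?thesis using V(2) by simp
      qed
      then show "?g S \<in> {..<n} \<rightarrow>\<^sub>E {0..M}" by auto
    qed
  qed
  finally show ?thesis by (simp add: family_sum_def)
qed

text \<open>
  A new variable occurs in an arbitrary set \<open>I\<close> of the factors and raises their degrees by one.
\<close>

lemma family_sum_insert:
  assumes V: "finite V" "v \<notin> V"
    and f: "\<And>c d. (\<And>i. i < n \<Longrightarrow> c i = d i) \<Longrightarrow> f c = f d"
  shows "family_sum n x (insert v V) f =
    (\<Sum>I\<in>Pow {..<n}. x v ^ card I * family_sum n x V (\<lambda>c. f (\<lambda>i. c i + of_bool (i \<in> I))))"
proof -
  let ?add = "\<lambda>I S. restrict (\<lambda>i. if i \<in> I then insert v (S i) else S i) {..<n}"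
  have "(\<Sum>I\<in>Pow {..<n}. x v ^ card I * family_sum n x V (\<lambda>c. f (\<lambda>i. c i + of_bool (i \<in> I)))) =
      (\<Sum>(I, S)\<in>Pow {..<n} \<times> ({..<n} \<rightarrow>\<^sub>E Pow V).
        x v ^ card I * (f (\<lambda>i. int (card (S i)) + of_bool (i \<in> I)) * (\<Prod>i<n. \<Prod>v\<in>S i. x v)))"
    unfolding family_sum_def by (simp add: sum_distrib_left sum.cartesian_product)
  also have "\<dots> = family_sum n x (insert v V) f"
    unfolding family_sum_def
  proof (rule sum.reindex_bij_witness[where j = "\<lambda>(I, S). ?add I S" and
        i = "\<lambda>S. ({i \<in> {..<n}. v \<in> S i}, restrict (\<lambda>i. S i - {v}) {..<n})"])
    fix p assume "p \<in> Pow {..<n} \<times> ({..<n} \<rightarrow>\<^sub>E Pow V)"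
    then obtain I S where p: "p = (I, S)" and I: "I \<subseteq> {..<n}" and S: "S \<in> {..<n} \<rightarrow>\<^sub>E Pow V" by auto
    have SV: "S i \<subseteq> V" if "i < n" for i using S that by auto
    then have nv: "v \<notin> S i" "finite (S i)" if "i < n" for i using V that finite_subset by blast+
    have add: "?add I S i = (if i \<in> I then insert v (S i) else S i)" if "i < n" for i using that by simp
    have "{i \<in> {..<n}. v \<in> ?add I S i} = I" using I nv by (auto split: if_splits)
    moreover have "restrict (\<lambda>i. ?add I S i - {v}) {..<n} = S"
      by (rule extensionalityI[of _ "{..<n}"]) (use S nv in \<open>auto simp: PiE_def\<close>)
    ultimately show "({i \<in> {..<n}. v \<in> (case p of (I, S) \<Rightarrow> ?add I S) i},
        restrict (\<lambda>i. (case p of (I, S) \<Rightarrow> ?add I S) i - {v}) {..<n}) = p"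
      by (simp only: p prod.case)
    show "(case p of (I, S) \<Rightarrow> ?add I S) \<in> {..<n} \<rightarrow>\<^sub>E Pow (insert v V)"
      unfolding p prod.case by (rule restrict_PiE_iff[THEN iffD2]) (auto dest: SV[THEN subsetD])
    have "f (\<lambda>i. int (card (?add I S i))) = f (\<lambda>i. int (card (S i)) + of_bool (i \<in> I))"
      by (rule f) (simp add: nv)
    moreover have "(\<Prod>i<n. \<Prod>u\<in>?add I S i. x u) = x v ^ card I * (\<Prod>i<n. \<Prod>u\<in>S i. x u)"
    proof -
      have "(\<Prod>i<n. \<Prod>u\<in>?add I S i. x u) = (\<Prod>i<n. (if i \<in> I then x v else 1) * (\<Prod>u\<in>S i. x u))"
        by (intro prod.cong refl) (auto simp: nv)
      also have "\<dots> = (\<Prod>i<n. if i \<in> I then x v else 1) * (\<Prod>i<n. \<Prod>u\<in>S i. x u)"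
        by (rule prod.distrib)
      also have "(\<Prod>i<n. if i \<in> I then x v else 1) = (\<Prod>i\<in>{i \<in> {..<n}. i \<in> I}. x v)"
        by (rule prod.inter_filter[symmetric]) simp
      also have "{i \<in> {..<n}. i \<in> I} = I" using I by auto
      finally show ?thesis by simp
    qed
    ultimately show "f (\<lambda>i. int (card ((case p of (I, S) \<Rightarrow> ?add I S) i))) * (\<Prod>i<n. \<Prod>u\<in>(case p of (I, S) \<Rightarrow> ?add I S) i. x u) =
        (case p of (I, S) \<Rightarrow> x v ^ card I * (f (\<lambda>i. int (card (S i)) + of_bool (i \<in> I)) * (\<Prod>i<n. \<Prod>v\<in>S i. x v)))"
      by (simp only: p prod.case mult_ac)
  next
    fix S assume S: "S \<in> {..<n} \<rightarrow>\<^sub>E Pow (insert v V)"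
    show "(case ({i \<in> {..<n}. v \<in> S i}, restrict (\<lambda>i. S i - {v}) {..<n}) of (I, S) \<Rightarrow> ?add I S) = S"
      unfolding prod.case
      by (rule extensionalityI[of _ "{..<n}"]) (use S in \<open>auto simp: PiE_def insert_absorb\<close>)
    show "({i \<in> {..<n}. v \<in> S i}, restrict (\<lambda>i. S i - {v}) {..<n}) \<in> Pow {..<n} \<times> ({..<n} \<rightarrow>\<^sub>E Pow V)"
      using S by (auto simp: PiE_iff)
  qed
  finally show ?thesis by (rule sym)
qed

lemma alcove_match_cong:
  assumes "\<And>i. i < n \<Longrightarrow> a i = b i" "\<And>i. i < n \<Longrightarrow> l i = m i"
  shows "alcove_match n N l a \<sigma> \<longleftrightarrow> alcove_match n N m b \<sigma>"
proof (cases "\<sigma> permutes {..<n}")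
  case True
  then have "\<sigma> i < n" if "i < n" for i using permutes_in_image[OF True, of i] that by simp
  moreover have "(\<Sum>i<n. a i) = (\<Sum>i<n. b i)" "(\<Sum>i<n. l i) = (\<Sum>i<n. m i)"
    by (auto intro!: sum.cong assms)
  ultimately show ?thesis using True assms by (simp add: alcove_match_def)
qed (simp add: alcove_match_def)

lemma orbit_sign_cong:
  assumes "\<And>i. i < n \<Longrightarrow> a i = b i" "\<And>i. i < n \<Longrightarrow> l i = m i"
  shows "orbit_sign n N l a = orbit_sign n N m b"
proof -
  have "alcove_match n N l a = alcove_match n N m b"
    by (rule ext) (rule alcove_match_cong[OF assms])
  then show ?thesis by (simp add: orbit_sign_def)
qed

text \<open>
  Exchanging the two positions does not affect the matching condition, but it changes the sign of
  the permutation.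
\<close>

lemma orbit_sign_repeated_residue:
  assumes ij: "i < n" "j < n" "i \<noteq> j" "N dvd l i - l j"
  shows "orbit_sign n N l a = 0"
proof -
  let ?t = "Transposition.transpose i j"
  have t: "?t permutes {..<n}" using ij by (intro permutes_swap_id) auto
  have dvd: "N dvd y - l m \<longleftrightarrow> N dvd y - l (?t m)" for y m
  proof -
    have "N dvd l m - l (?t m)" using ij(4) by (auto simp: Transposition.transpose_def dvd_diff_commute)
    then show ?thesis by (metis (no_types, opaque_lifting) diff_add_cancel diff_diff_eq2 dvd_add_left_iff add_diff_eq)
  qed
  have match: "alcove_match n N l a (\<sigma> \<circ> ?t)" if "alcove_match n N l a \<sigma>" for \<sigma>
  proof -
    have perm: "\<sigma> permutes {..<n}" using that by (simp add: alcove_match_def)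
    have "N dvd a (\<sigma> (?t m)) - l m" if m: "m < n" for m
    proof -
      have "?t m < n" using permutes_in_image[OF t, of m] m by simp
      then have "N dvd a (\<sigma> (?t m)) - l (?t m)" using \<open>alcove_match n N l a \<sigma>\<close> by (simp add: alcove_match_def)
      then show ?thesis using dvd by blast
    qed
    then show ?thesis using that permutes_compose[OF t perm] by (simp add: alcove_match_def)
  qed
  have "orbit_sign n N l a = (\<Sum>\<sigma> | alcove_match n N l a \<sigma>. sign (\<sigma> \<circ> ?t))"
    unfolding orbit_sign_def
    by (rule sum.reindex_bij_witness[of _ "\<lambda>\<sigma>. \<sigma> \<circ> ?t" "\<lambda>\<sigma>. \<sigma> \<circ> ?t"])
       (auto simp: match comp_assoc intro: match[unfolded comp_def])
  also have "\<dots> = (\<Sum>\<sigma> | alcove_match n N l a \<sigma>. - sign \<sigma>)"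
  proof (rule sum.cong[OF refl])
    fix \<sigma> assume "\<sigma> \<in> {\<sigma>. alcove_match n N l a \<sigma>}"
    then have "permutation \<sigma>" using permutation_permutes by (auto simp: alcove_match_def)
    then show "sign (\<sigma> \<circ> ?t) = - sign \<sigma>"
      using sign_compose[OF _ permutation_swap_id, of \<sigma> i j] ij by (simp add: sign_swap_id)
  qed
  also have "\<dots> = - orbit_sign n N l a" by (simp add: orbit_sign_def sum_negf)
  finally show ?thesis by simp
qed

text \<open>
  Raising the coordinates of \<open>a\<close> at the positions in \<open>I\<close> has the same effect as lowering those of
  \<open>l\<close> at the positions that \<open>\<sigma>\<close> maps to \<open>I\<close>. As all sets of a given size occur, the dependence on
  \<open>\<sigma>\<close> disappears in the sum.
\<close>

lemma sum_orbit_sign_shift: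
  fixes y :: "'a::comm_ring_1"
  shows "(\<Sum>I\<in>Pow {..<n}. y ^ card I * of_int (orbit_sign n N l (\<lambda>i. a i + of_bool (i \<in> I)))) =
    (\<Sum>J\<in>Pow {..<n}. y ^ card J * of_int (orbit_sign n N (\<lambda>i. l i - of_bool (i \<in> J)) a))"
proof -
  have "(\<Sum>I\<in>Pow {..<n}. y ^ card I * of_int (orbit_sign n N l (\<lambda>i. a i + of_bool (i \<in> I)))) =
      (\<Sum>\<sigma> | \<sigma> permutes {..<n}. \<Sum>I\<in>Pow {..<n}. y ^ card I *
        (if alcove_match n N l (\<lambda>i. a i + of_bool (i \<in> I)) \<sigma> then of_int (sign \<sigma>) else 0))"
    unfolding of_int_orbit_sign sum_distrib_left by (rule sum.swap)
  also have "\<dots> = (\<Sum>\<sigma> | \<sigma> permutes {..<n}. \<Sum>J\<in>Pow {..<n}. y ^ card J *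
        (if alcove_match n N (\<lambda>i. l i - of_bool (i \<in> J)) a \<sigma> then of_int (sign \<sigma>) else 0))"
  proof (rule sum.cong[OF refl])
    fix \<sigma> assume "\<sigma> \<in> {\<sigma>. \<sigma> permutes {..<n}}"
    then have \<sigma>: "\<sigma> permutes {..<n}" by simp
    have inj: "inj \<sigma>" by (rule permutes_inj[OF \<sigma>])
    have inv: "\<sigma> (inv_into UNIV \<sigma> i) = i" "inv_into UNIV \<sigma> (\<sigma> i) = i" for i
      using permutes_inverses[OF \<sigma>] by auto
    have im: "\<sigma> ` {..<n} = {..<n}" by (rule permutes_image[OF \<sigma>])
    have im': "inv_into UNIV \<sigma> ` {..<n} = {..<n}" by (rule permutes_image[OF permutes_inv[OF \<sigma>]])
    have match: "alcove_match n N l (\<lambda>i. a i + of_bool (i \<in> \<sigma> ` J)) \<sigma> \<longleftrightarrow>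
        alcove_match n N (\<lambda>i. l i - of_bool (i \<in> J)) a \<sigma>" if "J \<subseteq> {..<n}" for J
    proof -
      have "(\<sigma> i \<in> \<sigma> ` J) = (i \<in> J)" for i using inj by (simp add: inj_image_mem_iff)
      moreover have "(\<Sum>i<n. of_bool (i \<in> \<sigma> ` J)) = (\<Sum>i<n. of_bool (i \<in> J) :: int)"
        using sum.permute[OF \<sigma>, of "\<lambda>i. of_bool (i \<in> \<sigma> ` J) :: int"] inj
        by (simp add: o_def inj_image_mem_iff)
      ultimately show ?thesis
        unfolding alcove_match_def by (simp add: sum.distrib sum_subtractf) (simp add: algebra_simps)
    qed
    show "(\<Sum>I\<in>Pow {..<n}. y ^ card I * (if alcove_match n N l (\<lambda>i. a i + of_bool (i \<in> I)) \<sigma> then of_int (sign \<sigma>) else 0)) =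
        (\<Sum>J\<in>Pow {..<n}. y ^ card J * (if alcove_match n N (\<lambda>i. l i - of_bool (i \<in> J)) a \<sigma> then of_int (sign \<sigma>) else 0))"
    proof (rule sum.reindex_bij_witness[of _ "\<lambda>J. \<sigma> ` J" "\<lambda>I. inv_into UNIV \<sigma> ` I"])
      fix I assume I: "I \<in> Pow {..<n}"
      show \<sigma>I: "\<sigma> ` inv_into UNIV \<sigma> ` I = I" by (simp add: image_image inv)
      show J: "inv_into UNIV \<sigma> ` I \<in> Pow {..<n}" using I im' by blast
      have "card (inv_into UNIV \<sigma> ` I) = card I"
        using card_image[of \<sigma> "inv_into UNIV \<sigma> ` I"] inj inj_on_subset[OF inj] \<sigma>I by auto
      then show "y ^ card (inv_into UNIV \<sigma> ` I) * (if alcove_match n N (\<lambda>i. l i - of_bool (i \<in> inv_into UNIV \<sigma> ` I)) a \<sigma> then of_int (sign \<sigma>) else 0) =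
          y ^ card I * (if alcove_match n N l (\<lambda>i. a i + of_bool (i \<in> I)) \<sigma> then of_int (sign \<sigma>) else 0)"
        using match[of "inv_into UNIV \<sigma> ` I"] J unfolding \<sigma>I by simp
    next
      fix J assume "J \<in> Pow {..<n}"
      then show "\<sigma> ` J \<in> Pow {..<n}" using im by blast
      show "inv_into UNIV \<sigma> ` \<sigma> ` J = J" by (simp add: image_image inv)
    qed
  qed
  also have "\<dots> = (\<Sum>J\<in>Pow {..<n}. y ^ card J * of_int (orbit_sign n N (\<lambda>i. l i - of_bool (i \<in> J)) a))"
    unfolding of_int_orbit_sign sum_distrib_left by (rule sum.swap)
  finally show ?thesis .
qed

text \<open>
  Induction on the variables. By \<open>family_sum_insert\<close> and \<open>sum_orbit_sign_shift\<close>, one variable moves \<open>l\<close> to a point whose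
  coordinates are lowered by at most one. Such a point is still in the closed alcove, and its last
  coordinate is still too small. On the boundary two residues agree and the sum vanishes. Without
  variables, only the orbit of the empty partition contributes, and the last coordinate of its
  alcove point is not too small.
\<close>

lemma family_sum_orbit_sign_eq_0:
  assumes V: "finite V" and n: "n > 0" "int n \<le> N"
    and l: "l \<in> alcove n N" "l (n - 1) < - (int n - 1)"
  shows "family_sum n x V (\<lambda>c. of_int (orbit_sign n N l (\<lambda>i. c i - int i))) = (0::'a::comm_ring_1)"
  using V l
proof (induction V arbitrary: l rule: finite_induct)
  case empty
  \<comment> \<open>The alcove point of the empty partition.\<close>
  define \<delta> where "\<delta> = restrict (\<lambda>i. - int i) {..<n}"
  have \<delta>: "\<delta> \<in> alcove n N" using n by (auto simp: alcove_def \<delta>_def)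
  have match: "alcove_match n N \<delta> (\<lambda>i. 0 - int i) id"
    by (auto simp: alcove_match_def \<delta>_def permutes_id)
  have "\<not> alcove_match n N l (\<lambda>i. 0 - int i) \<tau>" for \<tau>
  proof
    assume "alcove_match n N l (\<lambda>i. 0 - int i) \<tau>"
    then have "\<delta> = l" using alcove_match_unique[OF \<delta> empty(1) _ match] n by simp
    then have "l (n - 1) = - int (n - 1)" using n by (auto simp: \<delta>_def)
    then show False using empty(2) n by (simp add: of_nat_diff)
  qed
  then have "orbit_sign n N l (\<lambda>i. 0 - int i) = 0"
    using orbit_sign_eq[OF empty(1), of "\<lambda>i. 0 - int i"] n by simp
  moreover have "{..<n} \<rightarrow>\<^sub>E Pow {} = {restrict (\<lambda>_. {}) {..<n} :: nat \<Rightarrow> nat set}"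
    by (auto simp: PiE_def Pi_def extensional_def fun_eq_iff)
  moreover have "orbit_sign n N l (\<lambda>i. int (card (restrict (\<lambda>_. {}) {..<n} i :: nat set)) - int i) =
      orbit_sign n N l (\<lambda>i. 0 - int i)"
    by (rule orbit_sign_cong) auto
  ultimately show ?case by (simp add: family_sum_def)
next
  case (insert v V)
  let ?l = "\<lambda>J. restrict (\<lambda>i. l i - of_bool (i \<in> J)) {..<n}"
  have "family_sum n x (insert v V) (\<lambda>c. of_int (orbit_sign n N l (\<lambda>i. c i - int i))) =
      (\<Sum>I\<in>Pow {..<n}. x v ^ card I *
        family_sum n x V (\<lambda>c. of_int (orbit_sign n N l (\<lambda>i. c i + of_bool (i \<in> I) - int i))))"
    by (rule family_sum_insert[OF insert.hyps]) (intro arg_cong[of _ _ of_int] orbit_sign_cong, simp_all)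
  also have "\<dots> = (\<Sum>S\<in>{..<n} \<rightarrow>\<^sub>E Pow V. (\<Sum>I\<in>Pow {..<n}. x v ^ card I *
      of_int (orbit_sign n N l (\<lambda>i. (int (card (S i)) - int i) + of_bool (i \<in> I)))) * (\<Prod>i<n. \<Prod>v\<in>S i. x v))"
    unfolding family_sum_def sum_distrib_left sum_distrib_right
    by (subst sum.swap) (simp add: mult.assoc algebra_simps)
  also have "\<dots> = (\<Sum>S\<in>{..<n} \<rightarrow>\<^sub>E Pow V. (\<Sum>J\<in>Pow {..<n}. x v ^ card J *
      of_int (orbit_sign n N (?l J) (\<lambda>i. int (card (S i)) - int i))) * (\<Prod>i<n. \<Prod>v\<in>S i. x v))"
    unfolding sum_orbit_sign_shift
    by (intro sum.cong refl arg_cong2[where f = "(*)"] arg_cong[of _ _ of_int] orbit_sign_cong) auto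
  also have "\<dots> = (\<Sum>J\<in>Pow {..<n}. x v ^ card J *
      family_sum n x V (\<lambda>c. of_int (orbit_sign n N (?l J) (\<lambda>i. c i - int i))))"
    unfolding family_sum_def sum_distrib_left sum_distrib_right
    by (subst sum.swap) (simp add: mult.assoc)
  also have "\<dots> = 0"
  proof (rule sum.neutral, rule ballI)
    fix J assume "J \<in> Pow {..<n}"
    have "family_sum n x V (\<lambda>c. of_int (orbit_sign n N (?l J) (\<lambda>i. c i - int i))) = 0"
    proof (cases "\<exists>i j. i < n \<and> j < n \<and> i \<noteq> j \<and> N dvd ?l J i - ?l J j")
      case True
      then obtain i j where "i < n" "j < n" "i \<noteq> j" "N dvd ?l J i - ?l J j" by blast
      then have "orbit_sign n N (?l J) a = 0" for a by (rule orbit_sign_repeated_residue)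
      then show ?thesis by (simp add: family_sum_def)
    next
      case False
      show ?thesis
      proof (rule insert.IH)
        show "?l J \<in> alcove n N"
          unfolding alcove_def
        proof (intro CollectI conjI allI impI)
          fix i j assume ij: "i < j" "j < n"
          have lt: "l j < l i" "l i < l j + N" using insert.prems(1) ij by (auto simp: alcove_def)
          have nd: "\<not> N dvd ?l J i - ?l J j" using False ij less_trans[OF ij] less_irrefl by blast
          have ne: "?l J i - ?l J j \<noteq> 0" "?l J i - ?l J j \<noteq> N" using nd by (metis dvd_0_right, metis dvd_refl)
          have e: "?l J i = l i - of_bool (i \<in> J)" "?l J j = l j - of_bool (j \<in> J)" using ij by auto
          have b: "of_bool (i \<in> J) \<le> (1::int)" "of_bool (j \<in> J) \<le> (1::int)"
            "of_bool (i \<in> J) \<ge> (0::int)" "of_bool (j \<in> J) \<ge> (0::int)" by auto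
          show "?l J j < ?l J i" "?l J i < ?l J j + N"
            using ne lt b unfolding e by linarith+
        qed simp
        show "?l J (n - 1) < - (int n - 1)"
          using insert.prems(2) n by (auto simp: of_bool_def)
      qed
    qed
    then show "x v ^ card J * family_sum n x V (\<lambda>c. of_int (orbit_sign n N (?l J) (\<lambda>i. c i - int i))) = 0"
      by simp
  qed
  finally show ?case .
qed

lemma orbit_sum_esym_in_eq_0:
  assumes "finite V" "int (card V) \<le> M" "n > 0" "int n \<le> N"
    and "l \<in> alcove n N" "l (n - 1) < - (int n - 1)"
  shows "orbit_sum n N M (esym_in x V) l = 0"
proof -
  have "orbit_sum n N M (esym_in x V) l = family_sum n x V (\<lambda>c. of_int (orbit_sign n N l (\<lambda>i. c i - int i)))"
    unfolding orbit_sum_def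
    by (rule sum_box_esym_in[OF assms(1,2)]) (intro arg_cong[of _ _ of_int] orbit_sign_cong, simp_all)
  then show ?thesis using family_sum_orbit_sign_eq_0[OF assms(1,3-6)] by simp
qed

section \<open>Summation over the alcove and over the rows\<close>

text \<open>
  The alcove points excluded from \<open>G\<close> contribute zero and may be added, so each index tuple \<open>c\<close> is
  weighted by the sum of its orbit signs over the whole alcove, which is its affine sign.
\<close>

lemma finsupp_sum_orbit_sum:
  fixes x :: "nat \<Rightarrow> 'a::comm_ring_1" and n :: nat and N M :: int
  assumes V: "finite V" "int (card V) \<le> M" and n: "n > 0" "int n \<le> N"
  defines "G \<equiv> {l \<in> alcove n N. - (int n - 1) \<le> l (n - 1)}"
  shows "finite {l \<in> G. orbit_sum n N M (esym_in x V) l \<noteq> 0}"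
    and "finsupp_sum (orbit_sum n N M (esym_in x V)) G =
      minor_sum N {..<n} (\<lambda>j s. periodization N (parity_sign n) M (esym_in x V) (s + int j))"
proof -
  let ?box = "{..<n} \<rightarrow>\<^sub>E {0..M}" and ?e = "esym_in x V"
  have N: "N > 0" using n by simp
  define L where "L = (\<Union>c\<in>?box. {l \<in> alcove n N. orbit_sign n N l (\<lambda>i. c i - int i) \<noteq> 0})"
  have fin: "finite ?box" by (auto intro!: finite_PiE)
  have finL: "finite L" unfolding L_def using fin finite_orbit_alcoves[OF N] by blast
  have L: "L \<subseteq> alcove n N" by (auto simp: L_def)
  have notL: "orbit_sum n N M ?e l = 0" if "l \<in> G" "l \<notin> L \<inter> G" for l
    using that unfolding orbit_sum_def L_def G_def by (intro sum.neutral) auto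
  have finLG: "finite (L \<inter> G)" and sub: "L \<inter> G \<subseteq> G" using finL by auto
  show "finite {l \<in> G. orbit_sum n N M ?e l \<noteq> 0}"
    by (rule finsupp_sum_eq_sum(1)[OF finLG sub notL])
  have "finsupp_sum (orbit_sum n N M ?e) G = (\<Sum>l\<in>L \<inter> G. orbit_sum n N M ?e l)"
    by (rule finsupp_sum_eq_sum(2)[OF finLG sub notL])
  also have "\<dots> = (\<Sum>l\<in>L. orbit_sum n N M ?e l)"
  proof (rule sum.mono_neutral_left[OF finL])
    show "\<forall>l\<in>L - L \<inter> G. orbit_sum n N M ?e l = 0"
    proof
      fix l assume l: "l \<in> L - L \<inter> G"
      then have "l \<in> alcove n N" "l (n - 1) < - (int n - 1)" using L by (auto simp: G_def)
      then show "orbit_sum n N M ?e l = 0" by (rule orbit_sum_esym_in_eq_0[OF V n])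
    qed
  qed simp
  also have "\<dots> = (\<Sum>c\<in>?box. of_int (\<Sum>l\<in>L. orbit_sign n N l (\<lambda>i. c i - int i)) * (\<Prod>i<n. ?e (c i)))"
    unfolding orbit_sum_def by (subst sum.swap) (simp add: sum_distrib_right)
  also have "\<dots> = (\<Sum>c\<in>?box. of_int (affine_sign n N (\<lambda>i. c i - int i)) * (\<Prod>i<n. ?e (c i)))"
  proof (rule sum.cong[OF refl])
    fix c assume "c \<in> ?box"
    then have "(\<Sum>l\<in>L. orbit_sign n N l (\<lambda>i. c i - int i)) = affine_sign n N (\<lambda>i. c i - int i)"
      by (intro sum_orbit_sign[OF N finL L]) (auto simp: L_def)
    then show "of_int (\<Sum>l\<in>L. orbit_sign n N l (\<lambda>i. c i - int i)) * (\<Prod>i<n. ?e (c i)) =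
        of_int (affine_sign n N (\<lambda>i. c i - int i)) * (\<Prod>i<n. ?e (c i))" by simp
  qed
  also have "\<dots> = minor_sum N {..<n} (\<lambda>j s. periodization N (parity_sign n) M ?e (s + int j))"
    by (rule minor_sum_periodization[OF N, symmetric])
  finally show "finsupp_sum (orbit_sum n N M ?e) G =
      minor_sum N {..<n} (\<lambda>j s. periodization N (parity_sign n) M ?e (s + int j))" .
qed

lemma periodization_eq_sum:
  assumes N: "N > 0" and K: "finite K" "\<And>k. s + N * k \<in> {0..M} \<Longrightarrow> k \<in> K"
    and supp: "\<And>c. c \<notin> {0..M} \<Longrightarrow> e c = 0"
  shows "periodization N \<eta> M e s = (\<Sum>k\<in>K. ipow \<eta> k * e (s + N * k))"
proof -
  have "periodization N \<eta> M e s =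
      (\<Sum>c\<in>{c \<in> {0..M}. N dvd c - s}. ipow \<eta> ((c - s) div N) * e c)"
    unfolding periodization_def by (rule sum.inter_filter[symmetric]) simp
  also have "\<dots> = (\<Sum>k\<in>{k \<in> K. s + N * k \<in> {0..M}}. ipow \<eta> k * e (s + N * k))"
    by (rule sum.reindex_bij_witness[of _ "\<lambda>k. s + N * k" "\<lambda>c. (c - s) div N"]) (use N K(2) in auto)
  also have "\<dots> = (\<Sum>k\<in>K. ipow \<eta> k * e (s + N * k))"
    by (rule sum.mono_neutral_left) (use K(1) supp in auto)
  finally show ?thesis .
qed

lemma (in cyclic_sequence) quasi_periodic_ipow: "E (s + N * q) = ipow \<eta> q * E s"
proof (induction q rule: int_induct[of _ 0])
  case base
  then show ?case by (simp add: ipow_def)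
next
  case (step1 i)
  have "E (s + N * (i + 1)) = \<eta> * E (s + N * i)"
    using quasi_periodic[of "s + N * i"] by (simp add: algebra_simps)
  also have "\<dots> = ipow \<eta> (i + 1) * E s"
    unfolding step1.IH ipow_add[OF eta_sq] by (simp add: ipow_def)
  finally show ?case .
next
  case (step2 i)
  have "ipow \<eta> i * E s = \<eta> * E (s + N * (i - 1))"
    using quasi_periodic[of "s + N * (i - 1)"] step2.IH by (simp add: algebra_simps)
  then have "\<eta> * (ipow \<eta> i * E s) = E (s + N * (i - 1))"
    using eta_sq by (simp flip: mult.assoc)
  moreover have "ipow \<eta> (i - 1) = \<eta> * ipow \<eta> i"
    using ipow_add[OF eta_sq, of i "- 1"] by (simp add: ipow_def)
  ultimately show ?case by (simp add: mult.assoc)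
qed

lemma sum_residue_class:
  fixes N :: int
  assumes "N > 0"
  shows "(\<Sum>s\<in>{0..<N}. if N dvd c - s then g s else 0) = g (c mod N)"
proof -
  have "(\<Sum>s\<in>{0..<N}. if N dvd c - s then g s else 0) = (\<Sum>s\<in>{c mod N}. if N dvd c - s then g s else 0)"
  proof (rule sum.mono_neutral_right)
    show "\<forall>s\<in>{0..<N} - {c mod N}. (if N dvd c - s then g s else 0) = 0"
      using periodization_residue(1)[OF assms] by simp
  qed (use assms in auto)
  also have "\<dots> = g (c mod N)" by (simp add: minus_mod_eq_mult_div)
  finally show ?thesis .
qed

text \<open>
  Unfold only the first of the two periodizations. Every index \<open>c\<close> then belongs to one residue \<open>s\<close>,
  and quasi-periodicity replaces \<open>s\<close> by \<open>c\<close> in the second one.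
\<close>

lemma corr_periodization:
  assumes N: "N > 0" and \<eta>: "\<eta> * \<eta> = 1"
    and K: "finite K" "\<And>c k. c \<in> {0..M} \<Longrightarrow> c + r + N * k \<in> {0..M} \<Longrightarrow> k \<in> K"
    and supp: "\<And>c. c \<notin> {0..M} \<Longrightarrow> e c = 0"
  shows "cyclic_sequence.corr N (periodization N \<eta> M e) r =
    (\<Sum>k\<in>K. ipow \<eta> k * (\<Sum>c\<in>{0..M}. e c * e (c + (r + N * k))))"
proof -
  let ?E = "periodization N \<eta> M e"
  interpret cyclic_sequence N \<eta> ?E by (rule cyclic_sequence_periodization[OF N \<eta>])
  have prod_E: "?E s * y = (\<Sum>c\<in>{0..M}. if N dvd c - s then e c * (ipow \<eta> ((c - s) div N) * y) else 0)" for s y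
    unfolding periodization_def sum_distrib_right by (intro sum.cong refl) (auto simp: mult_ac)
  have "corr r = (\<Sum>s\<in>{0..<N}. \<Sum>c\<in>{0..M}.
      if N dvd c - s then e c * (ipow \<eta> ((c - s) div N) * ?E (s + r)) else 0)"
    unfolding corr_def prod_E ..
  also have "\<dots> = (\<Sum>c\<in>{0..M}. e c * (ipow \<eta> ((c - c mod N) div N) * ?E (c mod N + r)))"
    by (subst sum.swap) (simp only: sum_residue_class[OF N])
  also have "\<dots> = (\<Sum>c\<in>{0..M}. e c * ?E (c + r))"
  proof (rule sum.cong[OF refl])
    fix c
    have "(c - c mod N) div N = c div N" using N by (simp add: minus_mod_eq_mult_div)
    moreover have "c mod N + r + N * (c div N) = c + r" by simp
    ultimately show "e c * (ipow \<eta> ((c - c mod N) div N) * ?E (c mod N + r)) = e c * ?E (c + r)"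
      using quasi_periodic_ipow[of "c mod N + r" "c div N"] by simp
  qed
  also have "\<dots> = (\<Sum>c\<in>{0..M}. e c * (\<Sum>k\<in>K. ipow \<eta> k * e (c + r + N * k)))"
    by (intro sum.cong refl arg_cong2[where f = "(*)"] periodization_eq_sum[OF N K(1) _ supp] K(2)) auto
  also have "\<dots> = (\<Sum>k\<in>K. ipow \<eta> k * (\<Sum>c\<in>{0..M}. e c * e (c + (r + N * k))))"
    unfolding sum_distrib_left by (subst sum.swap) (simp add: mult_ac add_ac)
  finally show ?thesis .
qed

lemma sum_periodization:
  fixes e :: "int \<Rightarrow> 'a::comm_ring_1"
  assumes N: "N > 0"
  shows "(\<Sum>s\<in>{0..<N}. periodization N 1 M e s) = (\<Sum>c\<in>{0..M}. e c)"
proof -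
  have "(\<Sum>s\<in>{0..<N}. periodization N 1 M e s) = (\<Sum>s\<in>{0..<N}. \<Sum>c\<in>{0..M}. if N dvd c - s then e c else 0)"
  proof -
    have "ipow 1 k = (1 :: 'a)" for k by (simp add: ipow_def)
    then show ?thesis unfolding periodization_def by (simp only: mult_1)
  qed
  also have "\<dots> = (\<Sum>c\<in>{0..M}. e c)"
    by (subst sum.swap) (simp only: sum_residue_class[OF N])
  finally show ?thesis .
qed

lemma det_row_sums:
  fixes A :: "nat \<Rightarrow> nat \<Rightarrow> 'k \<Rightarrow> 'a::comm_ring_1"
  assumes K: "finite K"
  shows "det (mat h h (\<lambda>(i, j). \<Sum>k\<in>K. u k * A i j k)) =
    (\<Sum>k\<in>{..<h} \<rightarrow>\<^sub>E K. (\<Prod>i<h. u (k i)) * det (mat h h (\<lambda>(i, j). A i j (k i))))"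
proof -
  have "det (mat h h (\<lambda>(i, j). \<Sum>k\<in>K. u k * A i j k)) =
      (\<Sum>p | p permutes {..<h}. of_int (sign p) * (\<Sum>k\<in>{..<h} \<rightarrow>\<^sub>E K. \<Prod>i<h. u (k i) * A i (p i) (k i)))"
    unfolding det_leibniz by (intro sum.cong refl arg_cong2[where f = "(*)"] prod_sum_PiE K) simp
  also have "\<dots> = (\<Sum>k\<in>{..<h} \<rightarrow>\<^sub>E K. (\<Prod>i<h. u (k i)) *
      (\<Sum>p | p permutes {..<h}. of_int (sign p) * (\<Prod>i<h. A i (p i) (k i))))"
    unfolding sum_distrib_left by (subst sum.swap) (simp add: prod.distrib mult_ac)
  finally show ?thesis unfolding det_leibniz .
qed

text \<open>
  If some \<open>k i\<close> lies outside \<open>K\<close>, then a whole row is zero. So the sum is finite and row linearity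
  applies.
\<close>

lemma finsupp_sum_det_rows:
  fixes A :: "nat \<Rightarrow> nat \<Rightarrow> int \<Rightarrow> 'a::comm_ring_1" and u :: "int \<Rightarrow> 'a" and h :: nat
  assumes K: "finite K" and A: "\<And>i j k. i < h \<Longrightarrow> j < h \<Longrightarrow> k \<notin> K \<Longrightarrow> A i j k = 0"
  defines "D \<equiv> \<lambda>k. (\<Prod>i<h. u (k i)) * det (mat h h (\<lambda>(i, j). A i j (k i)))"
  shows "finite {k \<in> int_tuples h. D k \<noteq> 0}"
    and "finsupp_sum D (int_tuples h) = det (mat h h (\<lambda>(i, j). \<Sum>k\<in>K. u k * A i j k))"
proof -
  have fin: "finite ({..<h} \<rightarrow>\<^sub>E K)" using K by (intro finite_PiE) auto
  have sub: "({..<h} \<rightarrow>\<^sub>E K) \<subseteq> int_tuples h" by (auto simp: int_tuples_def PiE_def)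
  have zero: "D k = 0" if k: "k \<in> int_tuples h" "k \<notin> {..<h} \<rightarrow>\<^sub>E K" for k
  proof -
    obtain i where i: "i < h" "k i \<notin> K" using k unfolding int_tuples_def PiE_def Pi_def by auto
    have "det (mat h h (\<lambda>(i, j). A i j (k i))) = 0"
      unfolding det_leibniz
    proof (rule sum.neutral, rule ballI)
      fix p assume "p \<in> {p. p permutes {..<h}}"
      then have "p i < h" using permutes_in_image[of p "{..<h}" i] i by simp
      then have "(\<Prod>i<h. A i (p i) (k i)) = 0" using i A by (intro prod_zero) auto
      then show "of_int (sign p) * (\<Prod>i<h. A i (p i) (k i)) = 0" by simp
    qed
    then show ?thesis by (simp add: D_def)
  qed
  show "finite {k \<in> int_tuples h. D k \<noteq> 0}" by (rule finsupp_sum_eq_sum(1)[OF fin sub zero])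
  show "finsupp_sum D (int_tuples h) = det (mat h h (\<lambda>(i, j). \<Sum>k\<in>K. u k * A i j k))"
    using finsupp_sum_eq_sum(2)[OF fin sub zero] unfolding det_row_sums[OF K] D_def .
qed

section \<open>Restriction to finitely many variables\<close>

text \<open>
  Setting the variables outside \<open>V\<close> to zero.
\<close>

definition restrict_vars :: "nat set \<Rightarrow> 'a::comm_ring_1 mfps \<Rightarrow> 'a mfps" where
  "restrict_vars V f = Abs_mfps (\<lambda>m. if Poly_Mapping.keys m \<subseteq> V then mcoeff f m else 0)"

lemma mcoeff_restrict_vars: "mcoeff (restrict_vars V f) m = (if Poly_Mapping.keys m \<subseteq> V then mcoeff f m else 0)"
  by (simp add: restrict_vars_def)

lemma mcoeff_0: "mcoeff (0::'a::comm_ring_1 mfps) m = 0"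
  by (simp add: zero_mfps_def)

lemma mcoeff_add: "mcoeff (f + g) m = mcoeff f m + mcoeff g m"
  by (simp add: plus_mfps_def)

lemma mcoeff_sum: "mcoeff (sum f A) m = (\<Sum>i\<in>A. mcoeff (f i) m)"
  by (induction A rule: infinite_finite_induct) (simp_all add: mcoeff_0 mcoeff_add)

lemma keys_add_nat:
  fixes a b :: "nat \<Rightarrow>\<^sub>0 nat"
  shows "Poly_Mapping.keys (a + b) = Poly_Mapping.keys a \<union> Poly_Mapping.keys b"
  by (auto simp: in_keys_iff lookup_add)

lemma comm_ring_hom_restrict_vars: "comm_ring_hom (restrict_vars V :: 'a::comm_ring_1 mfps \<Rightarrow> 'a mfps)"
proof
  fix f g :: "'a mfps"
  show "restrict_vars V (f + g) = restrict_vars V f + restrict_vars V g"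
    by (rule mfps_eqI) (simp add: mcoeff_restrict_vars mcoeff_add)
  show "restrict_vars V 1 = (1 :: 'a mfps)"
    by (rule mfps_eqI) (simp add: mcoeff_restrict_vars one_mfps_def)
  show "restrict_vars V 0 = (0 :: 'a mfps)"
    by (rule mfps_eqI) (simp add: mcoeff_restrict_vars mcoeff_0)
  show "restrict_vars V (f * g) = restrict_vars V f * restrict_vars V g"
  proof (rule mfps_eqI)
    fix m
    have "Poly_Mapping.keys m = Poly_Mapping.keys (fst p) \<union> Poly_Mapping.keys (snd p)" if "p \<in> splits m" for p
      using that by (auto simp: splits_def keys_add_nat)
    note keys = this
    have lhs: "mcoeff (restrict_vars V (f * g)) m =
        (if Poly_Mapping.keys m \<subseteq> V then \<Sum>p\<in>splits m. mcoeff f (fst p) * mcoeff g (snd p) else 0)"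
      by (simp add: mcoeff_restrict_vars times_mfps_def case_prod_unfold)
    have rhs: "mcoeff (restrict_vars V f * restrict_vars V g) m =
        (\<Sum>p\<in>splits m. mcoeff (restrict_vars V f) (fst p) * mcoeff (restrict_vars V g) (snd p))"
      by (simp add: times_mfps_def case_prod_unfold)
    show "mcoeff (restrict_vars V (f * g)) m = mcoeff (restrict_vars V f * restrict_vars V g) m"
    proof (cases "Poly_Mapping.keys m \<subseteq> V")
      case True
      then have "mcoeff (restrict_vars V f) (fst p) * mcoeff (restrict_vars V g) (snd p) = mcoeff f (fst p) * mcoeff g (snd p)"
        if "p \<in> splits m" for p
        using keys[OF that] by (simp add: mcoeff_restrict_vars)
      then show ?thesis unfolding lhs rhs using True by simp
    next
      case False
      then have "mcoeff (restrict_vars V f) (fst p) * mcoeff (restrict_vars V g) (snd p) = 0" if "p \<in> splits m" for p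
        using keys[OF that] by (auto simp: mcoeff_restrict_vars)
      then show ?thesis unfolding lhs rhs using False by simp
    qed
  qed
qed

lemma mfps_eq_restrict_vars:
  assumes "\<And>V. finite V \<Longrightarrow> restrict_vars V f = restrict_vars V g"
  shows "f = g"
proof (rule mfps_eqI)
  fix m
  have "mcoeff (restrict_vars (Poly_Mapping.keys m) f) m = mcoeff (restrict_vars (Poly_Mapping.keys m) g) m"
    using assms[of "Poly_Mapping.keys m"] by simp
  then show "mcoeff f m = mcoeff g m" by (simp add: mcoeff_restrict_vars)
qed

lemma msummable_restrict_vars:
  assumes "\<And>V. finite V \<Longrightarrow> finite {i \<in> A. restrict_vars V (F i) \<noteq> 0}"
  shows "msummable F A"
  unfolding msummable_def
proof
  fix m
  have "{i \<in> A. mcoeff (F i) m \<noteq> 0} \<subseteq> {i \<in> A. restrict_vars (Poly_Mapping.keys m) (F i) \<noteq> 0}"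
  proof clarify
    fix i assume "mcoeff (F i) m \<noteq> 0" "restrict_vars (Poly_Mapping.keys m) (F i) = 0"
    then show False using mcoeff_restrict_vars[of "Poly_Mapping.keys m" "F i" m] by (simp add: mcoeff_0)
  qed
  then show "finite {i \<in> A. mcoeff (F i) m \<noteq> 0}" by (rule finite_subset) (rule assms, simp)
qed

lemma restrict_vars_msum:
  assumes fin: "finite {i \<in> A. restrict_vars V (F i) \<noteq> 0}"
  shows "restrict_vars V (msum F A) = finsupp_sum (\<lambda>i. restrict_vars V (F i)) A"
proof (rule mfps_eqI)
  fix m
  let ?B = "{i \<in> A. restrict_vars V (F i) \<noteq> 0}"
  show "mcoeff (restrict_vars V (msum F A)) m = mcoeff (finsupp_sum (\<lambda>i. restrict_vars V (F i)) A) m"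
  proof (cases "Poly_Mapping.keys m \<subseteq> V")
    case True
    have coeff: "mcoeff (restrict_vars V (F i)) m = mcoeff (F i) m" for i using True by (simp add: mcoeff_restrict_vars)
    have sub: "{i \<in> A. mcoeff (F i) m \<noteq> 0} \<subseteq> ?B" unfolding coeff[symmetric] by (auto simp: mcoeff_0)
    have "mcoeff (restrict_vars V (msum F A)) m = (\<Sum>i\<in>{i \<in> A. mcoeff (F i) m \<noteq> 0}. mcoeff (F i) m)"
      using True by (simp add: mcoeff_restrict_vars msum_def)
    also have "\<dots> = (\<Sum>i\<in>?B. mcoeff (F i) m)"
      by (rule sum.mono_neutral_left[OF fin sub]) auto
    finally show ?thesis by (simp add: finsupp_sum_def mcoeff_sum coeff)
  next
    case False
    then show ?thesis by (simp add: finsupp_sum_def mcoeff_sum mcoeff_restrict_vars)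
  qed
qed

lemma restrict_vars_esym:
  assumes V: "finite V"
  shows "restrict_vars V (esym c :: 'a::comm_ring_1 mfps) = esym_in mvar V c"
proof (rule mfps_eqI)
  fix m
  let ?P = "\<lambda>S. mcoeff (\<Prod>i\<in>S. mvar i :: 'a mfps) m"
  have P: "S = Poly_Mapping.keys m" if "finite S" "?P S \<noteq> 0" for S
    using that keys_sum_single[OF that(1)] by (auto simp: mcoeff_prod_mvar split: if_splits)
  have fin: "finite {S. S \<subseteq> V \<and> int (card S) = c}"
    by (rule finite_subset[of _ "Pow V"]) (use V in auto)
  have rhs: "mcoeff (esym_in mvar V c :: 'a mfps) m = (\<Sum>S | S \<subseteq> V \<and> int (card S) = c. ?P S)"
    by (simp add: esym_in_def mcoeff_sum)
  show "mcoeff (restrict_vars V (esym c :: 'a mfps)) m = mcoeff (esym_in mvar V c) m"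
  proof (cases "Poly_Mapping.keys m \<subseteq> V \<and> c \<ge> 0")
    case True
    have "mcoeff (restrict_vars V (esym c :: 'a mfps)) m =
        (\<Sum>S\<in>{S \<in> {S. finite S \<and> card S = nat c}. ?P S \<noteq> 0}. ?P S)"
      using True by (simp add: mcoeff_restrict_vars esym_def msum_def)
    also have "\<dots> = (\<Sum>S | S \<subseteq> V \<and> int (card S) = c. ?P S)"
    proof (rule sum.mono_neutral_left[OF fin])
      show "{S \<in> {S. finite S \<and> card S = nat c}. ?P S \<noteq> 0} \<subseteq> {S. S \<subseteq> V \<and> int (card S) = c}"
        using True P by auto
      show "\<forall>S\<in>{S. S \<subseteq> V \<and> int (card S) = c} - {S \<in> {S. finite S \<and> card S = nat c}. ?P S \<noteq> 0}. ?P S = 0"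
        using V finite_subset by auto
    qed
    finally show ?thesis using rhs by simp
  next
    case False
    have "?P S = 0" if "S \<subseteq> V" "int (card S) = c" for S
    proof (rule ccontr)
      assume "?P S \<noteq> 0"
      then have "S = Poly_Mapping.keys m" using P that(1) V finite_subset by blast
      then show False using that False by simp
    qed
    then have "mcoeff (esym_in mvar V c :: 'a mfps) m = 0"
      unfolding rhs by (intro sum.neutral) auto
    then show ?thesis using False by (auto simp: mcoeff_restrict_vars esym_def mcoeff_0)
  qed
qed

lemma restrict_vars_fser:
  assumes V: "finite V"
  shows "restrict_vars V (fser r :: 'a::comm_ring_1 mfps) =
    (\<Sum>c\<in>{0..int (card V)}. esym_in mvar V c * esym_in mvar V (c + r))"
proof -
  interpret comm_ring_hom "restrict_vars V :: 'a mfps \<Rightarrow> 'a mfps" by (rule comm_ring_hom_restrict_vars)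
  have hom: "restrict_vars V (esym n * esym (n + r) :: 'a mfps) = esym_in mvar V n * esym_in mvar V (n + r)" for n
    by (simp add: hom_mult restrict_vars_esym[OF V])
  have zero: "restrict_vars V (esym n * esym (n + r) :: 'a mfps) = 0" if "n \<in> UNIV" "n \<notin> {0..int (card V)}" for n
    unfolding hom using esym_in_eq_0[OF V that(2), of "mvar :: nat \<Rightarrow> 'a mfps"] by simp
  note eq = finsupp_sum_eq_sum[OF finite_atLeastAtMost_int subset_UNIV zero]
  have "restrict_vars V (fser r :: 'a mfps) = finsupp_sum (\<lambda>n. restrict_vars V (esym n * esym (n + r))) UNIV"
    unfolding fser_def by (rule restrict_vars_msum) (rule eq(1))
  also have "\<dots> = (\<Sum>n\<in>{0..int (card V)}. restrict_vars V (esym n * esym (n + r)))" by (rule eq(2))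
  finally show ?thesis unfolding hom .
qed

section \<open>The two identities\<close>

lemma finsupp_sum_reindex:
  assumes "bij_betw h A B"
  shows "finite {x \<in> A. f (h x) \<noteq> 0} \<longleftrightarrow> finite {y \<in> B. f y \<noteq> 0}"
    and "finsupp_sum (\<lambda>x. f (h x)) A = finsupp_sum f B"
proof -
  have bij: "bij_betw h {x \<in> A. f (h x) \<noteq> 0} {y \<in> B. f y \<noteq> 0}"
    using assms unfolding bij_betw_def inj_on_def by blast
  show "finite {x \<in> A. f (h x) \<noteq> 0} \<longleftrightarrow> finite {y \<in> B. f y \<noteq> 0}"
    by (rule bij_betw_finite[OF bij])
  show "finsupp_sum (\<lambda>x. f (h x)) A = finsupp_sum f B"
    unfolding finsupp_sum_def by (rule sum.reindex_bij_betw[OF bij])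
qed

lemma partition_eq_0:
  assumes "p \<in> bounded_partitions n w" "n \<le> i"
  shows "p i = 0"
proof (rule ccontr)
  assume "p i \<noteq> 0"
  have p: "antimono p" "finite {i. p i > 0}" "card {i. p i > 0} \<le> n"
    using assms(1) by (auto simp: bounded_partitions_def is_partition_def plength_def)
  have "{..i} \<subseteq> {i. p i > 0}"
  proof
    fix j assume "j \<in> {..i}"
    then have "p i \<le> p j" using p(1) by (auto dest: antimonoD)
    then show "j \<in> {i. p i > 0}" using \<open>p i \<noteq> 0\<close> by simp
  qed
  then have "card {..i} \<le> card {i. p i > 0}" using p(2) by (rule card_mono[rotated])
  then show False using p(3) assms(2) by simp
qed

lemma alcove_step:
  assumes "l \<in> alcove n N" "i \<le> j" "j < n"
  shows "l j + int j \<le> l i + int i"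
  using assms(2,3)
proof (induction j rule: dec_induct)
  case (step j)
  have "l (Suc j) < l j" using alcove_less[OF assms(1), of j "Suc j"] step by simp
  then show ?case using step by simp
qed simp

text \<open>
  The strictly decreasing sequence \<open>\<lambda> i - i\<close> that encodes the first \<open>n\<close> parts of a partition.
\<close>

definition particles :: "nat \<Rightarrow> (nat \<Rightarrow> nat) \<Rightarrow> nat \<Rightarrow> int" where
  "particles n p = restrict (\<lambda>i. int (p i) - int i) {..<n}"

text \<open>
  The strict inequalities of the alcove correspond to the weak ones between the parts and to the
  bound on the difference of the first and the last part. The bound on the last coordinate says
  that the last part, and hence every part, is nonnegative.
\<close>

lemma bij_betw_particles:
  assumes n: "n > 0"
  shows "bij_betw (particles n) (bounded_partitions n w)
    {l \<in> alcove n (int (n + w)). - (int n - 1) \<le> l (n - 1)}"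
proof (rule bij_betwI[where g = "\<lambda>l i. if i < n then nat (l i + int i) else 0"])
  show "particles n \<in> bounded_partitions n w \<rightarrow> {l \<in> alcove n (int (n + w)). - (int n - 1) \<le> l (n - 1)}"
  proof
    fix p assume p: "p \<in> bounded_partitions n w"
    then have anti: "p j \<le> p i" if "i \<le> j" for i j
      using that by (auto simp: bounded_partitions_def is_partition_def dest: antimonoD)
    have wd: "int (p 0) - int (p (n - 1)) \<le> int w" using p by (simp add: bounded_partitions_def)
    have "particles n p \<in> alcove n (int (n + w))"
      unfolding alcove_def
    proof (intro CollectI conjI allI impI)
      fix i j assume ij: "i < j" "j < n"
      have "p j \<le> p i" "p i \<le> p 0" "p (n - 1) \<le> p j" using ij by (auto intro!: anti)
      then show "particles n p j < particles n p i" "particles n p i < particles n p j + int (n + w)"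
        using ij wd by (auto simp: particles_def)
    qed (simp add: particles_def)
    then show "particles n p \<in> {l \<in> alcove n (int (n + w)). - (int n - 1) \<le> l (n - 1)}"
      using n by (simp add: particles_def of_nat_diff)
  qed
  show "(\<lambda>l i. if i < n then nat (l i + int i) else 0) \<in>
      {l \<in> alcove n (int (n + w)). - (int n - 1) \<le> l (n - 1)} \<rightarrow> bounded_partitions n w"
  proof
    fix l assume "l \<in> {l \<in> alcove n (int (n + w)). - (int n - 1) \<le> l (n - 1)}"
    then have l: "l \<in> alcove n (int (n + w))" "- (int n - 1) \<le> l (n - 1)" by auto
    let ?p = "\<lambda>i. if i < n then nat (l i + int i) else 0"
    have anti: "antimono ?p"
    proof (rule antimonoI)
      fix i j :: nat assume "i \<le> j"
      then show "?p j \<le> ?p i" using alcove_step[OF l(1), of i j] by auto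
    qed
    have sub: "{i. ?p i > 0} \<subseteq> {..<n}" by auto
    have fin: "finite {i. ?p i > 0}" using sub by (rule finite_subset) simp
    have len: "plength ?p \<le> n" unfolding plength_def using card_mono[OF _ sub] by simp
    have wd: "int (?p 0) - int (?p (n - 1)) \<le> int w"
    proof (cases "n = 1")
      case False
      then have "l 0 < l (n - 1) + int (n + w)" using l(1) n by (auto simp: alcove_def)
      moreover have "l (n - 1) + int (n - 1) \<le> l 0 + int 0" using alcove_step[OF l(1), of 0 "n - 1"] n by simp
      ultimately show ?thesis using n l(2) by (simp add: of_nat_diff)
    qed simp
    show "?p \<in> bounded_partitions n w"
      unfolding bounded_partitions_def is_partition_def by (intro CollectI conjI anti fin len wd)
  qed
  show "(\<lambda>i. if i < n then nat (particles n p i + int i) else 0) = p" if "p \<in> bounded_partitions n w" for p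
    using partition_eq_0[OF that] by (auto simp: fun_eq_iff particles_def)
  show "particles n (\<lambda>i. if i < n then nat (l i + int i) else 0) = l"
    if "l \<in> {l \<in> alcove n (int (n + w)). - (int n - 1) \<le> l (n - 1)}" for l
  proof (rule extensionalityI[of _ "{..<n}"])
    fix i assume "i \<in> {..<n}"
    then have i: "i < n" by simp
    have "l (n - 1) + int (n - 1) \<le> l i + int i" using alcove_step[of l n _ i "n - 1"] that i by auto
    then have "0 \<le> l i + int i" using that n by (simp add: of_nat_diff)
    then show "particles n (\<lambda>i. if i < n then nat (l i + int i) else 0) i = l i"
      using i by (simp add: particles_def)
  qed (use that in \<open>auto simp: particles_def alcove_def\<close>)
qed

lemma restrict_vars_edet:
  assumes V: "finite V"
  shows "restrict_vars V (edet n N p k :: 'a::comm_ring_1 mfps) =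
    det (mat n n (\<lambda>(i, j). esym_in mvar V (particles n p i + int j + N * k i)))"
proof -
  interpret comm_ring_hom "restrict_vars V :: 'a mfps \<Rightarrow> 'a mfps" by (rule comm_ring_hom_restrict_vars)
  show ?thesis
    unfolding edet_def hom_det[symmetric]
  proof (intro arg_cong[of _ _ det] eq_matI)
    fix i j assume "i < dim_row (mat n n (\<lambda>(i, j). esym_in (mvar :: nat \<Rightarrow> 'a mfps) V (particles n p i + int j + N * k i)))"
      "j < dim_col (mat n n (\<lambda>(i, j). esym_in (mvar :: nat \<Rightarrow> 'a mfps) V (particles n p i + int j + N * k i)))"
    then have ij: "i < n" "j < n" by auto
    have "int (p i) - int (i + 1) + int (j + 1) + N * k i = particles n p i + int j + N * k i"
      using ij by (simp add: particles_def)
    then show "map_mat (restrict_vars V) (mat n n (\<lambda>(i, j). esym (int (p i) - int (i + 1) + int (j + 1) + N * k i))) $$ (i, j) =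
        mat n n (\<lambda>(i, j). esym_in mvar V (particles n p i + int j + N * k i)) $$ (i, j)"
      using ij by (simp only: index_map_mat index_mat dim_row_mat dim_col_mat prod.case restrict_vars_esym[OF V])
  qed auto
qed

text \<open>
  The left-hand side of both identities, for \<open>n\<close> rows and in finitely many variables.
\<close>

lemma restrict_vars_cylindric_sum:
  fixes n w :: nat and V :: "nat set"
  assumes n: "n > 0" and V: "finite V"
  defines "N \<equiv> int (n + w)"
  shows "finite {k \<in> zero_sum_tuples n. restrict_vars V (edet n N p k :: 'a::comm_ring_1 mfps) \<noteq> 0}"
    and "finite {p \<in> bounded_partitions n w. restrict_vars V (msum (edet n N p :: _ \<Rightarrow> 'a mfps) (zero_sum_tuples n)) \<noteq> 0}"
    and "finsupp_sum (\<lambda>p. restrict_vars V (msum (edet n N p :: _ \<Rightarrow> 'a mfps) (zero_sum_tuples n))) (bounded_partitions n w) =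
      minor_sum N {..<n} (\<lambda>j s. periodization N (parity_sign n) (int (card V)) (esym_in mvar V) (s + int j))"
proof -
  let ?M = "int (card V)" and ?e = "esym_in mvar V :: int \<Rightarrow> 'a mfps"
  have N: "N > 0" "int n \<le> N" using n by (auto simp: N_def)
  have supp: "?e c = 0" if "c \<notin> {0..?M}" for c by (rule esym_in_eq_0[OF V that])
  note det_sum = finsupp_sum_det_eq_orbit_sum[where e = ?e and n = n, OF N(1) supp]
  show fin: "finite {k \<in> zero_sum_tuples n. restrict_vars V (edet n N p k :: 'a mfps) \<noteq> 0}" for p
    unfolding restrict_vars_edet[OF V] by (rule det_sum(1))
  have orbit: "restrict_vars V (msum (edet n N p :: _ \<Rightarrow> 'a mfps) (zero_sum_tuples n)) = orbit_sum n N ?M ?e (particles n p)" for p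
    unfolding restrict_vars_msum[OF fin] restrict_vars_edet[OF V] by (rule det_sum(2))
  note bij = bij_betw_particles[OF n, of w, folded N_def]
  note total = finsupp_sum_orbit_sum[OF V order.refl n N(2), of "mvar :: nat \<Rightarrow> 'a mfps"]
  show "finite {p \<in> bounded_partitions n w. restrict_vars V (msum (edet n N p :: _ \<Rightarrow> 'a mfps) (zero_sum_tuples n)) \<noteq> 0}"
    unfolding orbit finsupp_sum_reindex(1)[OF bij] by (rule total(1))
  show "finsupp_sum (\<lambda>p. restrict_vars V (msum (edet n N p :: _ \<Rightarrow> 'a mfps) (zero_sum_tuples n))) (bounded_partitions n w) =
      minor_sum N {..<n} (\<lambda>j s. periodization N (parity_sign n) ?M ?e (s + int j))"
    unfolding orbit finsupp_sum_reindex(2)[OF bij] by (rule total(2))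
qed

lemma restrict_vars_fser_eq_0:
  assumes V: "finite V" and r: "\<bar>r\<bar> > int (card V)"
  shows "restrict_vars V (fser r :: 'a::comm_ring_1 mfps) = 0"
  unfolding restrict_vars_fser[OF V]
proof (rule sum.neutral, rule ballI)
  fix c assume "c \<in> {0..int (card V)}"
  then have "c + r \<notin> {0..int (card V)}" using r by auto
  from esym_in_eq_0[OF V this, of "mvar :: nat \<Rightarrow> 'a mfps"] show "esym_in mvar V c * (esym_in mvar V (c + r) :: 'a mfps) = 0" by simp
qed

text \<open>
  Only the translations \<open>k\<close> in a box contribute to the sums over all tuples of integers.
\<close>

lemma translate_bound:
  fixes N k r :: int
  assumes "N > 0" "\<bar>r + N * k\<bar> \<le> M"
  shows "k \<in> {- (M + \<bar>r\<bar>)..M + \<bar>r\<bar>}"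
proof -
  have "1 * \<bar>k\<bar> \<le> \<bar>N\<bar> * \<bar>k\<bar>" using assms(1) by (intro mult_right_mono) auto
  then have "\<bar>k\<bar> \<le> \<bar>N * k\<bar>" by (simp add: abs_mult)
  moreover have "\<bar>N * k\<bar> \<le> M + \<bar>r\<bar>" using assms(2) by linarith
  ultimately show ?thesis by auto
qed

lemma translate_far:
  fixes N k r :: int
  assumes "N > 0" "M + \<bar>r\<bar> \<le> B" "k \<notin> {- B..B}"
  shows "\<bar>r + N * k\<bar> > M"
proof (rule ccontr)
  assume "\<not> \<bar>r + N * k\<bar> > M"
  then have "k \<in> {- (M + \<bar>r\<bar>)..M + \<bar>r\<bar>}" using assms(1) by (intro translate_bound) auto
  then show False using assms(2,3) by auto
qed

lemma corr_eq_sum_fser: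
  fixes \<eta> :: "'a::comm_ring_1 mfps"
  assumes V: "finite V" and N: "N > 0" and \<eta>: "\<eta> * \<eta> = 1" and B: "int (card V) + \<bar>r\<bar> \<le> B"
  shows "cyclic_sequence.corr N (periodization N \<eta> (int (card V)) (esym_in mvar V)) r =
    (\<Sum>k\<in>{- B..B}. ipow \<eta> k * restrict_vars V (fser (r + N * k)))"
  unfolding restrict_vars_fser[OF V]
proof (rule corr_periodization[OF N \<eta>])
  fix c k assume "c \<in> {0..int (card V)}" "c + r + N * k \<in> {0..int (card V)}"
  then have "\<bar>r + N * k\<bar> \<le> int (card V)" by auto
  from translate_bound[OF N this] show "k \<in> {- B..B}" using B by auto
qed (auto intro: esym_in_eq_0[OF V])

lemma restrict_vars_fdet_minus:
  fixes h :: nat and N :: int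
  assumes V: "finite V" and N: "N > 0"
  shows "finite {k \<in> int_tuples h. restrict_vars V (fdet_minus h N k :: 'a::comm_ring_1 mfps) \<noteq> 0}"
    and "restrict_vars V (msum (fdet_minus h N :: _ \<Rightarrow> 'a mfps) (int_tuples h)) =
      det (mat h h (\<lambda>(i, j).
        cyclic_sequence.corr N (periodization N 1 (int (card V)) (esym_in mvar V)) (int j - int i)
        - cyclic_sequence.corr N (periodization N 1 (int (card V)) (esym_in mvar V)) (int i + int j + 2)))"
proof -
  interpret comm_ring_hom "restrict_vars V :: 'a mfps \<Rightarrow> 'a mfps" by (rule comm_ring_hom_restrict_vars)
  let ?f = "\<lambda>r. restrict_vars V (fser r) :: 'a mfps"
  \<comment> \<open>The offsets \<open>j - i\<close> and \<open>i + j + 2\<close> are at most \<open>2 * h\<close>, and \<open>f\<close> vanishes beyond the number of variables.\<close>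
  define B where "B = int (card V) + 2 * int h"
  define A where "A i j k = ?f (int j - int i + N * k) - ?f (int i + int j + 2 + N * k)" for i j :: nat and k
  have A: "A i j k = 0" if "i < h" "j < h" "k \<notin> {- B..B}" for i j k
  proof -
    have "\<bar>int j - int i\<bar> \<le> 2 * int h" "\<bar>int i + int j + 2\<bar> \<le> 2 * int h" using that by linarith+
    then have "?f (r + N * k) = 0" if "r = int j - int i \<or> r = int i + int j + 2" for r
      using that \<open>k \<notin> {- B..B}\<close>
      by (intro restrict_vars_fser_eq_0[OF V] translate_far[OF N, of _ _ B]) (auto simp: B_def)
    then show ?thesis by (simp add: A_def)
  qed
  have D: "restrict_vars V (fdet_minus h N k :: 'a mfps) = (\<Prod>i<h. 1) * det (mat h h (\<lambda>(i, j). A i j (k i)))" for k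
  proof -
    have "restrict_vars V (fdet_minus h N k :: 'a mfps) = det (map_mat (restrict_vars V) (mat h h (\<lambda>(i, j).
        fser (- int (i + 1) + int (j + 1) + N * k i) - fser (int (i + 1) + int (j + 1) + N * k i))))"
      unfolding fdet_minus_def by (rule hom_det[symmetric])
    also have "map_mat (restrict_vars V) (mat h h (\<lambda>(i, j).
        fser (- int (i + 1) + int (j + 1) + N * k i) - fser (int (i + 1) + int (j + 1) + N * k i))) =
        mat h h (\<lambda>(i, j). A i j (k i))"
      by (rule eq_matI) (auto simp: A_def hom_minus algebra_simps)
    finally show ?thesis by simp
  qed
  note rows = finsupp_sum_det_rows[OF finite_atLeastAtMost_int A, where u = "\<lambda>_. 1"]
  show fin: "finite {k \<in> int_tuples h. restrict_vars V (fdet_minus h N k :: 'a mfps) \<noteq> 0}"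
    unfolding D by (rule rows(1))
  have "restrict_vars V (msum (fdet_minus h N :: _ \<Rightarrow> 'a mfps) (int_tuples h)) =
      det (mat h h (\<lambda>(i, j). \<Sum>k\<in>{- B..B}. 1 * A i j k))"
    unfolding restrict_vars_msum[OF fin] D by (rule rows(2))
  also have "mat h h (\<lambda>(i, j). \<Sum>k\<in>{- B..B}. 1 * A i j k) = mat h h (\<lambda>(i, j).
        cyclic_sequence.corr N (periodization N 1 (int (card V)) (esym_in mvar V)) (int j - int i)
        - cyclic_sequence.corr N (periodization N 1 (int (card V)) (esym_in mvar V)) (int i + int j + 2))"
  proof (rule eq_matI, simp_all)
    fix i j assume ij: "i < h" "j < h"
    have "ipow 1 k = (1 :: 'a mfps)" for k by (simp add: ipow_def)
    moreover have "\<bar>int j - int i\<bar> \<le> 2 * int h" using ij by linarith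
    ultimately show "sum (A i j) {- B..B} =
        cyclic_sequence.corr N (periodization N 1 (int (card V)) (esym_in mvar V)) (int j - int i)
        - cyclic_sequence.corr N (periodization N 1 (int (card V)) (esym_in mvar V)) (int i + int j + 2)"
      using corr_eq_sum_fser[OF V N, of "1 :: 'a mfps" "int j - int i" B] corr_eq_sum_fser[OF V N, of "1 :: 'a mfps" "int i + int j + 2" B] ij
      by (simp add: A_def B_def sum_subtractf)
  qed
  finally show "restrict_vars V (msum (fdet_minus h N :: _ \<Rightarrow> 'a mfps) (int_tuples h)) =
      det (mat h h (\<lambda>(i, j).
        cyclic_sequence.corr N (periodization N 1 (int (card V)) (esym_in mvar V)) (int j - int i)
        - cyclic_sequence.corr N (periodization N 1 (int (card V)) (esym_in mvar V)) (int i + int j + 2)))" .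
qed

lemma restrict_vars_fdet_plus:
  fixes h :: nat and N :: int
  assumes V: "finite V" and N: "N > 0"
  defines "D \<equiv> \<lambda>k. neg_one_pow (\<Sum>i<h. k i) * fdet_plus h N k :: 'a::comm_ring_1 mfps"
  shows "finite {k \<in> int_tuples h. restrict_vars V (D k) \<noteq> 0}"
    and "restrict_vars V (msum D (int_tuples h)) =
      det (mat h h (\<lambda>(i, j).
        cyclic_sequence.corr N (periodization N (- 1) (int (card V)) (esym_in mvar V)) (int j - int i)
        + cyclic_sequence.corr N (periodization N (- 1) (int (card V)) (esym_in mvar V)) (int i + int j + 1)))"
proof -
  interpret comm_ring_hom "restrict_vars V :: 'a mfps \<Rightarrow> 'a mfps" by (rule comm_ring_hom_restrict_vars)
  let ?f = "\<lambda>r. restrict_vars V (fser r) :: 'a mfps"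
  define B where "B = int (card V) + 2 * int h"
  define A where "A i j k = ?f (int j - int i + N * k) + ?f (int i + int j + 1 + N * k)" for i j :: nat and k
  have A: "A i j k = 0" if "i < h" "j < h" "k \<notin> {- B..B}" for i j k
  proof -
    have "\<bar>int j - int i\<bar> \<le> 2 * int h" "\<bar>int i + int j + 1\<bar> \<le> 2 * int h" using that by linarith+
    then have "?f (r + N * k) = 0" if "r = int j - int i \<or> r = int i + int j + 1" for r
      using that \<open>k \<notin> {- B..B}\<close>
      by (intro restrict_vars_fser_eq_0[OF V] translate_far[OF N, of _ _ B]) (auto simp: B_def)
    then show ?thesis by (simp add: A_def)
  qed
  have D: "restrict_vars V (D k) = (\<Prod>i<h. ipow (- 1) (k i)) * det (mat h h (\<lambda>(i, j). A i j (k i)))" for k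
  proof -
    have "restrict_vars V (fdet_plus h N k :: 'a mfps) = det (map_mat (restrict_vars V) (mat h h (\<lambda>(i, j).
        fser (- int (i + 1) + int (j + 1) + N * k i) + fser (int (i + 1) + int (j + 1) - 1 + N * k i))))"
      unfolding fdet_plus_def by (rule hom_det[symmetric])
    also have "map_mat (restrict_vars V) (mat h h (\<lambda>(i, j).
        fser (- int (i + 1) + int (j + 1) + N * k i) + fser (int (i + 1) + int (j + 1) - 1 + N * k i))) =
        mat h h (\<lambda>(i, j). A i j (k i))"
      by (rule eq_matI) (auto simp: A_def hom_add algebra_simps)
    finally have "restrict_vars V (fdet_plus h N k :: 'a mfps) = det (mat h h (\<lambda>(i, j). A i j (k i)))" .
    moreover have "restrict_vars V (neg_one_pow s) = ipow (- 1 :: 'a mfps) s" for s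
      by (simp add: neg_one_pow_def ipow_def hom_uminus)
    moreover have "ipow (- 1) (\<Sum>i<h. k i) = (\<Prod>i<h. ipow (- 1 :: 'a mfps) (k i))" by (rule ipow_sum) simp
    ultimately show ?thesis unfolding D_def hom_mult by metis
  qed
  note rows = finsupp_sum_det_rows[OF finite_atLeastAtMost_int A, where u = "ipow (- 1)"]
  show fin: "finite {k \<in> int_tuples h. restrict_vars V (D k) \<noteq> 0}"
    unfolding D by (rule rows(1))
  have "restrict_vars V (msum D (int_tuples h)) = det (mat h h (\<lambda>(i, j). \<Sum>k\<in>{- B..B}. ipow (- 1) k * A i j k))"
    unfolding restrict_vars_msum[OF fin] D by (rule rows(2))
  also have "mat h h (\<lambda>(i, j). \<Sum>k\<in>{- B..B}. ipow (- 1) k * A i j k) = mat h h (\<lambda>(i, j).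
        cyclic_sequence.corr N (periodization N (- 1) (int (card V)) (esym_in mvar V)) (int j - int i)
        + cyclic_sequence.corr N (periodization N (- 1) (int (card V)) (esym_in mvar V)) (int i + int j + 1))"
  proof (rule eq_matI, simp_all)
    fix i j assume ij: "i < h" "j < h"
    have "\<bar>int j - int i\<bar> \<le> 2 * int h" using ij by linarith
    then show "(\<Sum>k = - B..B. ipow (- 1) k * A i j k) =
        cyclic_sequence.corr N (periodization N (- 1) (int (card V)) (esym_in mvar V)) (int j - int i)
        + cyclic_sequence.corr N (periodization N (- 1) (int (card V)) (esym_in mvar V)) (int i + int j + 1)"
      using corr_eq_sum_fser[OF V N, of "- 1 :: 'a mfps" "int j - int i" B] corr_eq_sum_fser[OF V N, of "- 1 :: 'a mfps" "int i + int j + 1" B] ij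
      by (simp add: A_def B_def distrib_left sum.distrib)
  qed
  finally show "restrict_vars V (msum D (int_tuples h)) =
      det (mat h h (\<lambda>(i, j).
        cyclic_sequence.corr N (periodization N (- 1) (int (card V)) (esym_in mvar V)) (int j - int i)
        + cyclic_sequence.corr N (periodization N (- 1) (int (card V)) (esym_in mvar V)) (int i + int j + 1)))" .
qed

lemma restrict_vars_esym_series:
  fixes F :: "'a::comm_ring_1 mfps"
  assumes V: "finite V"
  shows "finite {m \<in> UNIV. restrict_vars V (esym (int m) * F) \<noteq> 0}"
    and "restrict_vars V (msum (\<lambda>m. esym (int m) * F) UNIV) = (\<Sum>c\<in>{0..int (card V)}. esym_in mvar V c) * restrict_vars V F"
proof -
  interpret comm_ring_hom "restrict_vars V :: 'a mfps \<Rightarrow> 'a mfps" by (rule comm_ring_hom_restrict_vars)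
  have hom: "restrict_vars V (esym (int m) * F) = esym_in mvar V (int m) * restrict_vars V F" for m
    by (simp add: hom_mult restrict_vars_esym[OF V])
  have zero: "restrict_vars V (esym (int m) * F) = 0" if "m \<in> UNIV" "m \<notin> {..card V}" for m
  proof -
    have "int m \<notin> {0..int (card V)}" using that by simp
    then show ?thesis unfolding hom using esym_in_eq_0[OF V, of "int m" "mvar :: nat \<Rightarrow> 'a mfps"] by simp
  qed
  note eq = finsupp_sum_eq_sum[OF finite_atMost subset_UNIV zero]
  show "finite {m \<in> UNIV. restrict_vars V (esym (int m) * F) \<noteq> 0}" by (rule eq(1))
  have "restrict_vars V (msum (\<lambda>m. esym (int m) * F) UNIV) = finsupp_sum (\<lambda>m. restrict_vars V (esym (int m) * F)) UNIV"
    by (rule restrict_vars_msum) (rule eq(1))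
  also have "\<dots> = (\<Sum>m\<in>{..card V}. restrict_vars V (esym (int m) * F))" by (rule eq(2))
  also have "\<dots> = (\<Sum>c\<in>{0..int (card V)}. esym_in mvar V c * restrict_vars V F)"
    unfolding hom by (rule sum.reindex_bij_witness[of _ nat int]) auto
  finally show "restrict_vars V (msum (\<lambda>m. esym (int m) * F) UNIV) = (\<Sum>c\<in>{0..int (card V)}. esym_in mvar V c) * restrict_vars V F"
    by (simp add: sum_distrib_right)
qed

theorem theorem1p2:
  fixes h w :: nat
  assumes "h > 0" and "w > 0"
  shows
    "(let n = 2 * h + 1; N = int (2 * h + w + 1);
          P = bounded_partitions n w; Z = zero_sum_tuples n; K = int_tuples h in
        (\<forall>p \<in> P. msummable (edet n N p :: _ \<Rightarrow> 'a::comm_ring_1 mfps) Z) \<and>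
        msummable (\<lambda>p. msum (edet n N p :: _ \<Rightarrow> 'a mfps) Z) P \<and>
        msummable (fdet_minus h N :: _ \<Rightarrow> 'a mfps) K \<and>
        msummable (\<lambda>m. esym (int m) * msum (fdet_minus h N :: _ \<Rightarrow> 'a mfps) K) UNIV \<and>
        msum (\<lambda>p. msum (\<lambda>k. edet n N p k :: 'a mfps) Z) P
          = msum (\<lambda>m. esym (int m) * msum (\<lambda>k. fdet_minus h N k) K) UNIV)
     \<and>
     (let n = 2 * h; N = int (2 * h + w);
          P = bounded_partitions n w; Z = zero_sum_tuples n; K = int_tuples h in
        (\<forall>p \<in> P. msummable (edet n N p :: _ \<Rightarrow> 'a mfps) Z) \<and>
        msummable (\<lambda>p. msum (edet n N p :: _ \<Rightarrow> 'a mfps) Z) P \<and>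
        msummable (\<lambda>k. neg_one_pow (\<Sum>i<h. k i) * fdet_plus h N k :: 'a mfps) K \<and>
        msum (\<lambda>p. msum (\<lambda>k. edet n N p k :: 'a mfps) Z) P
          = msum (\<lambda>k. neg_one_pow (\<Sum>i<h. k i) * fdet_plus h N k) K)"
  unfolding Let_def
proof (intro conjI ballI)
  have N: "int (2 * h + 1 + w) = int (2 * h + w + 1)" "int (2 * h + w + 1) > 0" and n: "2 * h + 1 > 0" by auto
  note lhs = restrict_vars_cylindric_sum[where n = "2 * h + 1" and w = w, OF n, unfolded N(1)]
  show "msummable (edet (2 * h + 1) (int (2 * h + w + 1)) p :: _ \<Rightarrow> 'a mfps) (zero_sum_tuples (2 * h + 1))" for p
    by (rule msummable_restrict_vars) (rule lhs(1))
  show s1: "msummable (\<lambda>p. msum (edet (2 * h + 1) (int (2 * h + w + 1)) p :: _ \<Rightarrow> 'a mfps) (zero_sum_tuples (2 * h + 1)))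
      (bounded_partitions (2 * h + 1) w)"
    by (rule msummable_restrict_vars) (rule lhs(2))
  show "msummable (fdet_minus h (int (2 * h + w + 1)) :: _ \<Rightarrow> 'a mfps) (int_tuples h)"
    by (rule msummable_restrict_vars) (rule restrict_vars_fdet_minus(1)[OF _ N(2)])
  show "msummable (\<lambda>m. esym (int m) * msum (fdet_minus h (int (2 * h + w + 1)) :: _ \<Rightarrow> 'a mfps) (int_tuples h)) UNIV"
    by (rule msummable_restrict_vars) (rule restrict_vars_esym_series(1))
  show "msum (\<lambda>p. msum (\<lambda>k. edet (2 * h + 1) (int (2 * h + w + 1)) p k :: 'a mfps) (zero_sum_tuples (2 * h + 1)))
        (bounded_partitions (2 * h + 1) w) =
      msum (\<lambda>m. esym (int m) * msum (\<lambda>k. fdet_minus h (int (2 * h + w + 1)) k) (int_tuples h)) UNIV"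
  proof (rule mfps_eq_restrict_vars)
    fix V :: "nat set" assume V: "finite V"
    let ?N = "int (2 * h + w + 1)"
    let ?E = "periodization ?N 1 (int (card V)) (esym_in mvar V) :: int \<Rightarrow> 'a mfps"
    interpret E: cyclic_sequence ?N 1 ?E by (rule cyclic_sequence_periodization) simp_all
    have "restrict_vars V (msum (\<lambda>p. msum (edet (2 * h + 1) ?N p :: _ \<Rightarrow> 'a mfps) (zero_sum_tuples (2 * h + 1)))
        (bounded_partitions (2 * h + 1) w)) =
        minor_sum ?N {..<2 * h + 1} (\<lambda>j s. periodization ?N (parity_sign (2 * h + 1)) (int (card V)) (esym_in mvar V) (s + int j))"
      unfolding restrict_vars_msum[OF lhs(2)[OF V]] by (rule lhs(3)[OF V])
    also have "\<dots> = minor_sum ?N {..<2 * h + 1} (\<lambda>j s. ?E (s + int j))"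
      by (simp add: parity_sign_def)
    also have "\<dots> = (\<Sum>s\<in>{0..<?N}. ?E s) *
        det (mat h h (\<lambda>(i, j). E.corr (int j - int i) - E.corr (int i + int j + 2)))"
      by (rule E.minor_sum_odd) (rule refl)
    also have "\<dots> = restrict_vars V (msum (\<lambda>m. esym (int m) * msum (fdet_minus h ?N :: _ \<Rightarrow> 'a mfps) (int_tuples h)) UNIV)"
      unfolding restrict_vars_esym_series(2)[OF V] restrict_vars_fdet_minus(2)[OF V N(2)] sum_periodization[OF N(2)] ..
    finally show "restrict_vars V (msum (\<lambda>p. msum (\<lambda>k. edet (2 * h + 1) ?N p k :: 'a mfps) (zero_sum_tuples (2 * h + 1)))
        (bounded_partitions (2 * h + 1) w)) =
        restrict_vars V (msum (\<lambda>m. esym (int m) * msum (\<lambda>k. fdet_minus h ?N k) (int_tuples h)) UNIV)" .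
  qed
next
  have N: "int (2 * h + w) > 0" and n: "2 * h > 0" using assms by auto
  note lhs = restrict_vars_cylindric_sum[where n = "2 * h" and w = w, OF n]
  show "msummable (edet (2 * h) (int (2 * h + w)) p :: _ \<Rightarrow> 'a mfps) (zero_sum_tuples (2 * h))" for p
    by (rule msummable_restrict_vars) (rule lhs(1))
  show "msummable (\<lambda>p. msum (edet (2 * h) (int (2 * h + w)) p :: _ \<Rightarrow> 'a mfps) (zero_sum_tuples (2 * h)))
      (bounded_partitions (2 * h) w)"
    by (rule msummable_restrict_vars) (rule lhs(2))
  show "msummable (\<lambda>k. neg_one_pow (\<Sum>i<h. k i) * fdet_plus h (int (2 * h + w)) k :: 'a mfps) (int_tuples h)"
    by (rule msummable_restrict_vars) (rule restrict_vars_fdet_plus(1)[OF _ N])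
  show "msum (\<lambda>p. msum (\<lambda>k. edet (2 * h) (int (2 * h + w)) p k :: 'a mfps) (zero_sum_tuples (2 * h)))
        (bounded_partitions (2 * h) w) =
      msum (\<lambda>k. neg_one_pow (\<Sum>i<h. k i) * fdet_plus h (int (2 * h + w)) k) (int_tuples h)"
  proof (rule mfps_eq_restrict_vars)
    fix V :: "nat set" assume V: "finite V"
    let ?N = "int (2 * h + w)"
    let ?E = "periodization ?N (- 1) (int (card V)) (esym_in mvar V) :: int \<Rightarrow> 'a mfps"
    interpret E: cyclic_sequence ?N "- 1" ?E by (rule cyclic_sequence_periodization) (use N in simp_all)
    have "restrict_vars V (msum (\<lambda>p. msum (edet (2 * h) ?N p :: _ \<Rightarrow> 'a mfps) (zero_sum_tuples (2 * h)))
        (bounded_partitions (2 * h) w)) =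
        minor_sum ?N {..<2 * h} (\<lambda>j s. periodization ?N (parity_sign (2 * h)) (int (card V)) (esym_in mvar V) (s + int j))"
      unfolding restrict_vars_msum[OF lhs(2)[OF V]] by (rule lhs(3)[OF V])
    also have "\<dots> = minor_sum ?N {..<2 * h} (\<lambda>j s. ?E (s + int j))"
      by (simp add: parity_sign_def)
    also have "\<dots> = det (mat h h (\<lambda>(i, j). E.corr (int j - int i) + E.corr (int i + int j + 1)))"
      by (rule E.minor_sum_even) (rule refl)
    also have "\<dots> = restrict_vars V (msum (\<lambda>k. neg_one_pow (\<Sum>i<h. k i) * fdet_plus h ?N k) (int_tuples h))"
      by (rule restrict_vars_fdet_plus(2)[OF V N, symmetric])
    finally show "restrict_vars V (msum (\<lambda>p. msum (\<lambda>k. edet (2 * h) ?N p k :: 'a mfps) (zero_sum_tuples (2 * h)))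
        (bounded_partitions (2 * h) w)) =
        restrict_vars V (msum (\<lambda>k. neg_one_pow (\<Sum>i<h. k i) * fdet_plus h ?N k) (int_tuples h))" .
  qed
qed

end
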